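(* Let $K \subset \bar F$ be a quadratic extension of $F$. (i) If $K/F$ is unramified, then $\rho_2(K) = \frac{q^2-q+1}{q^2+q+1}$ and, for all $n \geq 3$, $\rho_n(K) = \frac{q^4+1}{q^4+q^3+q^2+q+1}$. (ii) If $K/F$ is totally ramified, then $\rho_2(K) = \|D_K\|\cdot\frac{q^2}{q^2+q+1}$ and, for all $n\geq 3$, $\rho_n(K) = \|D_K\|\cdot \frac{q^2(q^2+1)}{q^4+q^3+q^2+q+1}$.
   Context: Let $p$ be a prime, $F$ a finite extension of $\mathbb{Q}_p$ with ring of integers $\mathcal{O}_F$ and residue field of cardinality $q$, and $\bar F$ an algebraic closure of $F$. Let $\|\cdot\|$ be the absolute value on $\bar F$ normalized by $\|p\| = p^{-[F:\mathbb{Q}_p]}$. For $m \geq 0$, $\Omega_m$ is the set of polynomials of degree at most $m$ with coefficients in $\mathcal{O}_F$, identified with $\mathcal{O}_F^{m+1}$ with the probability measure $\lambda_F^{\otimes(m+1)}$ ($\lambda_F(\mathcal{O}_F)=1$). For a finite extension $K$ of $F$ of degree $r$, $\lambda_K$ is the Haar measure with $\lambda_K(\mathcal{O}_K)=1$, $D_K$ is the discriminant of $K/F$, and $\rho_{K,n}:K\to\mathbb{R}_{\ge0}$ is defined by: for $x\in\mathcal{O}_K$, $\rho_{K,n}(x)=\frac{\|D_K\|}{\#(\mathcal{O}_K/\mathcal{O}_F[x])}\int_{\Omega_{n-r}}\|Q(x)\|^r\,dQ$ if $n\ge r$ and $F[x]=K$, and $0$ otherwise; for $x\notin\mathcal{O}_K$,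 $\rho_{K,n}(x)=\|x\|^{-2r}\rho_{K,n}(x^{-1})$. Finally $\rho_n(K) = \int_K \rho_{K,n}(x)\,d\lambda_K(x)$. *)

theory Defs
  imports
    "HOL-Analysis.Analysis"
    "HOL-Algebra.Algebraic_Closure_Type"
    "Jordan_Normal_Form.Determinant"
begin

text \<open>
  All fields are subfields of one ambient field, the type \<^typ>\<open>'a\<close>, which plays the role
  of the algebraic closure of \<open>F\<close>.
\<close>

abbreviation ambient :: "'a::field ring"
  where "ambient \<equiv> ring_of_type_algebra"

abbreviation ext_degree :: "'a::field set \<Rightarrow> 'a set \<Rightarrow> nat"
  where "ext_degree F K \<equiv> ring.dim ambient F K"


subsection \<open>Absolute values and the field of p-adic numbers\<close>

definition nonarch_abs :: "('a::field \<Rightarrow> real) \<Rightarrow> bool"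
  where "nonarch_abs v \<longleftrightarrow>
    (\<forall>x. 0 \<le> v x) \<and> (\<forall>x. v x = 0 \<longleftrightarrow> x = 0) \<and>
    (\<forall>x y. v (x * y) = v x * v y) \<and> (\<forall>x y. v (x + y) \<le> max (v x) (v y))"

abbreviation abs_topology :: "('a::field \<Rightarrow> real) \<Rightarrow> 'a set \<Rightarrow> 'a topology"
  where "abs_topology v K \<equiv> Metric_space.mtopology K (\<lambda>x y. v (x - y))"

lemma Metric_space_nonarch_abs:
  assumes "nonarch_abs v"
  shows "Metric_space K (\<lambda>x y. v (x - y))"
proof
  have nonneg: "0 \<le> v x" and mult: "v (x * y) = v x * v y"
    and zero: "v x = 0 \<longleftrightarrow> x = 0" and ultra: "v (x + y) \<le> max (v x) (v y)" for x y
    using assms unfolding nonarch_abs_def by blast+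
  have "v 1 * v 1 = v 1" "v 1 \<noteq> 0"
    using mult[of 1 1] zero[of 1] by auto
  hence v1: "v 1 = 1"
    by simp
  have "v (-1) * v (-1) = 1"
    using mult[of "-1" "-1"] v1 by simp
  hence vm1: "v (-1) = 1"
    using nonneg[of "-1"] by (metis abs_of_nonneg abs_1 abs_mult_self_eq power2_eq_1_iff
        power2_eq_square abs_minus_cancel)
  show "0 \<le> v (x - y)" for x y
    by (rule nonneg)
  show "v (x - y) = v (y - x)" for x y
    using mult[of "-1" "y - x"] vm1 by simp
  show "v (x - y) = 0 \<longleftrightarrow> x = y" for x y
    using zero[of "x - y"] by simp
  show "v (x - z) \<le> v (x - y) + v (y - z)" for x y z
    using ultra[of "x - y" "y - z"] nonneg[of "x - y"] nonneg[of "y - z"] by simp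
qed

definition padic_abs :: "nat \<Rightarrow> rat \<Rightarrow> real"
  where "padic_abs p x = (if x = 0 then 0 else
    real p powi (int (multiplicity (int p) (snd (quotient_of x)))
                 - int (multiplicity (int p) (fst (quotient_of x)))))"

text \<open>
  \<open>Qp\<close>, with the restriction of \<open>v\<close>, is the completion of the rationals with respect to the
  p-adic absolute value. The exponent \<open>s\<close> leaves the normalization of \<open>v\<close> open.
\<close>

definition is_padic_numbers :: "nat \<Rightarrow> ('a::field_char_0 \<Rightarrow> real) \<Rightarrow> 'a set \<Rightarrow> bool"
  where "is_padic_numbers p v Qp \<longleftrightarrow>
    subfield Qp ambient \<and>
    (\<exists>s>0. \<forall>x. v (of_rat x) = padic_abs p x powr s) \<and>
    Metric_space.mcomplete Qp (\<lambda>x y. v (x - y)) \<and>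
    abs_topology v Qp closure_of \<rat> = Qp"

text \<open>
  \<open>F\<close> is a finite extension of the field of p-adic numbers, the type \<^typ>\<open>'a\<close> is an algebraic
  closure of \<open>F\<close>, and \<open>v\<close> is the absolute value on it that extends the p-adic one, normalized
  according to \<open>F\<close>. Since \<open>Qp\<close> is complete, this determines \<open>v\<close>.
\<close>

definition padic_setting :: "nat \<Rightarrow> 'a::field_char_0 set \<Rightarrow> 'a set \<Rightarrow> ('a \<Rightarrow> real) \<Rightarrow> bool"
  where "padic_setting p Qp F v \<longleftrightarrow>
    Factorial_Ring.prime p \<and> nonarch_abs v \<and> is_padic_numbers p v Qp \<and>
    subfield F ambient \<and> Qp \<subseteq> F \<and> ring.finite_dimension ambient Qp F \<and>
    algebraic_closure ambient F \<and>
    v (of_nat p) = 1 / real p ^ ext_degree Qp F"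


subsection \<open>Integers, residue field, ramification\<close>

definition int_ring :: "('a::field \<Rightarrow> real) \<Rightarrow> 'a set \<Rightarrow> 'a set"
  where "int_ring v K = {x \<in> K. v x \<le> 1}"

definition max_ideal :: "('a::field \<Rightarrow> real) \<Rightarrow> 'a set \<Rightarrow> 'a set"
  where "max_ideal v K = {x \<in> K. v x < 1}"

definition add_index :: "'a::ab_group_add set \<Rightarrow> 'a set \<Rightarrow> nat"
  where "add_index A B = card (A // {(x, y). x \<in> A \<and> y \<in> A \<and> x - y \<in> B})"

definition residue_card :: "('a::field \<Rightarrow> real) \<Rightarrow> 'a set \<Rightarrow> nat"
  where "residue_card v K = add_index (int_ring v K) (max_ideal v K)"

text \<open>The index of the value group of \<open>F\<close> in that of \<open>K\<close>.\<close>

definition ramification_index :: "('a::field \<Rightarrow> real) \<Rightarrow> 'a set \<Rightarrow> 'a set \<Rightarrow> nat"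
  where "ramification_index v F K =
    card ((v ` (K - {0})) //
      {(s, t). s \<in> v ` (K - {0}) \<and> t \<in> v ` (K - {0}) \<and> s / t \<in> v ` (F - {0})})"

text \<open>
  Residue fields are finite here, so no separability condition on the residue extension is needed.
\<close>

definition unramified :: "('a::field \<Rightarrow> real) \<Rightarrow> 'a set \<Rightarrow> 'a set \<Rightarrow> bool"
  where "unramified v F K \<longleftrightarrow> ramification_index v F K = 1"

definition totally_ramified :: "('a::field \<Rightarrow> real) \<Rightarrow> 'a set \<Rightarrow> 'a set \<Rightarrow> bool"
  where "totally_ramified v F K \<longleftrightarrow> ramification_index v F K = ext_degree F K"


subsection \<open>Trace and discriminant\<close>

text \<open>\<open>e 0, \<dots>, e (r - 1)\<close> is a basis of the free \<open>A\<close>-module \<open>M\<close>.\<close>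

definition is_basis :: "'a::comm_ring_1 set \<Rightarrow> 'a set \<Rightarrow> nat \<Rightarrow> (nat \<Rightarrow> 'a) \<Rightarrow> bool"
  where "is_basis A M r e \<longleftrightarrow>
    bij_betw (\<lambda>c. \<Sum>i<r. c i * e i) ({..<r} \<rightarrow>\<^sub>E A) M"

text \<open>The trace of the matrix, in any basis, of multiplication by \<open>a\<close>.\<close>

definition field_trace :: "'a::field set \<Rightarrow> 'a set \<Rightarrow> 'a \<Rightarrow> 'a"
  where "field_trace F K a = (THE t. \<exists>e m.
    is_basis F K (ext_degree F K) e \<and>
    (\<forall>i<ext_degree F K. \<forall>j<ext_degree F K. m i j \<in> F) \<and>
    (\<forall>j<ext_degree F K. a * e j = (\<Sum>i<ext_degree F K. m i j * e i)) \<and>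
    t = (\<Sum>i<ext_degree F K. m i i))"

text \<open>
  The discriminant depends on the choice of an integral basis, but only up to the square of a
  unit of the ring of integers of \<open>F\<close>; so its absolute value does not.
\<close>

definition is_discriminant :: "('a::field \<Rightarrow> real) \<Rightarrow> 'a set \<Rightarrow> 'a set \<Rightarrow> 'a \<Rightarrow> bool"
  where "is_discriminant v F K D \<longleftrightarrow> (\<exists>e.
    is_basis (int_ring v F) (int_ring v K) (ext_degree F K) e \<and>
    D = Determinant.det (Matrix.mat (ext_degree F K) (ext_degree F K)
          (\<lambda>(i, j). field_trace F K (e i * e j))))"


subsection \<open>Haar measure\<close>

text \<open>
  A translation invariant Borel measure giving the compact open subgroup of integers mass 1 is
  locally finite, hence the normalized Haar measure.
\<close>

definition is_haar :: "('a::field \<Rightarrow> real) \<Rightarrow> 'a set \<Rightarrow> 'a measure \<Rightarrow> bool"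
  where "is_haar v K M \<longleftrightarrow>
    sets M = sets (sigma K {U. openin (abs_topology v K) U}) \<and>
    (\<forall>a\<in>K. \<forall>A\<in>sets M. emeasure M ((\<lambda>x. a + x) ` A) = emeasure M A) \<and>
    emeasure M (int_ring v K) = 1"

text \<open>
  Polynomials of degree at most \<open>m\<close> over the ring of integers of \<open>F\<close>, as coefficient vectors
  indexed by \<open>0, \<dots>, m\<close>.
\<close>

definition poly_measure :: "('a::field \<Rightarrow> real) \<Rightarrow> 'a set \<Rightarrow> 'a measure \<Rightarrow> nat \<Rightarrow> (nat \<Rightarrow> 'a) measure"
  where "poly_measure v F lamF m = Pi\<^sub>M {..m} (\<lambda>_. restrict_space lamF (int_ring v F))"


subsection \<open>The densities\<close>

definition adjoin :: "'a::comm_ring_1 set \<Rightarrow> 'a \<Rightarrow> 'a set"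
  where "adjoin A x = {Polynomial.poly P x |P. \<forall>i. Polynomial.coeff P i \<in> A}"

definition rho_integral ::
  "('a::field \<Rightarrow> real) \<Rightarrow> 'a set \<Rightarrow> 'a measure \<Rightarrow> 'a set \<Rightarrow> 'a \<Rightarrow> nat \<Rightarrow> 'a \<Rightarrow> real"
  where "rho_integral v F lamF K D n x =
    (if ext_degree F K \<le> n \<and> adjoin F x = K
     then v D / real (add_index (int_ring v K) (adjoin (int_ring v F) x))
          * (\<integral>c. v (\<Sum>i\<le>n - ext_degree F K. c i * x ^ i) ^ ext_degree F K
               \<partial>poly_measure v F lamF (n - ext_degree F K))
     else 0)"

definition rho_density ::
  "('a::field \<Rightarrow> real) \<Rightarrow> 'a set \<Rightarrow> 'a measure \<Rightarrow> 'a set \<Rightarrow> 'a \<Rightarrow> nat \<Rightarrow> 'a \<Rightarrow> real"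
  where "rho_density v F lamF K D n x =
    (if x \<in> int_ring v K then rho_integral v F lamF K D n x
     else v x powi (- 2 * int (ext_degree F K)) * rho_integral v F lamF K D n (inverse x))"

definition rho ::
  "('a::field \<Rightarrow> real) \<Rightarrow> 'a set \<Rightarrow> 'a measure \<Rightarrow> 'a set \<Rightarrow> 'a measure \<Rightarrow> 'a \<Rightarrow> nat \<Rightarrow> real"
  where "rho v F lamF K lamK D n = (\<integral>x. rho_density v F lamF K D n x \<partial>lamK)"

end

theory Submission
  imports Defs
begin

text \<open>
  Write \<open>t = 1/q\<close>. Counting \<open>O_F / p O_F\<close> in two ways (a basis over the p-adic integers on
  one side, powers of a uniformizer on the other) shows that \<open>v\<close> takes the value \<open>t\<close> on a
  uniformizer \<open>\<pi>\<close> of \<open>F\<close>.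
  In the unramified and in the ramified case \<open>K\<close> contains \<open>\<omega>\<close> such that
  \<open>v (a + b \<omega>) = max (v a) (\<sigma> v b)\<close> on \<open>F\<close>, where \<open>\<sigma>\<close> is \<open>1\<close> and \<open>\<surd>t\<close> respectively. For an integral
  \<open>x = a + b \<omega>\<close> with \<open>v b = t^k\<close> the index of \<open>O_F[x]\<close> is \<open>q^k\<close>. Reducing \<open>Q(x)\<close> to the form \<open>X + Y b \<omega>\<close>,
  the pair \<open>(X, Y)\<close> is uniformly distributed by translation invariance, so the mean of
  \<open>\<parallel>Q(x)\<parallel>^2\<close> is a geometric series depending on \<open>k\<close> only.
  Inversion multiplies the Haar measure of \<open>K\<close> by \<open>v(x)^-4\<close>, hence the contribution from outside
  \<open>O_K\<close> equals the integral of the same density over the maximal ideal, and \<open>\<rho>_n(K)\<close> is a geometric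
  series over \<open>k\<close>.
\<close>

section \<open>Non-archimedean absolute values\<close>

text \<open>Formula (i) carries no discriminant, so \<open>v D = 1\<close> must be proved for
  unramified K; residue characteristic 2 needs its own argument there, since completing the square
  is impossible modulo the maximal ideal. The integral basis contained in
  \<open>is_discriminant\<close> serves twice: it yields an \<omega> whose residue generates the
  residue extension, and it ties D to s^2 + 4n, the discriminant of the equation of \<omega>.
  Discreteness of the value group, finiteness of the residue field and v \<pi> = 1/q all come out of
  one finite count modulo p, because the setting prescribes v only at p. The threshold n = 3 is
  where Q acquires a linear coefficient: the constant and the linear coefficient already make (X, Y)
  fill O_F^2, and higher ones only translate it. For n = 2 there is X alone. The two ramification
  types differ in \<sigma>^2, which enters the mean of \<parallel>Q(x)\<parallel>^2, and in the
  shape of the maximal ideal of K, recorded by an exponent \<delta>. In the unramified case that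
  shape removes level k = 0 outside O_K, which is the origin of the numerator q^2 - q + 1.\<close>

locale nonarch =
  fixes v :: "'a::field \<Rightarrow> real"
  assumes nonarch: "nonarch_abs v"
begin

lemma nonneg [simp]: "0 \<le> v x"
  and eq_0 [simp]: "v x = 0 \<longleftrightarrow> x = 0"
  and mult: "v (x * y) = v x * v y"
  and add: "v (x + y) \<le> max (v x) (v y)"
  using nonarch unfolding nonarch_abs_def by blast+

lemma zero [simp]: "v 0 = 0"
  by simp

lemma pos_iff [simp]: "0 < v x \<longleftrightarrow> x \<noteq> 0"
  using nonneg[of x] eq_0[of x] by linarith

lemma one [simp]: "v 1 = 1"
  by (metis eq_0 mult mult_cancel_right1 one_neq_zero)

lemma uminus [simp]: "v (- x) = v x"
proof -
  have "v (-1) * v (-1) = 1"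
    using mult[of "-1" "-1"] by simp
  hence "v (-1) = 1"
    using nonneg[of "-1"] by (smt (verit) mult_less_cancel_right2 mult_less_cancel_right1)
  thus ?thesis
    using mult[of "-1" x] by simp
qed

lemma minus_commute: "v (x - y) = v (y - x)"
  by (metis minus_diff_eq uminus)

lemma diff: "v (x - y) \<le> max (v x) (v y)"
  using add[of x "- y"] by simp

lemma add_le: "v x \<le> r \<Longrightarrow> v y \<le> r \<Longrightarrow> v (x + y) \<le> r"
  using add[of x y] by linarith

lemma diff_le: "v x \<le> r \<Longrightarrow> v y \<le> r \<Longrightarrow> v (x - y) \<le> r"
  using diff[of x y] by linarith

lemma add_less: "v x < r \<Longrightarrow> v y < r \<Longrightarrow> v (x + y) < r"
  using add[of x y] by linarith

lemma diff_less: "v x < r \<Longrightarrow> v y < r \<Longrightarrow> v (x - y) < r"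
  using diff[of x y] by linarith

lemma sum_le: "(\<And>i. i \<in> I \<Longrightarrow> v (f i) \<le> r) \<Longrightarrow> 0 \<le> r \<Longrightarrow> v (\<Sum>i\<in>I. f i) \<le> r"
  by (induction I rule: infinite_finite_induct) (auto intro: add_le)

lemma power: "v (x ^ n) = v x ^ n"
  by (induction n) (auto simp: mult)

lemma inverse: "v (inverse x) = inverse (v x)"
proof (cases "x = 0")
  case False
  hence "v x * v (inverse x) = 1"
    by (simp flip: mult)
  thus ?thesis
    by (metis inverse_unique)
qed simp

lemma divide: "v (x / y) = v x / v y"
  by (simp add: divide_inverse mult inverse)

lemma power_int: "v (x powi n) = v x powi n"
  by (simp add: power_int_def power inverse)

lemma add_eq_left:
  assumes "v y < v x"
  shows "v (x + y) = v x"
proof (rule antisym)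
  show "v (x + y) \<le> v x"
    using add[of x y] assms by linarith
  show "v x \<le> v (x + y)"
    using diff[of "x + y" y] assms by auto
qed

lemma eq_of_diff_less: "v (x - y) < v y \<Longrightarrow> v x = v y"
  using add_eq_left[of "x - y" y] by simp

lemma add_eq_max: "v x \<noteq> v y \<Longrightarrow> v (x + y) = max (v x) (v y)"
  using add_eq_left[of x y] add_eq_left[of y x] by (auto simp: add.commute max_def not_le)

lemma of_nat_le_1: "v (of_nat n) \<le> 1"
  by (induction n) (auto intro: add_le)

lemma of_int_le_1: "v (of_int k) \<le> 1"
  by (cases k rule: int_cases2) (auto intro: of_nat_le_1)

text \<open>Uniqueness of limits in quantitative form. It identifies an element with its p-adic
  expansion, both being approximated by the same partial sums.\<close>

lemma eq_of_common_approx: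
  assumes "\<And>n. v (x - f n) \<le> e n" "e \<longlonglongrightarrow> 0" "\<And>n. v (y - f n) \<le> e n"
  shows "x = y"
proof -
  have "v (x - y) \<le> e n" for n
    using diff_le[OF assms(1,3)[of n]] by simp
  hence "v (x - y) \<le> 0"
    using assms(2) by (meson LIMSEQ_le_const)
  hence "v (x - y) = 0"
    using nonneg[of "x - y"] by linarith
  thus ?thesis by simp
qed

end

locale sub_field =
  fixes F :: "'a::field set"
  assumes subfield: "subfield F ambient"
begin

lemma zero_mem [simp]: "0 \<in> F" and one_mem [simp]: "1 \<in> F"
  and add_mem: "x \<in> F \<Longrightarrow> y \<in> F \<Longrightarrow> x + y \<in> F"
  and mult_mem: "x \<in> F \<Longrightarrow> y \<in> F \<Longrightarrow> x * y \<in> F"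
  using subringE[OF subfieldE(1)[OF subfield]] by (auto simp: ring_of_type_algebra_def)

lemma uminus_mem: "x \<in> F \<Longrightarrow> - x \<in> F"
proof -
  interpret ring "ambient :: 'a ring" by rule
  assume "x \<in> F"
  hence "a_inv ambient x \<in> F"
    using subringE(5)[OF subfieldE(1)[OF subfield]] by blast
  moreover have "a_inv ambient x = - x"
    using minus_equality[of "-x" x] by (simp add: ring_of_type_algebra_def)
  ultimately show ?thesis by simp
qed

lemma diff_mem: "x \<in> F \<Longrightarrow> y \<in> F \<Longrightarrow> x - y \<in> F"
  using add_mem[of x "-y"] uminus_mem[of y] by simp

lemma inverse_mem: "x \<in> F \<Longrightarrow> inverse x \<in> F"
proof (cases "x = 0")
  case False
  interpret ring "ambient :: 'a ring" by rule
  assume "x \<in> F"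
  hence "\<exists>y\<in>F. x * y = 1"
    using subfield_m_inv[OF subfield, of x] False by (auto simp: ring_of_type_algebra_def)
  thus ?thesis
    by (metis inverse_unique)
qed simp

lemma divide_mem: "x \<in> F \<Longrightarrow> y \<in> F \<Longrightarrow> x / y \<in> F"
  by (simp add: divide_inverse mult_mem inverse_mem)

lemma power_mem: "x \<in> F \<Longrightarrow> x ^ n \<in> F"
  by (induction n) (auto intro: mult_mem)

lemma power_int_mem: "x \<in> F \<Longrightarrow> x powi n \<in> F"
  by (simp add: power_int_def power_mem inverse_mem)

lemma sum_mem: "(\<And>i. i \<in> I \<Longrightarrow> f i \<in> F) \<Longrightarrow> (\<Sum>i\<in>I. f i) \<in> F"
  by (induction I rule: infinite_finite_induct) (auto intro: add_mem)

lemma of_nat_mem [simp]: "of_nat n \<in> F"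
  by (induction n) (auto intro: add_mem)

lemma of_int_mem [simp]: "of_int k \<in> F"
  by (cases k rule: int_cases2) (auto intro: uminus_mem)

end

section \<open>Transversals\<close>

text \<open>Representatives replace the quotient sets of \<open>add_index\<close>: they can be
  scaled, added along towers of subgroups, and used to index disjoint translates when measures are
  computed.\<close>

definition is_transversal :: "'a::ab_group_add set \<Rightarrow> 'a set \<Rightarrow> 'a set \<Rightarrow> bool"
  where "is_transversal R A B \<longleftrightarrow> R \<subseteq> A \<and> (\<forall>x\<in>A. \<exists>!r. r \<in> R \<and> x - r \<in> B)"

text \<open>An additive subgroup, encoded by closure under differences.\<close>

definition add_closed :: "'a::ab_group_add set \<Rightarrow> bool"
  where "add_closed B \<longleftrightarrow> 0 \<in> B \<and> (\<forall>x\<in>B. \<forall>y\<in>B. x - y \<in> B)"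

lemma add_closedD:
  assumes "add_closed B"
  shows "0 \<in> B" "x \<in> B \<Longrightarrow> y \<in> B \<Longrightarrow> x - y \<in> B" "x \<in> B \<Longrightarrow> - x \<in> B"
    "x \<in> B \<Longrightarrow> y \<in> B \<Longrightarrow> x + y \<in> B"
proof -
  show 0: "0 \<in> B"
    using assms unfolding add_closed_def by auto
  show d: "x - y \<in> B" if "x \<in> B" "y \<in> B" for x y
    using assms that unfolding add_closed_def by auto
  show m: "- x \<in> B" if "x \<in> B" for x
    using d[OF 0 that] by simp
  show "x + y \<in> B" if "x \<in> B" "y \<in> B"
    using d[OF that(1) m[OF that(2)]] by simp
qed

lemma is_transversalI:
  assumes "R \<subseteq> A" "\<And>x. x \<in> A \<Longrightarrow> \<exists>r\<in>R. x - r \<in> B"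
    "\<And>r s. r \<in> R \<Longrightarrow> s \<in> R \<Longrightarrow> r - s \<in> B \<Longrightarrow> r = s" "add_closed B"
  shows "is_transversal R A B"
  unfolding is_transversal_def
proof (intro conjI ballI)
  fix x assume "x \<in> A"
  then obtain r where r: "r \<in> R" "x - r \<in> B"
    using assms by blast
  show "\<exists>!r. r \<in> R \<and> x - r \<in> B"
  proof (rule ex1I[of _ r])
    fix s assume s: "s \<in> R \<and> x - s \<in> B"
    have "(x - s) - (x - r) \<in> B"
      using s r add_closedD[OF assms(4)] by blast
    thus "s = r"
      using assms(3)[of r s] r s by simp
  qed (use r in auto)
qed (use assms in auto)

lemma is_transversalD:
  assumes "is_transversal R A B"
  shows "r \<in> R \<Longrightarrow> r \<in> A" "x \<in> A \<Longrightarrow> \<exists>r\<in>R. x - r \<in> B"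
    "add_closed B \<Longrightarrow> r \<in> R \<Longrightarrow> s \<in> R \<Longrightarrow> r - s \<in> B \<Longrightarrow> r = s"
proof -
  show 1: "r \<in> R \<Longrightarrow> r \<in> A" for r
    using assms unfolding is_transversal_def by blast
  show "x \<in> A \<Longrightarrow> \<exists>r\<in>R. x - r \<in> B"
    using assms unfolding is_transversal_def by blast
  show "r = s" if "add_closed B" "r \<in> R" "s \<in> R" "r - s \<in> B"
  proof -
    have "r \<in> A" "r - r \<in> B"
      using 1 that add_closedD[OF that(1)] by auto
    thus ?thesis
      using assms that unfolding is_transversal_def by blast
  qed
qed

lemma is_transversal_unique:
  "is_transversal R A B \<Longrightarrow> x \<in> A \<Longrightarrow> r \<in> R \<Longrightarrow> s \<in> R \<Longrightarrow> x - r \<in> B \<Longrightarrow> x - s \<in> B \<Longrightarrow> r = s"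
  unfolding is_transversal_def by blast

lemma transversal_exists:
  assumes "add_closed B" 
  shows "\<exists>R. is_transversal R A B"
proof -
  \<comment> \<open>\<open>SOME\<close> returns the same element for congruent arguments, because
    the two predicates then coincide; so the image of \<open>c\<close> meets each class of A
    once.\<close>
  define c where "c x = (SOME y. y \<in> A \<and> x - y \<in> B)" for x
  have c: "c x \<in> A" "x - c x \<in> B" if "x \<in> A" for x
    using someI[of "\<lambda>y. y \<in> A \<and> x - y \<in> B" x] that add_closedD(1)[OF assms]
    unfolding c_def by auto
  have c_eq: "c x = c y" if "x - y \<in> B" for x y
  proof -
    have "(x - z \<in> B) = (y - z \<in> B)" for z
      using add_closedD(2)[OF assms, of "x - z" "x - y"]
        add_closedD(4)[OF assms, of "y - z" "x - y"] that by auto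
    thus ?thesis
      unfolding c_def by simp
  qed
  have "is_transversal (c ` A) A B"
  proof (rule is_transversalI)
    fix r s assume "r \<in> c ` A" "s \<in> c ` A" and rs: "r - s \<in> B"
    then obtain x y where "x \<in> A" "y \<in> A" "r = c x" "s = c y"
      by blast
    moreover from this have "c (c x) = c x" "c (c y) = c y"
      using c c_eq by metis+
    ultimately show "r = s"
      using c_eq[OF rs] by simp
  qed (use c assms in auto)
  thus ?thesis ..
qed

lemma add_index_eq_card:
  assumes "is_transversal R A B" "add_closed B"
  shows "add_index A B = card R"
proof -
  define E where "E = {(x, y). x \<in> A \<and> y \<in> A \<and> x - y \<in> B}"
  note B = add_closedD[OF assms(2)]
  note R = is_transversalD[OF assms(1)]
  have E_eq: "E `` {x} = E `` {y}" if "x \<in> A" "y \<in> A" "x - y \<in> B" for x y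
  proof -
    have "(x - z \<in> B) = (y - z \<in> B)" for z
      using B(2)[of "x - z" "x - y"] B(4)[of "y - z" "x - y"] that by auto
    thus ?thesis
      using that unfolding E_def by auto
  qed
  have "bij_betw (\<lambda>r. E `` {r}) R (A // E)"
    unfolding bij_betw_def
  proof
    show "inj_on (\<lambda>r. E `` {r}) R"
    proof (rule inj_onI)
      fix r s assume rs: "r \<in> R" "s \<in> R" "E `` {r} = E `` {s}"
      have "s \<in> E `` {s}"
        using rs R B(1) unfolding E_def by auto
      hence "r - s \<in> B"
        using rs unfolding E_def by auto
      thus "r = s"
        using R(3)[OF assms(2) rs(1,2)] by blast
    qed
    have "E `` {x} \<in> (\<lambda>r. E `` {r}) ` R" if x: "x \<in> A" for x
    proof -
      obtain r where r: "r \<in> R" "x - r \<in> B"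
        using R(2)[OF x] by blast
      show ?thesis
        using E_eq[OF x R(1)[OF r(1)] r(2)] by (rule image_eqI) (rule r(1))
    qed
    thus "(\<lambda>r. E `` {r}) ` R = A // E"
      using R(1) unfolding quotient_def by auto
  qed
  thus ?thesis
    unfolding add_index_def E_def by (simp add: bij_betw_same_card)
qed

lemma transversal_card_eq:
  "is_transversal R A B \<Longrightarrow> is_transversal S A B \<Longrightarrow> add_closed B \<Longrightarrow> card R = card S"
  by (metis add_index_eq_card)

text \<open>Multiplicativity of the index in a tower. Reading a relation between sums modulo B
  identifies the outer representatives, after which the relation modulo C identifies the inner
  ones.\<close>

lemma transversal_trans:
  assumes "is_transversal R A B" "is_transversal S B C" "add_closed A" "add_closed B" "add_closed C"
    "B \<subseteq> A" "C \<subseteq> B"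
  shows "is_transversal ((\<lambda>(r, s). r + s) ` (R \<times> S)) A C"
    and "card ((\<lambda>(r, s). r + s) ` (R \<times> S)) = card R * card S"
proof -
  note R = is_transversalD[OF assms(1)] and S = is_transversalD[OF assms(2)]
  note A = add_closedD[OF assms(3)] and B = add_closedD[OF assms(4)] and C = add_closedD[OF assms(5)]
  have eq: "r = r' \<and> s = s'"
    if "r \<in> R" "s \<in> S" "r' \<in> R" "s' \<in> S" "r + s - (r' + s') \<in> C" for r s r' s'
  proof -
    have "s \<in> B" "s' \<in> B" "r + s - (r' + s') \<in> B"
      using that S assms by auto
    hence "(r + s - (r' + s')) - (s - s') \<in> B"
      using B(2) by blast
    hence "r - r' \<in> B"
      by (simp add: algebra_simps)
    hence "r = r'"
      using R(3)[OF assms(4)] that by blast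
    moreover from this have "s - s' \<in> C"
      using that by simp
    ultimately show ?thesis
      using S(3)[OF assms(5)] that by blast
  qed
  have "inj_on (\<lambda>(r, s). r + s) (R \<times> S)"
  proof (rule inj_onI, clarify)
    fix r s r' s' assume "r \<in> R" "s \<in> S" "r' \<in> R" "s' \<in> S" "r + s = r' + s'"
    thus "r = r' \<and> s = s'"
      using eq[of r s r' s'] C(1) by simp
  qed
  thus "card ((\<lambda>(r, s). r + s) ` (R \<times> S)) = card R * card S"
    by (simp add: card_image card_cartesian_product)
  show "is_transversal ((\<lambda>(r, s). r + s) ` (R \<times> S)) A C"
  proof (rule is_transversalI)
    have "r + s \<in> A" if "r \<in> R" "s \<in> S" for r s
      using A(4)[OF R(1)[OF that(1)] subsetD[OF assms(6) S(1)[OF that(2)]]] .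
    thus "(\<lambda>(r, s). r + s) ` (R \<times> S) \<subseteq> A"
      by auto
    fix x assume "x \<in> A"
    then obtain r where r: "r \<in> R" "x - r \<in> B"
      using R(2) by blast
    then obtain s where "s \<in> S" "x - r - s \<in> C"
      using S(2) by blast
    thus "\<exists>z\<in>(\<lambda>(r, s). r + s) ` (R \<times> S). x - z \<in> C"
      using r by (intro bexI[of _ "r + s"]) (auto simp: algebra_simps)
  next
    fix x y assume "x \<in> (\<lambda>(r, s). r + s) ` (R \<times> S)" "y \<in> (\<lambda>(r, s). r + s) ` (R \<times> S)" "x - y \<in> C"
    thus "x = y"
      using eq by auto
  qed (use assms in auto)
qed

section \<open>Dimension in terms of finite sums\<close>

lemma ambient_simps:
  fixes x y :: "'a::field"
  shows "carrier (ambient :: 'a ring) = UNIV" "x \<otimes>\<^bsub>ambient\<^esub> y = x * y"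
    "x \<oplus>\<^bsub>ambient\<^esub> y = x + y" "\<zero>\<^bsub>(ambient :: 'a ring)\<^esub> = 0"
  by (simp_all add: ring_of_type_algebra_def)

lemma combine_eq_sum:
  fixes Ks Us :: "'a::field list"
  assumes "length Ks = length Us"
  shows "ring.combine ambient Ks Us = (\<Sum>i<length Us. Ks ! i * Us ! i)"
proof -
  interpret ring "ambient :: 'a ring" by rule
  show ?thesis
    using assms
    by (induction Ks Us rule: list_induct2)
      (simp_all add: ambient_simps sum.lessThan_Suc_shift del: sum.lessThan_Suc)
qed

context sub_field
begin

text \<open>Spans are defined through lists and \<open>combine\<close>; the later linear algebra
  works with coefficient functions and finite sums.\<close>

lemma Span_mem_sum:
  "x \<in> ring.Span ambient F (map u [0..<m]) \<longleftrightarrow> (\<exists>c. (\<forall>i<m. c i \<in> F) \<and> x = (\<Sum>i<m. c i * u i))"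
proof -
  interpret ring "ambient :: 'a ring" by rule
  let ?Us = "map u [0..<m]"
  have carr: "set ?Us \<subseteq> carrier ambient"
    by (simp add: ring_of_type_algebra_def)
  show ?thesis
    unfolding Span_mem_iff_length_version[OF subfield carr]
  proof
    assume "\<exists>Ks. set Ks \<subseteq> F \<and> length Ks = length ?Us \<and> x = combine Ks ?Us"
    then obtain Ks where "set Ks \<subseteq> F" "length Ks = m" "x = combine Ks ?Us"
      by auto
    thus "\<exists>c. (\<forall>i<m. c i \<in> F) \<and> x = (\<Sum>i<m. c i * u i)"
      by (intro exI[of _ "\<lambda>i. Ks ! i"]) (auto simp: combine_eq_sum)
  next
    assume "\<exists>c. (\<forall>i<m. c i \<in> F) \<and> x = (\<Sum>i<m. c i * u i)"
    then obtain c where "\<forall>i<m. c i \<in> F" "x = (\<Sum>i<m. c i * u i)"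
      by blast
    thus "\<exists>Ks. set Ks \<subseteq> F \<and> length Ks = length ?Us \<and> x = combine Ks ?Us"
      by (intro exI[of _ "map c [0..<m]"]) (auto simp: combine_eq_sum)
  qed
qed

lemma independent_of_sum:
  assumes "\<And>c. (\<forall>i<m. c i \<in> F) \<Longrightarrow> (\<Sum>i<m. c i * u i) = 0 \<Longrightarrow> \<forall>i<m. c i = 0"
  shows "ring.independent ambient F (map u [0..<m])"
proof -
  interpret ring "ambient :: 'a ring" by rule
  let ?Us = "map u [0..<m]"
  have carr: "set ?Us \<subseteq> carrier ambient" "carrier (ambient :: 'a ring) = UNIV" "zero (ambient :: 'a ring) = 0"
    by (simp_all add: ring_of_type_algebra_def)
  show ?thesis
  proof (rule ccontr)
    assume dep: "\<not> independent F ?Us"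
    obtain Ks where Ks: "length Ks = length ?Us" "combine Ks ?Us = 0" "set Ks \<subseteq> F" "set Ks \<noteq> {0}"
      by (rule dependent_imp_non_trivial_combine[OF subfield carr(1) dep, unfolded carr(3)])
    have "\<forall>i<m. Ks ! i = 0"
    proof (rule assms)
      show "\<forall>i<m. Ks ! i \<in> F"
        using Ks(1,3) by (auto simp: subset_iff)
      show "(\<Sum>i<m. Ks ! i * u i) = 0"
        using Ks(1,2) by (simp add: combine_eq_sum)
    qed
    hence "set Ks \<subseteq> {0}"
      using Ks(1) by (auto simp: in_set_conv_nth)
    hence "Ks = []"
      using Ks(4) by (metis set_empty subset_singletonD)
    hence "?Us = []"
      using Ks(1) by simp
    thus False
      using dep by simp
  qed
qed

lemma independent_le_dimension:
  assumes "ring.dimension ambient n F E" "\<And>i. i < m \<Longrightarrow> u i \<in> E"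
    "\<And>c. (\<forall>i<m. c i \<in> F) \<Longrightarrow> (\<Sum>i<m. c i * u i) = 0 \<Longrightarrow> \<forall>i<m. c i = 0"
  shows "m \<le> n"
proof -
  interpret ring "ambient :: 'a ring" by rule
  have "set (map u [0..<m]) \<subseteq> E"
    using assms(2) by auto
  thus ?thesis
    using independent_length_le_dimension[OF subfield assms(1) independent_of_sum[of m u, OF assms(3)]]
    by simp
qed

lemma independent_spans:
  assumes "ring.dimension ambient m F E" "\<And>i. i < m \<Longrightarrow> u i \<in> E"
    "\<And>c. (\<forall>i<m. c i \<in> F) \<Longrightarrow> (\<Sum>i<m. c i * u i) = 0 \<Longrightarrow> \<forall>i<m. c i = 0"
    and "x \<in> E"
  shows "\<exists>c. (\<forall>i<m. c i \<in> F) \<and> x = (\<Sum>i<m. c i * u i)"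
proof -
  interpret ring "ambient :: 'a ring" by rule
  have "set (map u [0..<m]) \<subseteq> E"
    using assms(2) by auto
  hence "Span F (map u [0..<m]) = E"
    using independent_length_eq_dimension[OF subfield assms(1) independent_of_sum[of m u, OF assms(3)]]
    by simp
  thus ?thesis
    using Span_mem_sum[of x u m] assms(4) by blast
qed

lemma dimension_le_spanning:
  assumes "ring.dimension ambient n F E"
    "\<And>x. x \<in> E \<Longrightarrow> \<exists>c. (\<forall>i<m. c i \<in> F) \<and> x = (\<Sum>i<m. c i * u i)"
  shows "n \<le> m"
proof -
  interpret ring "ambient :: 'a ring" by rule
  let ?Us = "map u [0..<m]"
  have carr: "set Us \<subseteq> carrier ambient" for Us :: "'a list"
    by (simp add: ring_of_type_algebra_def)
  obtain Vs where Vs: "independent F Vs" "length Vs = n" "Span F Vs = E"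
    using exists_base[OF subfield assms(1)] by blast
  have sub: "set Vs \<subseteq> Span F ?Us"
    using Span_base_incl[OF subfield carr, of Vs] assms(2) Span_mem_sum[of _ u m] Vs(3) by blast
  \<comment> \<open>Thinning a spanning list: a vector already in the span of the later ones is
    dropped. The independent list obtained is not longer, and the exchange bound for
    \<open>Vs\<close> applies to it.\<close>
  have "\<exists>Ws. independent F Ws \<and> Span F Ws = Span F Us \<and> length Ws \<le> length Us" for Us
  proof (induction Us)
    case Nil
    show ?case by (intro exI[of _ "[]"]) simp
  next
    case (Cons w Us)
    then obtain Ws where Ws: "independent F Ws" "Span F Ws = Span F Us" "length Ws \<le> length Us"
      by blast
    have Sp: "Span F (w # Ws) = Span F (w # Us)"
      using Ws(2) by simp
    show ?case
    proof (cases "w \<in> Span F Ws")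
      case True
      have "Span F (w # Ws) \<subseteq> Span F Ws"
        by (rule mono_Span_subset[OF subfield _ carr]) (use True Span_base_incl[OF subfield carr, of Ws] in auto)
      moreover have "Span F Ws \<subseteq> Span F (w # Ws)"
        by (rule mono_Span_subset[OF subfield _ carr])
          (use Span_base_incl[OF subfield carr, of "w # Ws"] in auto)
      ultimately show ?thesis
        using Ws Sp by (intro exI[of _ Ws]) auto
    next
      case False
      hence "independent F (w # Ws)"
        using Ws(1) by (intro li_Cons) (auto simp: ring_of_type_algebra_def)
      thus ?thesis
        using Ws(3) Sp by (intro exI[of _ "w # Ws"]) auto
    qed
  qed
  then obtain Ws where "independent F Ws" "Span F Ws = Span F ?Us" "length Ws \<le> length ?Us"
    by blast
  thus ?thesis
    using independent_length_le[OF subfield Vs(1), of Ws] sub Vs(2) by simp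
qed

end

section \<open>Discretely valued fields\<close>

text \<open>The p-adic origin of F is condensed into a uniformizer, a cyclic value group and
  finitely many residue representatives \<open>R\<close>. The treatment of K rests on this
  interface, with q appearing as \<open>card R\<close>.\<close>

locale disc_val = nonarch v + sub_field F for v :: "'a::field \<Rightarrow> real" and F +
  fixes \<pi> :: 'a and R :: "'a set"
  assumes unif_mem: "\<pi> \<in> F" and unif_pos [simp]: "\<pi> \<noteq> 0" and unif_less: "v \<pi> < 1"
    and value_group: "x \<in> F \<Longrightarrow> x \<noteq> 0 \<Longrightarrow> \<exists>k. v x = v \<pi> powi k"
    and transversal: "is_transversal R (int_ring v F) (max_ideal v F)" and finite_R: "finite R"
begin

text \<open>The fractional ideal generated by \<open>\<pi> powi i\<close>; larger indices give
  smaller sets.\<close>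

definition vball :: "int \<Rightarrow> 'a set"
  where "vball i = {x \<in> F. v x \<le> v \<pi> powi i}"

lemma unif_gt_0: "0 < v \<pi>" "0 \<le> v \<pi>" "v \<pi> \<noteq> 0"
  by auto

lemma powi_gt_0: "0 < v \<pi> powi i"
  by (simp add: zero_less_power_int)

lemma powi_le_iff: "v \<pi> powi i \<le> v \<pi> powi j \<longleftrightarrow> j \<le> i"
  using power_int_decreasing[of j i "v \<pi>"] power_int_strict_decreasing[of i j "v \<pi>"]
    unif_less unif_gt_0 by force

lemma powi_less_iff: "v \<pi> powi i < v \<pi> powi j \<longleftrightarrow> j < i"
  by (meson linorder_not_le powi_le_iff)

lemma powi_eq_iff: "v \<pi> powi i = v \<pi> powi j \<longleftrightarrow> i = j"
  by (metis order_antisym powi_le_iff order_refl)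

lemma vball_add_closed: "add_closed (vball i)"
  unfolding add_closed_def vball_def by (auto intro: diff_mem diff_le)

lemma vball_mono: "j \<le> i \<Longrightarrow> vball i \<subseteq> vball j"
  unfolding vball_def using powi_le_iff[of i j] by auto

lemma vball_0: "vball 0 = int_ring v F"
  by (simp add: vball_def int_ring_def)

text \<open>Discreteness: no value lies strictly between consecutive powers, so a strict bound is a
  weak bound one exponent later and closed balls suffice throughout.\<close>

lemma less_iff_le: "x \<in> F \<Longrightarrow> v x < v \<pi> powi i \<longleftrightarrow> v x \<le> v \<pi> powi (i + 1)"
proof (cases "x = 0")
  case False
  assume "x \<in> F"
  then obtain k where "v x = v \<pi> powi k"
    using value_group False by blast
  thus ?thesis
    using powi_le_iff[of k "i+1"] powi_less_iff[of k i] by auto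
qed (simp add: powi_gt_0 less_imp_le)

lemma vball_1: "vball 1 = max_ideal v F"
  using less_iff_le[of _ 0] by (auto simp: vball_def max_ideal_def)

lemma vball_scale: "c \<in> F \<Longrightarrow> v c = v \<pi> powi i \<Longrightarrow> c * x \<in> vball (i + j) \<longleftrightarrow> c * x \<in> F \<and> x \<in> vball j"
proof -
  assume c: "c \<in> F" "v c = v \<pi> powi i"
  hence c0: "c \<noteq> 0" "v c > 0"
    using powi_gt_0[of i] by auto
  have "c * x / c \<in> F" if "c * x \<in> F"
    using that c(1) divide_mem by blast
  moreover have "v (c * x) \<le> v \<pi> powi (i + j) \<longleftrightarrow> v x \<le> v \<pi> powi j"
    using mult_le_cancel_left_pos[OF c0(2), of "v x" "v \<pi> powi j"] c(2)
    by (simp add: mult power_int_add)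
  ultimately show ?thesis
    using c0 by (auto simp: vball_def)
qed

text \<open>Each layer between consecutive balls is a copy of the residue field scaled by a power of
  \<pi>, so k layers multiply the index by \<open>card R\<close> k times.\<close>

lemma vball_transversal:
  "\<exists>T. is_transversal T (vball i) (vball (i + int k)) \<and> finite T \<and> card T = card R ^ k"
proof (induction k)
  case 0
  have "is_transversal {0} (vball i) (vball (i + int 0))"
    by (rule is_transversalI) (auto simp: vball_add_closed, auto simp: vball_def)
  thus ?case
    by (intro exI[of _ "{0}"]) auto
next
  case (Suc k)
  then obtain T where T: "is_transversal T (vball i) (vball (i + int k))" "finite T" "card T = card R ^ k"
    by blast
  define j where "j = i + int k"
  define c where "c = \<pi> powi j"
  have c: "c \<in> F" "c \<noteq> 0" "v c = v \<pi> powi j"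
    using unif_mem unif_pos by (auto simp: c_def power_int_mem power_int)
  note R = is_transversalD[OF transversal]
  have "is_transversal ((*) c ` R) (vball j) (vball (j + 1))"
  proof (rule is_transversalI)
    have "c * r \<in> vball (j + 0)" if "r \<in> R" for r
    proof -
      have "r \<in> vball 0"
        using R(1)[OF that] vball_0 by simp
      moreover from this have "c * r \<in> F"
        using mult_mem[OF c(1)] vball_def by simp
      ultimately show ?thesis
        using vball_scale[OF c(1,3)] by blast
    qed
    thus "(*) c ` R \<subseteq> vball j"
      by auto
    show "\<exists>z\<in>(*) c ` R. x - z \<in> vball (j + 1)" if x: "x \<in> vball j" for x
    proof -
      have xF: "x \<in> F"
        using x vball_def by auto
      have "x / c \<in> vball 0"
        using vball_scale[OF c(1,3), of "x / c" 0] x c(2) xF by simp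
      then obtain r where r: "r \<in> R" "x / c - r \<in> vball 1"
        using R(2) vball_0 vball_1 by blast
      have eq: "c * (x / c - r) = x - c * r"
        using c by (simp add: algebra_simps)
      have "r \<in> F"
        using R(1)[OF r(1)] by (simp add: int_ring_def)
      hence "x - c * r \<in> F"
        using xF c(1) diff_mem mult_mem by blast
      hence "x - c * r \<in> vball (j + 1)"
        using vball_scale[OF c(1,3), of "x / c - r" 1] r eq by simp
      thus ?thesis
        using r(1) by blast
    qed
    show "r = s" if rs: "r \<in> (*) c ` R" "s \<in> (*) c ` R" "r - s \<in> vball (j + 1)" for r s
    proof -
      obtain r' s' where *: "r = c * r'" "s = c * s'" "r' \<in> R" "s' \<in> R"
        using rs by blast
      hence "c * (r' - s') \<in> vball (j + 1)"
        using rs by (simp add: algebra_simps)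
      hence "r' - s' \<in> vball 1"
        using vball_scale[OF c(1,3)] by blast
      thus ?thesis
        using R(3)[of r' s'] * vball_add_closed[of 1] vball_1 by auto
    qed
  qed (rule vball_add_closed)
  note tr = transversal_trans[OF T(1)[folded j_def] this vball_add_closed vball_add_closed vball_add_closed
      vball_mono vball_mono]
  have "card ((*) c ` R) = card R"
    using c(2) by (intro card_image) (auto intro: inj_onI)
  moreover have "finite ((\<lambda>(r, s). r + s) ` (T \<times> (*) c ` R))"
    using T(2) finite_R by simp
  ultimately show ?case
    using tr T(3) by (intro exI[of _ "(\<lambda>(r, s). r + s) ` (T \<times> (*) c ` R)"]) (auto simp: j_def add_ac)
qed

end

section \<open>Finite extensions of the p-adic numbers\<close>

locale padic =
  fixes p :: nat and Qp F :: "'a::field_char_0 set" and v :: "'a \<Rightarrow> real"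
  assumes setting: "padic_setting p Qp F v"

sublocale padic \<subseteq> nonarch v
  using setting by (simp add: nonarch_def padic_setting_def)

sublocale padic \<subseteq> sub_field F
  using setting by (simp add: sub_field_def padic_setting_def)

sublocale padic \<subseteq> base: sub_field Qp
  using setting by (simp add: sub_field_def padic_setting_def is_padic_numbers_def)

context padic
begin

lemma prime_p: "Factorial_Ring.prime p" and Qp_subset: "Qp \<subseteq> F"
  and dimension: "ring.dimension ambient (ext_degree Qp F) Qp F"
  and v_p: "v (of_nat p) = 1 / real p ^ ext_degree Qp F"
proof -
  interpret ring "ambient :: 'a ring" by rule
  show "Factorial_Ring.prime p" "Qp \<subseteq> F" "v (of_nat p) = 1 / real p ^ ext_degree Qp F"
    using setting by (auto simp: padic_setting_def)
  show "dimension (ext_degree Qp F) Qp F"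
    using setting finite_dimensionE[OF base.subfield] by (auto simp: padic_setting_def over_def)
qed

lemma v_of_int_coprime:
  assumes "\<not> int p dvd k"
  shows "v (of_int k) = 1"
proof -
  obtain s where s: "\<And>x. v (of_rat x) = padic_abs p x powr s"
    using setting by (auto simp: padic_setting_def is_padic_numbers_def)
  have "k \<noteq> 0"
    using assms by auto
  moreover have "multiplicity (int p) k = 0"
    using assms by (rule not_dvd_imp_multiplicity_0)
  ultimately have "padic_abs p (of_int k) = 1"
    by (simp add: padic_abs_def)
  thus ?thesis
    using s[of "of_int k"] by simp
qed

lemma p_gt_1: "1 < p"
  using prime_p by (rule prime_gt_1_nat)

lemma v_p_pos: "0 < v (of_nat p)"
  using p_gt_1 by simp

lemma v_p_less: "v (of_nat p) < 1"
proof -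
  obtain s where s: "s > 0" "\<And>x. v (of_rat x) = padic_abs p x powr s"
    using setting by (auto simp: padic_setting_def is_padic_numbers_def)
  have "Factorial_Ring.prime (int p)"
    using prime_p by simp
  hence "multiplicity (int p) (int p) = 1"
    using p_gt_1 by (intro multiplicity_self) auto
  hence "padic_abs p (of_nat p) = 1 / real p"
    using p_gt_1 by (simp add: padic_abs_def power_int_minus divide_inverse)
  moreover have "(1 / real p) powr s < 1"
    using p_gt_1 s(1) powr_less_mono2[of s "1 / real p" 1] by simp
  ultimately show ?thesis
    using s(2)[of "of_nat p"] by simp
qed

lemma v_of_int_dvd:
  assumes "int p dvd k"
  shows "v (of_int k) \<le> v (of_nat p)"
proof -
  obtain j where "k = int p * j"
    using assms by blast
  thus ?thesis
    using of_int_le_1[of j] by (simp add: mult mult_left_le)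
qed

lemma int_inverse_mod_p:
  assumes "\<not> int p dvd k"
  shows "\<exists>j. v (1 - of_int (j * k)) \<le> v (of_nat p)"
proof -
  have "coprime (int p) k"
    using assms prime_p by (simp add: prime_imp_coprime)
  then obtain a b where "a * int p + b * k = 1"
    using bezout_int[of "int p" k] by auto
  hence "1 - b * k = a * int p"
    by simp
  hence "int p dvd 1 - b * k"
    by simp
  hence "v (of_int (1 - b * k)) \<le> v (of_nat p)"
    by (rule v_of_int_dvd)
  thus ?thesis
    by (intro exI[of _ b]) simp
qed

text \<open>Density supplies a nearby rational. A denominator divisible by p, being coprime to the
  numerator, would push its absolute value above 1; so the denominator is invertible modulo p and
  the rational can be replaced by an integer.\<close>

lemma Zp_approx:
  assumes "z \<in> Qp" "v z \<le> 1"
  shows "\<exists>k. v (z - of_int k) \<le> v (of_nat p)"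
proof -
  interpret M: Metric_space Qp "\<lambda>x y. v (x - y)"
    by (rule Metric_space_nonarch_abs[OF nonarch])
  have "z \<in> M.mtopology closure_of \<rat>"
    using setting assms(1) by (simp add: padic_setting_def is_padic_numbers_def)
  then obtain y where y: "y \<in> \<rat>" "y \<in> M.mball z (v (of_nat p))"
    unfolding M.metric_closure_of using v_p_pos by blast
  hence zy: "v (z - y) < v (of_nat p)"
    by simp
  have vy: "v y \<le> 1"
    using diff_le[of z 1 "z - y"] assms(2) zy v_p_less by simp
  obtain x where x: "y = of_rat x"
    using y(1) by (rule Rats_cases)
  obtain a b where ab: "quotient_of x = (a, b)"
    by fastforce
  have b: "b > 0" and cop: "coprime a b" and "x = of_int a / of_int b"
    using quotient_of_denom_pos[OF ab] quotient_of_coprime[OF ab] quotient_of_div[OF ab] by auto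
  hence y_eq: "y = of_int a / of_int b"
    using x by (simp add: of_rat_divide)
  have "\<not> int p dvd b"
  proof
    assume dvd: "int p dvd b"
    have "\<not> int p dvd a"
    proof
      assume "int p dvd a"
      hence "is_unit (int p)"
        using dvd cop by (auto dest: coprime_common_divisor)
      thus False
        using p_gt_1 by simp
    qed
    hence "v y = 1 / v (of_int b)"
      by (simp add: y_eq divide v_of_int_coprime)
    moreover have "v (of_int b) < 1" "v (of_int b) > 0"
      using v_of_int_dvd[OF dvd] v_p_less b by auto
    ultimately have "1 < v y"
      by (simp add: less_divide_eq_1_pos del: pos_iff)
    thus False
      using vy by simp
  qed
  then obtain j where j: "v (1 - of_int (j * b)) \<le> v (of_nat p)" and vb: "v (of_int b) = 1"
    using int_inverse_mod_p v_of_int_coprime by blast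
  have "y - of_int (a * j) = of_int a * (1 - of_int (j * b)) / of_int b"
    using b by (simp add: y_eq field_simps)
  hence "v (y - of_int (a * j)) = v (of_int a) * v (1 - of_int (j * b))"
    using vb by (simp add: divide mult)
  also have "\<dots> \<le> 1 * v (of_nat p)"
    using j of_int_le_1[of a] by (intro mult_mono) auto
  finally have "v (y - of_int (a * j)) \<le> v (of_nat p)"
    by simp
  hence "v ((z - y) + (y - of_int (a * j))) \<le> v (of_nat p)"
    using zy by (intro add_le) auto
  thus ?thesis
    by (intro exI[of _ "a * j"]) simp
qed

text \<open>Completeness in the form needed for digit expansions: the ultrametric inequality makes
  the bound on one step a bound on all later steps, and hence on the distance to the limit.\<close>

lemma Qp_limit:
  assumes "\<And>n. S n \<in> Qp" "\<And>n. v (S (Suc n) - S n) \<le> v (of_nat p) ^ n"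
  shows "\<exists>z\<in>Qp. \<forall>n. v (z - S n) \<le> v (of_nat p) ^ n"
proof -
  let ?P = "v (of_nat p)"
  interpret M: Metric_space Qp "\<lambda>x y. v (x - y)"
    by (rule Metric_space_nonarch_abs[OF nonarch])
  have step: "v (S (n + k) - S n) \<le> ?P ^ n" for n k
  proof (induction k)
    case (Suc k)
    have "v (S (Suc (n + k)) - S (n + k)) \<le> ?P ^ n"
      by (rule order_trans[OF assms(2) power_decreasing]) (use v_p_less in auto)
    from add_le[OF this Suc] show ?case
      by simp
  qed simp
  have step': "v (S m - S n) \<le> ?P ^ n" if "n \<le> m" for m n
    using step[of n "m - n"] that by simp
  have "M.MCauchy S"
    unfolding M.MCauchy_def
  proof (intro conjI allI impI)
    fix e :: real assume "e > 0"
    then obtain N where N: "?P ^ N < e"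
      using real_arch_pow_inv v_p_less by blast
    show "\<exists>N. \<forall>n n'. N \<le> n \<longrightarrow> N \<le> n' \<longrightarrow> v (S n - S n') < e"
    proof (intro exI[of _ N] allI impI)
      fix n n' assume "N \<le> n" "N \<le> n'"
      from diff_le[OF step'[OF this(1)] step'[OF this(2)]] show "v (S n - S n') < e"
        using N by simp
    qed
  qed (use assms(1) in auto)
  moreover have "M.mcomplete"
    using setting by (simp add: padic_setting_def is_padic_numbers_def)
  ultimately obtain z where "limitin M.mtopology S z sequentially"
    unfolding M.mcomplete_def by blast
  hence z: "z \<in> Qp" "\<And>e. e > 0 \<Longrightarrow> \<forall>\<^sub>F n in sequentially. S n \<in> Qp \<and> v (S n - z) < e"
    unfolding M.limitin_metric by auto
  have "v (z - S n) \<le> ?P ^ n" for n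
  proof -
    have "?P ^ n > 0"
      using v_p_pos by (rule zero_less_power)
    from eventually_happens[OF eventually_conj[OF z(2)[OF this] eventually_ge_at_top[of n]]]
    obtain m where "v (S m - z) < ?P ^ n" "n \<le> m"
      by auto
    from diff_le[OF step'[OF this(2)], of "S m - z"] this(1) show ?thesis
      by simp
  qed
  thus ?thesis
    using z(1) by blast
qed

text \<open>
  A family independent modulo \<open>p\<close> is independent over the p-adic numbers, which bounds its length by the
  degree; by completeness a maximal one spans, so it has exactly that length.
\<close>

definition indep_mod_p :: "nat \<Rightarrow> (nat \<Rightarrow> 'a) \<Rightarrow> bool"
  where "indep_mod_p m u \<longleftrightarrow> (\<forall>i<m. u i \<in> int_ring v F) \<and>
    (\<forall>c::nat \<Rightarrow> int. v (\<Sum>i<m. of_int (c i) * u i) \<le> v (of_nat p) \<longrightarrow> (\<forall>i<m. int p dvd c i))"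

lemma indep_mod_p_le:
  assumes "indep_mod_p m u"
  shows "m \<le> ext_degree Qp F"
proof (rule base.independent_le_dimension[OF dimension])
  show "u i \<in> F" if "i < m" for i
    using that assms by (auto simp: indep_mod_p_def int_ring_def)
  fix c assume c: "\<forall>i<m. c i \<in> Qp" "(\<Sum>i<m. c i * u i) = 0"
  show "\<forall>i<m. c i = 0"
  proof (rule ccontr)
    assume "\<not> (\<forall>i<m. c i = 0)"
    then obtain i0 where i0: "i0 < m" "c i0 \<noteq> 0"
      by blast
    have "finite ((\<lambda>i. v (c i)) ` {..<m})" "(\<lambda>i. v (c i)) ` {..<m} \<noteq> {}"
      using i0 by auto
    from Max_in[OF this] obtain j where j: "j < m" "v (c j) = Max ((\<lambda>i. v (c i)) ` {..<m})"
      by auto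
    have le: "v (c i) \<le> v (c j)" if "i < m" for i
      using that by (auto simp: j(2))
    have "0 < v (c i0)"
      using i0(2) by simp
    hence "0 < v (c j)"
      using le[OF i0(1)] by linarith
    hence cj: "c j \<noteq> 0"
      by simp
    \<comment> \<open>Division by a largest coefficient makes all coefficients integral and
      \<open>d j = 1\<close>. After rounding to integers the relation holds modulo p, and
      independence forces p to divide a rounding of 1.\<close>
    define d where "d i = c i / c j" for i
    have "\<exists>k. v (d i - of_int k) \<le> v (of_nat p)" if "i < m" for i
      using that c(1) le[OF that] cj j(1)
      by (intro Zp_approx) (auto simp: d_def divide intro: base.divide_mem)
    then obtain k where k: "\<And>i. i < m \<Longrightarrow> v (d i - of_int (k i)) \<le> v (of_nat p)"
      by metis
    have "(\<Sum>i<m. d i * u i) = (\<Sum>i<m. c i * u i) / c j"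
      by (simp add: d_def sum_divide_distrib)
    hence "(\<Sum>i<m. of_int (k i) * u i) = - (\<Sum>i<m. (d i - of_int (k i)) * u i)"
      using c(2) by (simp add: algebra_simps sum_subtractf)
    also have "v \<dots> \<le> v (of_nat p)"
      unfolding uminus
    proof (rule sum_le)
      fix i assume "i \<in> {..<m}"
      hence "v (d i - of_int (k i)) \<le> v (of_nat p)" "v (u i) \<le> 1"
        using k assms by (auto simp: indep_mod_p_def int_ring_def)
      thus "v ((d i - of_int (k i)) * u i) \<le> v (of_nat p)"
        unfolding mult using mult_mono[of "v (d i - of_int (k i))" "v (of_nat p)" "v (u i)" 1] by simp
    qed simp
    finally have "int p dvd k j"
      using assms j(1) by (auto simp: indep_mod_p_def)
    hence "v (of_int (k j)) \<le> v (of_nat p)"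
      by (rule v_of_int_dvd)
    from add_le[OF k[OF j(1)] this] show False
      using v_p_less cj by (simp add: d_def)
  qed
qed

lemma indep_mod_p_maximal:
  "\<exists>m u. indep_mod_p m u \<and>
     (\<forall>x\<in>int_ring v F. \<exists>d. (\<forall>i<m. d i \<in> {0..<int p}) \<and> v (x - (\<Sum>i<m. of_int (d i) * u i)) \<le> v (of_nat p))"
proof -
  define m where "m = (GREATEST m. \<exists>u. indep_mod_p m u)"
  have "\<exists>u. indep_mod_p 0 u"
    by (simp add: indep_mod_p_def)
  hence ex: "\<exists>u. indep_mod_p m u"
    unfolding m_def by (rule GreatestI_nat) (use indep_mod_p_le in blast)
  have m_max: "\<not> indep_mod_p (Suc m) u" for u
  proof
    assume "indep_mod_p (Suc m) u"
    hence "Suc m \<le> m"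
      unfolding m_def by (intro Greatest_le_nat) (use indep_mod_p_le in blast)+
    thus False by simp
  qed
  obtain u where u: "indep_mod_p m u"
    using ex by blast
  let ?P = "v (of_nat p)"
  show ?thesis
  proof (intro exI[of _ m] exI[of _ u] conjI ballI)
    show "indep_mod_p m u" by fact
    fix x assume x: "x \<in> int_ring v F"
    \<comment> \<open>Appending x to a family of maximal length creates a relation modulo p. Its
      coefficient at x is prime to p, since otherwise the relation would live on \<open>u\<close>
      alone; inverting that coefficient expresses x through \<open>u\<close>.\<close>
    have "\<not> indep_mod_p (Suc m) (u(m := x))"
      by (rule m_max)
    moreover have "\<forall>i<Suc m. (u(m := x)) i \<in> int_ring v F"
      using u x by (auto simp: indep_mod_p_def)
    ultimately obtain c :: "nat \<Rightarrow> int" where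
      "v (\<Sum>i<Suc m. of_int (c i) * (u(m := x)) i) \<le> ?P" and nd: "\<not> (\<forall>i<Suc m. int p dvd c i)"
      unfolding indep_mod_p_def by blast
    hence c: "v ((\<Sum>i<m. of_int (c i) * u i) + of_int (c m) * x) \<le> ?P"
      by simp
    have vx: "v x \<le> 1" and vu: "\<And>i. i < m \<Longrightarrow> v (u i) \<le> 1"
      using x u by (auto simp: indep_mod_p_def int_ring_def)
    have "\<not> int p dvd c m"
    proof
      assume dvd: "int p dvd c m"
      have "v (of_int (c m)) * v x \<le> ?P * 1"
        using vx v_of_int_dvd[OF dvd] by (intro mult_mono) auto
      hence "v (of_int (c m) * x) \<le> ?P"
        by (simp add: mult)
      from diff_le[OF c this] have "\<forall>i<m. int p dvd c i"
        using u by (simp add: indep_mod_p_def)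
      with dvd nd show False
        by (auto simp: less_Suc_eq)
    qed
    then obtain j where j: "v (1 - of_int (j * c m)) \<le> ?P"
      using int_inverse_mod_p by blast
    \<comment> \<open>Multiplying the relation by j makes the coefficient of x congruent to 1, so
      the other coefficients \<open>j * c i\<close> change sign when x is isolated. Reduction to
      digits changes them by multiples of p only.\<close>
    define d where "d i = (- j * c i) mod int p" for i
    have d: "v (of_int (d i + j * c i)) \<le> ?P" for i
    proof -
      have "d i + j * c i = (- j * c i) mod int p - (- j * c i)"
        unfolding d_def by simp
      also have "int p dvd \<dots>"
        by (metis dvd_minus_mod dvd_diff_commute)
      finally show ?thesis
        by (rule v_of_int_dvd)
    qed
    have "x - (\<Sum>i<m. of_int (d i) * u i) = (1 - of_int (j * c m)) * x
        + of_int j * ((\<Sum>i<m. of_int (c i) * u i) + of_int (c m) * x)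
        - (\<Sum>i<m. of_int (d i + j * c i) * u i)"
      by (simp add: algebra_simps sum.distrib sum_distrib_left)
    also have "v \<dots> \<le> ?P"
    proof (intro diff_le add_le sum_le)
      show "v ((1 - of_int (j * c m)) * x) \<le> ?P"
        unfolding mult using mult_mono[OF j vx] by simp
      show "v (of_int j * ((\<Sum>i<m. of_int (c i) * u i) + of_int (c m) * x)) \<le> ?P"
        unfolding mult[of "of_int j"] using mult_mono[OF of_int_le_1[of j] c] by simp
      show "v (of_int (d i + j * c i) * u i) \<le> ?P" if "i \<in> {..<m}" for i
        unfolding mult using mult_mono[OF d[of i] vu[of i]] that by simp
    qed simp
    finally show "\<exists>d. (\<forall>i<m. d i \<in> {0..<int p}) \<and> v (x - (\<Sum>i<m. of_int (d i) * u i)) \<le> ?P"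
      using p_gt_1 by (intro exI[of _ d]) (auto simp: d_def)
  qed
qed

text \<open>Digit vectors over a maximal family represent the classes modulo p and are pairwise
  incongruent by independence. The family has as many members as the degree, because repeated digit
  extraction expands every integer of F with coefficients that converge in
  \<open>Qp\<close>.\<close>

lemma mod_p_transversal:
  "\<exists>T. is_transversal T (int_ring v F) {x \<in> F. v x \<le> v (of_nat p)} \<and> finite T \<and>
     card T = p ^ ext_degree Qp F"
proof -
  let ?P = "v (of_nat p)"
  obtain m u where u: "indep_mod_p m u" and
    digits: "\<And>x. x \<in> int_ring v F \<Longrightarrow>
      \<exists>d. (\<forall>i<m. d i \<in> {0..<int p}) \<and> v (x - (\<Sum>i<m. of_int (d i) * u i)) \<le> ?P"
    using indep_mod_p_maximal by blast
  have u_int: "u i \<in> F" "v (u i) \<le> 1" if "i < m" for i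
    using u that by (auto simp: indep_mod_p_def int_ring_def)
  define lin where "lin d = (\<Sum>i<m. of_int (d i) * u i)" for d
  have lin_mem: "lin d \<in> int_ring v F" for d
  proof -
    have "v (of_int (d i) * u i) \<le> 1" if "i < m" for i
      unfolding mult using mult_mono[OF of_int_le_1[of "d i"] u_int(2)[OF that]] by simp
    thus ?thesis
      unfolding lin_def int_ring_def using u_int
      by (auto intro!: sum_mem mult_mem sum_le)
  qed
  have "ext_degree Qp F \<le> m"
  proof (rule base.dimension_le_spanning[OF dimension])
    have int_case: "\<exists>c. (\<forall>i<m. c i \<in> Qp) \<and> x = (\<Sum>i<m. c i * u i)" if x: "x \<in> int_ring v F" for x
    proof -
      obtain D where D: "\<And>y. y \<in> int_ring v F \<Longrightarrow> v (y - lin (D y)) \<le> ?P"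
        using digits unfolding lin_def by metis
      \<comment> \<open>The remainders of digit extraction: remove the leading digit combination,
        which leaves a multiple of p, and divide by p.\<close>
      define Y where "Y = rec_nat x (\<lambda>_ y. (y - lin (D y)) / of_nat p)"
      have Y0: "Y 0 = x" and YS: "Y (Suc k) = (Y k - lin (D (Y k))) / of_nat p" for k
        by (auto simp: Y_def)
      have Y: "Y k \<in> int_ring v F" for k
      proof (induction k)
        case (Suc k)
        have "v (Y (Suc k)) \<le> 1"
          using D[OF Suc] v_p_pos by (simp add: YS divide)
        moreover have "Y (Suc k) \<in> F"
          using Suc lin_mem[of "D (Y k)"] by (auto simp: YS int_ring_def intro: divide_mem diff_mem)
        ultimately show ?case
          by (simp add: int_ring_def)
      qed (simp add: Y0 x)
      define S where "S i N = (\<Sum>k<N. of_int (D (Y k) i) * of_nat p ^ k :: 'a)" for i N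
      have expand: "x = (\<Sum>i<m. S i N * u i) + of_nat p ^ N * Y N" for N
      proof (induction N)
        case (Suc N)
        have "Y N = lin (D (Y N)) + of_nat p * Y (Suc N)"
          using p_gt_1 by (simp add: YS)
        hence "of_nat p ^ N * Y N = of_nat p ^ N * (lin (D (Y N)) + of_nat p * Y (Suc N))"
          by (rule arg_cong)
        also have "\<dots> = (\<Sum>i<m. of_int (D (Y N) i) * of_nat p ^ N * u i) + of_nat p ^ Suc N * Y (Suc N)"
          by (simp add: lin_def algebra_simps sum_distrib_left)
        finally show ?case
          using Suc
          by (simp add: S_def distrib_right sum.distrib)
      qed (simp add: S_def Y0)
      have "\<exists>z\<in>Qp. \<forall>n. v (z - S i n) \<le> ?P ^ n" for i
      proof (rule Qp_limit)
        show "S i n \<in> Qp" for n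
          unfolding S_def by (intro base.sum_mem base.mult_mem base.power_mem) auto
        show "v (S i (Suc n) - S i n) \<le> ?P ^ n" for n
          using mult_mono[OF of_int_le_1[of "D (Y n) i"] order_refl[of "?P ^ n"]]
          by (simp add: S_def mult power)
      qed
      then obtain z where z: "\<And>i. z i \<in> Qp" "\<And>i n. v (z i - S i n) \<le> ?P ^ n"
        by metis
      have "x = (\<Sum>i<m. z i * u i)"
      proof (rule eq_of_common_approx)
        show "(\<lambda>n. ?P ^ n) \<longlonglongrightarrow> 0"
          using v_p_less by (intro LIMSEQ_power_zero) simp
        fix n
        have "v (of_nat p ^ n * Y n) \<le> ?P ^ n"
          using mult_mono[OF order_refl[of "?P ^ n"], of "v (Y n)" 1] Y[of n]
          by (simp add: mult power int_ring_def)
        thus "v (x - (\<Sum>i<m. S i n * u i)) \<le> ?P ^ n"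
          by (subst expand[of n]) simp
        have "v ((z i - S i n) * u i) \<le> ?P ^ n" if "i < m" for i
          unfolding mult using mult_mono[OF z(2)[of i n] u_int(2)[OF that]] by simp
        hence "v (\<Sum>i<m. (z i - S i n) * u i) \<le> ?P ^ n"
          by (intro sum_le) auto
        thus "v ((\<Sum>i<m. z i * u i) - (\<Sum>i<m. S i n * u i)) \<le> ?P ^ n"
          by (simp add: left_diff_distrib sum_subtractf)
      qed
      thus ?thesis
        using z(1) by (intro exI[of _ z]) simp
    qed
    fix x assume x: "x \<in> F"
    show "\<exists>c. (\<forall>i<m. c i \<in> Qp) \<and> x = (\<Sum>i<m. c i * u i)"
    proof (cases "x = 0")
      case True
      thus ?thesis
        by (intro exI[of _ "\<lambda>_. 0"]) auto
    next
      case False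
      hence "1 / v x > 0"
        by simp
      \<comment> \<open>A power of p moves x into the ring of integers, where the expansion is
        available.\<close>
      then obtain N where N: "?P ^ N < 1 / v x"
        using real_arch_pow_inv v_p_less by blast
      have "v (of_nat p ^ N * x) \<le> 1"
        using N False by (simp add: mult power field_simps)
      moreover have "of_nat p ^ N * x \<in> F"
        by (intro mult_mem power_mem x of_nat_mem)
      ultimately have "of_nat p ^ N * x \<in> int_ring v F"
        by (simp add: int_ring_def)
      then obtain c where c: "\<forall>i<m. c i \<in> Qp" "of_nat p ^ N * x = (\<Sum>i<m. c i * u i)"
        using int_case by blast
      have "x = of_nat p ^ N * x / of_nat p ^ N"
        using p_gt_1 by simp
      hence "x = (\<Sum>i<m. (c i / of_nat p ^ N) * u i)"
        unfolding c(2) by (simp add: sum_divide_distrib)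
      thus ?thesis
        using c(1) by (intro exI[of _ "\<lambda>i. c i / of_nat p ^ N"])
          (auto intro: base.divide_mem base.power_mem base.of_nat_mem)
    qed
  qed
  hence m: "m = ext_degree Qp F"
    using indep_mod_p_le[OF u] by simp
  let ?B = "{x \<in> F. v x \<le> ?P}" and ?I = "{..<m} \<rightarrow>\<^sub>E {0..<int p}"
  have lin_inj: "d = e" if "d \<in> ?I" "e \<in> ?I" "v (lin d - lin e) \<le> ?P" for d e
  proof -
    have "lin d - lin e = (\<Sum>i<m. of_int (d i - e i) * u i)"
      by (simp add: lin_def sum_subtractf left_diff_distrib)
    hence dvd: "\<forall>i<m. int p dvd d i - e i"
      using that(3) u unfolding indep_mod_p_def by metis
    have "d i = e i" if "i < m" for i
    proof -
      have "d i mod int p = e i mod int p"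
        using dvd that by (simp add: mod_eq_dvd_iff)
      moreover have "0 \<le> d i" "d i < int p" "0 \<le> e i" "e i < int p"
        using PiE_mem[OF \<open>d \<in> ?I\<close>, of i] PiE_mem[OF \<open>e \<in> ?I\<close>, of i] that by auto
      ultimately show ?thesis
        by simp
    qed
    thus ?thesis
      using that(1,2) by (intro PiE_ext) auto
  qed
  have cl: "add_closed ?B"
    by (auto simp: add_closed_def intro: diff_mem diff_le)
  have "is_transversal (lin ` ?I) (int_ring v F) ?B"
  proof (rule is_transversalI)
    fix x assume x: "x \<in> int_ring v F"
    then obtain d where d: "\<forall>i<m. d i \<in> {0..<int p}" "v (x - lin d) \<le> ?P"
      using digits unfolding lin_def by blast
    have "lin (restrict d {..<m}) = lin d"
      by (simp add: lin_def)
    moreover have "restrict d {..<m} \<in> ?I"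
      using d by auto
    moreover have "x - lin d \<in> F"
      using x lin_mem[of d] by (auto simp: int_ring_def intro: diff_mem)
    ultimately show "\<exists>r\<in>lin ` ?I. x - r \<in> ?B"
      using d(2) by (metis (mono_tags, lifting) imageI mem_Collect_eq)
  qed (use lin_mem lin_inj cl in auto)
  moreover have "inj_on lin ?I"
    using lin_inj by (intro inj_onI) auto
  hence "card (lin ` ?I) = p ^ m"
    by (simp add: card_image card_PiE)
  moreover have "finite (lin ` ?I)"
    by (intro finite_imageI finite_PiE) auto
  ultimately show ?thesis
    using m by blast
qed

text \<open>Finitely many classes modulo p leave finitely many values between \<open>v p\<close> and
  1; the largest one below 1 belongs to a uniformizer. The normalization makes \<open>v p\<close>
  the reciprocal of the number of classes, so comparing the two counts determines
  \<open>v \<pi>\<close>.\<close>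

theorem disc_val_exists:
  "\<exists>\<pi> R. disc_val v F \<pi> R \<and> card R = residue_card v F \<and> v \<pi> = 1 / real (residue_card v F)"
proof -
  let ?P = "v (of_nat p)"
  obtain T where T: "is_transversal T (int_ring v F) {x \<in> F. v x \<le> ?P}" "finite T"
    "card T = p ^ ext_degree Qp F"
    using mod_p_transversal by blast
  note Td = is_transversalD[OF T(1)]
  have p_mem: "of_nat p \<in> F"
    by simp
  \<comment> \<open>A representative modulo p differs from x by less than \<open>v x\<close>, hence
    has the same absolute value.\<close>
  have rep: "v x \<in> v ` T" if "x \<in> F" "v x \<le> 1" "?P < v x" for x
  proof -
    obtain r where r: "r \<in> T" "x - r \<in> {x \<in> F. v x \<le> ?P}"
      using Td(2)[of x] \<open>x \<in> F\<close> \<open>v x \<le> 1\<close> by (auto simp: int_ring_def)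
    hence "v (r - x) < v x"
      using \<open>?P < v x\<close> by (simp add: minus_commute[of r x])
    hence "v r = v x"
      by (rule eq_of_diff_less)
    thus ?thesis
      using r(1) by (metis imageI)
  qed
  define V where "V = {v x |x. x \<in> F \<and> ?P \<le> v x \<and> v x < 1}"
  have "V \<subseteq> insert ?P (v ` T)"
    unfolding V_def using rep by force
  hence fin: "finite V"
    using T(2) by (auto intro: finite_subset)
  have PV: "?P \<in> V"
    unfolding V_def using p_mem v_p_less by blast
  have V_ex: "\<exists>x. x \<in> F \<and> ?P \<le> v x \<and> v x < 1 \<and> v x = y" if "y \<in> V" for y
    using that unfolding V_def by blast
  have "Max V \<in> V"
    using fin PV by (intro Max_in) auto
  from V_ex[OF this] obtain \<pi> where \<pi>: "\<pi> \<in> F" "?P \<le> v \<pi>" "v \<pi> < 1" "v \<pi> = Max V"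
    by blast
  have \<pi>_pos: "v \<pi> > 0"
    using \<pi>(2) v_p_pos by linarith
  have max: "v x \<le> v \<pi>" if "x \<in> F" "v x < 1" for x
  proof (cases "?P \<le> v x")
    case True
    hence "v x \<in> V"
      using that unfolding V_def by blast
    thus ?thesis
      using fin \<pi>(4) by simp
  qed (use \<pi>(2) in linarith)
  have group: "\<exists>k. v x = v \<pi> powi k" if x: "x \<in> F" "x \<noteq> 0" for x
  proof -
    \<comment> \<open>Taking the floor puts \<open>v y\<close> above \<open>v \<pi>\<close> and at
      most at 1; the maximality of \<open>v \<pi>\<close> below 1 then leaves only the value
      1.\<close>
    define k where "k = \<lfloor>log (v \<pi>) (v x)\<rfloor>"
    define y where "y = x / \<pi> powi k"
    have vx: "v x = v \<pi> powr log (v \<pi>) (v x)"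
      using \<pi>(3) \<pi>_pos x(2) by (intro powr_log_cancel[symmetric]) auto
    have vk: "v \<pi> powi k = v \<pi> powr k" for k :: int
      using \<pi>_pos by (simp add: powr_real_of_int')
    have "v \<pi> powr (real_of_int k + 1) < v \<pi> powr log (v \<pi>) (v x)"
      using \<pi>(3) \<pi>_pos unfolding k_def by (intro powr_less_mono') linarith+
    moreover have "v \<pi> powr log (v \<pi>) (v x) \<le> v \<pi> powr k"
      using \<pi>(3) unfolding k_def by (intro powr_mono') auto
    ultimately have "v \<pi> powr (real_of_int k + 1) < v x" "v x \<le> v \<pi> powr k"
      using vx by simp_all
    hence "v y \<le> 1" "v \<pi> < v y"
      using \<pi>_pos by (auto simp: y_def divide power_int vk powr_add field_simps)
    moreover have "y \<in> F"
      using x \<pi>(1) by (auto simp: y_def intro: divide_mem power_int_mem)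
    ultimately have "v y = 1"
      using max[of y] by linarith
    hence "v x = v \<pi> powi k"
      using \<pi>_pos by (simp add: y_def divide power_int)
    thus ?thesis ..
  qed
  have cl: "add_closed (max_ideal v F)"
    by (auto simp: add_closed_def max_ideal_def intro: diff_mem diff_less)
  obtain R where R: "is_transversal R (int_ring v F) (max_ideal v F)"
    using transversal_exists[OF cl] by blast
  note Rd = is_transversalD[OF R]
  have "\<exists>s\<in>T. r - s \<in> {x \<in> F. v x \<le> ?P}" if "r \<in> R" for r
    using Td(2) Rd(1) that by blast
  \<comment> \<open>Congruence modulo p is finer than congruence modulo the maximal ideal, so
    \<open>f\<close> embeds \<open>R\<close> into the finite set \<open>T\<close>.\<close>
  then obtain f where f: "\<And>r. r \<in> R \<Longrightarrow> f r \<in> T \<and> r - f r \<in> F \<and> v (r - f r) \<le> ?P"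
    by (metis (mono_tags, lifting) mem_Collect_eq)
  have "inj_on f R"
  proof (rule inj_onI)
    fix r s assume rs: "r \<in> R" "s \<in> R" "f r = f s"
    have "v ((r - f r) - (s - f s)) \<le> ?P" "(r - f r) - (s - f s) \<in> F"
      using f[OF rs(1)] f[OF rs(2)] by (auto intro: diff_le diff_mem)
    hence "r - s \<in> max_ideal v F"
      using rs(3) v_p_less by (auto simp: max_ideal_def)
    thus "r = s"
      using Rd(3)[OF cl rs(1,2)] by blast
  qed
  hence finR: "finite R"
    using f T(2) by (meson finite_imageD finite_subset image_subsetI)
  have dv: "disc_val v F \<pi> R"
    using nonarch subfield \<pi>(1,3) \<pi>_pos group R finR
    by (auto simp: disc_val_def disc_val_axioms_def nonarch_def sub_field_def)
  interpret disc_val v F \<pi> R by (rule dv)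
  obtain e where e: "?P = v \<pi> powi e"
    using value_group[of "of_nat p"] p_gt_1 by auto
  have "e > 0"
    using v_p_less powi_less_iff[of e 0] e by simp
  then obtain k where k: "e = int k" "k > 0"
    by (metis zero_less_imp_eq_int)
  \<comment> \<open>The second count: the same quotient is filtered by k layers, each as large as
    the residue field.\<close>
  obtain T' where T': "is_transversal T' (vball 0) (vball (0 + int k))" "card T' = card R ^ k"
    using vball_transversal[of 0 k] by blast
  have "vball (0 + int k) = {x \<in> F. v x \<le> ?P}"
    by (simp add: vball_def e k(1))
  hence "card T' = card T"
    using transversal_card_eq[of T' "vball 0" _ T] T'(1) T(1) vball_add_closed vball_0 by metis
  hence "real (card R) ^ k = real p ^ ext_degree Qp F"
    using T'(2) T(3) by (metis of_nat_power)
  hence "(1 / real (card R)) ^ k = v \<pi> ^ k"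
    using v_p e k(1) by (simp add: power_one_over)
  hence "v \<pi> = 1 / real (card R)"
    using k(2) by (simp add: power_eq_iff_eq_base)
  moreover have "card R = residue_card v F"
    using add_index_eq_card[OF R cl] by (simp add: residue_card_def)
  ultimately show ?thesis
    using dv by auto
qed

end

section \<open>Quadratic extensions\<close>

lemma is_basis_2_iff:
  "is_basis A M 2 e \<longleftrightarrow>
    (\<forall>a\<in>A. \<forall>b\<in>A. a * e 0 + b * e 1 \<in> M) \<and>
    (\<forall>x\<in>M. \<exists>a\<in>A. \<exists>b\<in>A. x = a * e 0 + b * e 1) \<and>
    (\<forall>a\<in>A. \<forall>b\<in>A. \<forall>c\<in>A. \<forall>d\<in>A. a * e 0 + b * e 1 = c * e 0 + d * e 1 \<longrightarrow> a = c \<and> b = d)"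
proof -
  define f where "f c = (\<Sum>i<2. c i * e i)" for c
  have f: "f c = c 0 * e 0 + c 1 * e 1" for c
    by (simp add: f_def numeral_2_eq_2)
  define g where "g a b = (\<lambda>i\<in>{..<2::nat}. if i = 0 then a else b)" for a b :: 'a
  have g: "g a b 0 = a" "g a b 1 = b" "a \<in> A \<Longrightarrow> b \<in> A \<Longrightarrow> g a b \<in> {..<2} \<rightarrow>\<^sub>E A" for a b
    by (auto simp: g_def)
  have ext: "c = d" if "c \<in> {..<2} \<rightarrow>\<^sub>E A" "d \<in> {..<2} \<rightarrow>\<^sub>E A" "c 0 = d 0" "c 1 = d 1" for c d :: "nat \<Rightarrow> 'a"
    using that by (intro PiE_ext[OF that(1,2)]) (auto simp: less_2_cases_iff)
  have mem: "c 0 \<in> A" "c 1 \<in> A" if "c \<in> {..<2} \<rightarrow>\<^sub>E A" for c :: "nat \<Rightarrow> 'a"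
    using PiE_mem[OF that, of 0] PiE_mem[OF that, of 1] by simp_all
  have "is_basis A M 2 e \<longleftrightarrow> bij_betw f ({..<2} \<rightarrow>\<^sub>E A) M"
    unfolding is_basis_def f_def ..
  also have "\<dots> \<longleftrightarrow> (\<forall>a\<in>A. \<forall>b\<in>A. a * e 0 + b * e 1 \<in> M) \<and>
    (\<forall>x\<in>M. \<exists>a\<in>A. \<exists>b\<in>A. x = a * e 0 + b * e 1) \<and>
    (\<forall>a\<in>A. \<forall>b\<in>A. \<forall>c\<in>A. \<forall>d\<in>A. a * e 0 + b * e 1 = c * e 0 + d * e 1 \<longrightarrow> a = c \<and> b = d)"
    (is "_ \<longleftrightarrow> ?R")
  proof
    assume bij: "bij_betw f ({..<2} \<rightarrow>\<^sub>E A) M"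
    show ?R
    proof (intro conjI ballI)
      fix a b assume ab: "a \<in> A" "b \<in> A"
      show "a * e 0 + b * e 1 \<in> M"
        using bij_betw_apply[OF bij g(3)[OF ab]] by (simp only: f g)
    next
      fix x assume "x \<in> M"
      then obtain c where "c \<in> {..<2} \<rightarrow>\<^sub>E A" "x = f c"
        using bij by (auto simp: bij_betw_def)
      thus "\<exists>a\<in>A. \<exists>b\<in>A. x = a * e 0 + b * e 1"
        using mem[of c] f[of c] by blast
    next
      fix a b c d assume A: "a \<in> A" "b \<in> A" "c \<in> A" "d \<in> A"
      show "a * e 0 + b * e 1 = c * e 0 + d * e 1 \<longrightarrow> a = c \<and> b = d"
      proof
        assume "a * e 0 + b * e 1 = c * e 0 + d * e 1"
        hence "f (g a b) = f (g c d)"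
          by (simp only: f g)
        hence "g a b = g c d"
          using inj_onD[OF bij_betw_imp_inj_on[OF bij] _ g(3)[OF A(1,2)] g(3)[OF A(3,4)]] by blast
        thus "a = c \<and> b = d"
          using g by metis
      qed
    qed
  next
    assume ?R
    hence R1: "\<And>a b. a \<in> A \<Longrightarrow> b \<in> A \<Longrightarrow> a * e 0 + b * e 1 \<in> M"
      and R2: "\<And>x. x \<in> M \<Longrightarrow> \<exists>a\<in>A. \<exists>b\<in>A. x = a * e 0 + b * e 1"
      and R3: "\<And>a b c d. a \<in> A \<Longrightarrow> b \<in> A \<Longrightarrow> c \<in> A \<Longrightarrow> d \<in> A \<Longrightarrow>
        a * e 0 + b * e 1 = c * e 0 + d * e 1 \<Longrightarrow> a = c \<and> b = d"
      by blast+
    show "bij_betw f ({..<2} \<rightarrow>\<^sub>E A) M"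
      unfolding bij_betw_def
    proof
      show "inj_on f ({..<2} \<rightarrow>\<^sub>E A)"
      proof (rule inj_onI)
        fix c d assume cd: "c \<in> {..<2} \<rightarrow>\<^sub>E A" "d \<in> {..<2} \<rightarrow>\<^sub>E A" "f c = f d"
        from R3[OF mem[OF cd(1)] mem[OF cd(2)]] cd(3) show "c = d"
          by (intro ext[OF cd(1,2)]) (auto simp: f)
      qed
      show "f ` ({..<2} \<rightarrow>\<^sub>E A) = M"
      proof
        show "f ` ({..<2} \<rightarrow>\<^sub>E A) \<subseteq> M"
          using R1 mem by (auto simp: f)
        show "M \<subseteq> f ` ({..<2} \<rightarrow>\<^sub>E A)"
        proof
          fix x assume "x \<in> M"
          then obtain a b where ab: "a \<in> A" "b \<in> A" "x = a * e 0 + b * e 1"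
            using R2 by blast
          hence "x = f (g a b)"
            by (simp only: f g)
          thus "x \<in> f ` ({..<2} \<rightarrow>\<^sub>E A)"
            using g(3)[OF ab(1,2)] by blast
        qed
      qed
    qed
  qed
  finally show ?thesis .
qed

lemma det_mat_2:
  fixes f :: "nat \<times> nat \<Rightarrow> 'a::comm_ring_1"
  shows "Determinant.det (Matrix.mat 2 2 f) = f (0, 0) * f (1, 1) - f (0, 1) * f (1, 0)"
proof -
  let ?A = "Matrix.mat 2 2 f"
  have A: "?A \<in> carrier_mat 2 2"
    by simp
  have "Determinant.det ?A = (\<Sum>j<2. ?A $$ (0, j) * cofactor ?A 0 j)"
    by (rule laplace_expansion_row[OF A]) simp
  moreover have "Determinant.det (mat_delete ?A 0 0) = f (1, 1)" "Determinant.det (mat_delete ?A 0 1) = f (1, 0)"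
    by (subst det_single; simp add: mat_delete_def)+
  ultimately show ?thesis
    by (simp add: numeral_2_eq_2 cofactor_def)
qed

locale quad_ext = disc_val v F \<pi> R + ext: sub_field K
  for v :: "'a::field_char_0 \<Rightarrow> real" and F \<pi> R K +
  assumes F_subset: "F \<subseteq> K" and dim_K: "ring.dimension ambient 2 F K"
begin

lemma powi_add: "v \<pi> powi (i + j) = v \<pi> powi i * v \<pi> powi j"
  by (simp add: power_int_add)

lemma mult_less_1:
  assumes "v x < 1" "v y \<le> 1"
  shows "v (x * y) < 1"
proof -
  have "v x * v y \<le> v x"
    using assms(2) by (intro mult_left_le) simp_all
  thus ?thesis
    unfolding mult using assms(1) by linarith
qed

lemma ext_degree: "ext_degree F K = 2"
proof -
  interpret ring "ambient :: 'a ring" by rule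
  show ?thesis
    using dimI[OF subfield dim_K] by (simp add: over_def)
qed

lemma spans:
  assumes "\<omega> \<in> K" "\<And>a b. a \<in> F \<Longrightarrow> b \<in> F \<Longrightarrow> a + b * \<omega> = 0 \<Longrightarrow> a = 0 \<and> b = 0"
  shows "K = {a + b * \<omega> |a b. a \<in> F \<and> b \<in> F}"
proof
  show "{a + b * \<omega> |a b. a \<in> F \<and> b \<in> F} \<subseteq> K"
    using F_subset assms(1) by (auto intro!: ext.add_mem ext.mult_mem)
  show "K \<subseteq> {a + b * \<omega> |a b. a \<in> F \<and> b \<in> F}"
  proof
    fix x assume "x \<in> K"
    define u where "u i = (if i = 0 then 1 else \<omega>)" for i :: nat
    have "\<exists>c. (\<forall>i<2. c i \<in> F) \<and> x = (\<Sum>i<2. c i * u i)"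
    proof (rule independent_spans[OF dim_K _ _ \<open>x \<in> K\<close>])
      show "u i \<in> K" for i
        using assms(1) by (simp add: u_def)
      show "\<forall>i<2. c i = 0" if "\<forall>i<2. c i \<in> F" "(\<Sum>i<2. c i * u i) = 0" for c
        using assms(2)[of "c 0" "c 1"] that by (auto simp: u_def numeral_2_eq_2 less_Suc_eq)
    qed
    then obtain c where "\<forall>i<2. c i \<in> F" "x = (\<Sum>i<2. c i * u i)"
      by blast
    hence "x = c 0 + c 1 * \<omega>" "c 0 \<in> F" "c 1 \<in> F"
      by (simp_all add: u_def numeral_2_eq_2)
    thus "x \<in> {a + b * \<omega> |a b. a \<in> F \<and> b \<in> F}"
      by blast
  qed
qed

section \<open>Ramification and generators adapted to the absolute value\<close>

definition ram_rel :: "(real \<times> real) set"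
  where "ram_rel = {(s, t). s \<in> v ` (K - {0}) \<and> t \<in> v ` (K - {0}) \<and> s / t \<in> v ` (F - {0})}"

lemma ram_index: "ramification_index v F K = card (v ` (K - {0}) // ram_rel)"
  by (simp add: ramification_index_def ram_rel_def)

lemma ram_class_eqD:
  assumes "x \<in> K - {0}" "y \<in> K - {0}" "ram_rel `` {v x} = ram_rel `` {v y}"
  shows "v x / v y \<in> v ` (F - {0})"
proof -
  have "1 = v 1"
    by simp
  hence "1 \<in> v ` (F - {0})"
    by (rule image_eqI) simp
  moreover have "v y / v y = 1"
    using assms(2) by simp
  ultimately have "v y / v y \<in> v ` (F - {0})"
    by metis
  hence "v y \<in> ram_rel `` {v y}"
    using assms(2) unfolding Image_singleton_iff ram_rel_def mem_Collect_eq prod.case by blast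
  hence "v y \<in> ram_rel `` {v x}"
    unfolding assms(3) .
  thus ?thesis
    unfolding Image_singleton_iff ram_rel_def mem_Collect_eq prod.case by blast
qed

text \<open>There is a single class modulo the value group of F, so every value of K is equivalent
  to the value of 1.\<close>

lemma unramified_value:
  assumes "unramified v F K" "x \<in> K" "x \<noteq> 0"
  shows "v x \<in> v ` (F - {0})"
proof -
  obtain C where C: "v ` (K - {0}) // ram_rel = {C}"
    using assms(1) card_1_singletonE unfolding unramified_def ram_index by metis
  have cl: "ram_rel `` {v y} = C" if "y \<in> K - {0}" for y
    using quotientI[OF imageI[OF that, of v], of ram_rel] unfolding C by simp
  have x: "x \<in> K - {0}" and K1: "1 \<in> K - {0}"
    using assms by auto
  have "v x / v 1 \<in> v ` (F - {0})"
    by (rule ram_class_eqD[OF x K1]) (simp only: cl[OF x] cl[OF K1])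
  thus ?thesis by simp
qed

text \<open>Modulo the value group of F there are just two classes, so a value outside that group
  has its square inside. The exponent of the square is odd, since otherwise the value itself would
  come from F; dividing by a power of \<pi> leaves a square root of \<open>v \<pi>\<close>.\<close>

lemma ramified_unif:
  assumes "totally_ramified v F K"
  shows "\<exists>\<omega>\<in>K. v \<omega> = sqrt (v \<pi>)"
proof -
  let ?Q = "v ` (K - {0}) // ram_rel"
  have card: "card ?Q = 2"
    using assms unfolding totally_ramified_def ram_index ext_degree by simp
  have mult_F: "r * s \<in> v ` (F - {0})" if rs: "r \<in> v ` (F - {0})" "s \<in> v ` (F - {0})" for r s
  proof -
    obtain x y where xy: "x \<in> F" "x \<noteq> 0" "r = v x" "y \<in> F" "y \<noteq> 0" "s = v y"
      using rs by blast
    hence "r * s = v (x * y)" "x * y \<in> F - {0}"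
      by (auto simp: mult mult_mem)
    thus ?thesis by blast
  qed
  have inv_F: "inverse r \<in> v ` (F - {0})" if r: "r \<in> v ` (F - {0})" for r
  proof -
    obtain x where "x \<in> F" "x \<noteq> 0" "r = v x"
      using r by blast
    hence "inverse r = v (inverse x)" "inverse x \<in> F - {0}"
      by (auto simp: inverse inverse_mem)
    thus ?thesis by blast
  qed
  have "\<exists>x\<in>K - {0}. v x \<notin> v ` (F - {0})"
  proof (rule ccontr)
    assume "\<not> ?thesis"
    hence all: "v x \<in> v ` (F - {0})" if "x \<in> K - {0}" for x
      using that by blast
    have div: "v x / v y \<in> v ` (F - {0})" if "x \<in> K - {0}" "y \<in> K - {0}" for x y
      unfolding divide_inverse using mult_F[OF all[OF that(1)] inv_F[OF all[OF that(2)]]] .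
    have "ram_rel `` {v x} = v ` (K - {0})" if "x \<in> K - {0}" for x
    proof
      show "v ` (K - {0}) \<subseteq> ram_rel `` {v x}"
        using div[OF that] that unfolding Image_singleton_iff ram_rel_def mem_Collect_eq prod.case subset_iff by blast
    qed (auto simp: ram_rel_def)
    hence "?Q \<subseteq> {v ` (K - {0})}"
      by (auto elim!: quotientE)
    hence "card ?Q \<le> 1"
      using card_mono[of "{v ` (K - {0})}" ?Q] by simp
    thus False
      using card by simp
  qed
  then obtain x where x: "x \<in> K - {0}" "v x \<notin> v ` (F - {0})"
    by blast
  have xx: "x * x \<in> K - {0}" and K1: "1 \<in> K - {0}"
    using x ext.mult_mem by auto
  have ne1: "ram_rel `` {v x} \<noteq> ram_rel `` {v 1}"
  proof
    assume "ram_rel `` {v x} = ram_rel `` {v 1}"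
    from ram_class_eqD[OF x(1) K1 this] show False
      using x(2) by simp
  qed
  have ne2: "ram_rel `` {v (x * x)} \<noteq> ram_rel `` {v x}"
  proof
    assume "ram_rel `` {v (x * x)} = ram_rel `` {v x}"
    from ram_class_eqD[OF xx x(1) this] show False
      using x by (simp add: mult)
  qed
  have sub: "{ram_rel `` {v x}, ram_rel `` {v 1}, ram_rel `` {v (x * x)}} \<subseteq> ?Q"
    using quotientI[OF imageI[OF x(1), of v], of ram_rel] quotientI[OF imageI[OF xx, of v], of ram_rel]
      quotientI[OF imageI[OF K1, of v], of ram_rel] by simp
  have fin: "finite ?Q"
    using card by (metis card.infinite zero_neq_numeral)
  have "ram_rel `` {v (x * x)} = ram_rel `` {v 1}"
  proof (rule ccontr)
    assume "ram_rel `` {v (x * x)} \<noteq> ram_rel `` {v 1}"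
    hence "card {ram_rel `` {v x}, ram_rel `` {v 1}, ram_rel `` {v (x * x)}} = 3"
      using ne1 ne2 by (auto simp: card_insert_if simp del: one)
    thus False
      using card_mono[OF fin sub] card by simp
  qed
  from ram_class_eqD[OF xx K1 this] have "v (x * x) / v 1 \<in> v ` (F - {0})" .
  then obtain y where y: "y \<in> F" "y \<noteq> 0" "v x ^ 2 = v y"
    by (auto simp: mult power2_eq_square)
  obtain m where m: "v y = v \<pi> powi m"
    using value_group y by blast
  define j where "j = m div 2"
  have "odd m"
  proof
    assume "even m"
    hence "m = j + j"
      by (simp add: j_def)
    hence "v \<pi> powi m = (v \<pi> powi j) ^ 2"
      by (simp only: powi_add power2_eq_square)
    hence "v x = v (\<pi> powi j)"
      using y(3) m powi_gt_0[of j] power2_eq_iff_nonneg[of "v x" "v \<pi> powi j"] by (simp add: power_int)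
    moreover have "\<pi> powi j \<in> F - {0}"
      using unif_mem by (simp add: power_int_mem)
    ultimately show False
      using x(2) by blast
  qed
  hence mj: "m = (j + j) + 1"
    by (simp add: j_def)
  define w where "w = x / \<pi> powi j"
  have "v w ^ 2 = v \<pi> powi m / (v \<pi> powi j * v \<pi> powi j)"
    using y(3) m by (simp add: w_def divide power_int power_divide power2_eq_square)
  also have "\<dots> = v \<pi>"
    unfolding mj powi_add by simp
  finally have "v w = sqrt (v \<pi>)"
    by (metis nonneg real_sqrt_unique)
  moreover have "w \<in> K"
    using x(1) unif_mem F_subset by (auto simp: w_def intro!: ext.divide_mem ext.power_int_mem)
  ultimately show ?thesis
    by blast
qed

text \<open>Nonzero a have integral exponents with respect to \<pi>, nonzero b \<omega>
  half-integral ones. The two summands never tie, so the ultrametric inequality is an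
  equality.\<close>

lemma ramified_generator:
  assumes "totally_ramified v F K"
  shows "\<exists>\<omega>\<in>K. \<forall>a\<in>F. \<forall>b\<in>F. v (a + b * \<omega>) = max (v a) (sqrt (v \<pi>) * v b)"
proof -
  obtain \<omega> where \<omega>: "\<omega> \<in> K" "v \<omega> = sqrt (v \<pi>)"
    using ramified_unif[OF assms] by blast
  have "v (a + b * \<omega>) = max (v a) (sqrt (v \<pi>) * v b)" if ab: "a \<in> F" "b \<in> F" for a b
  proof (cases "b = 0")
    case False
    have "v a \<noteq> v (b * \<omega>)"
    proof
      assume eq: "v a = v (b * \<omega>)"
      hence "a \<noteq> 0"
        using False \<omega>(2) by (auto simp: mult)
      then obtain i where i: "v a = v \<pi> powi i"
        using value_group ab(1) by blast
      obtain j where j: "v b = v \<pi> powi j"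
        using value_group ab(2) False by blast
      have "v a ^ 2 = v \<pi> * v b ^ 2"
        using eq \<omega>(2) by (simp add: mult power_mult_distrib)
      hence "v \<pi> powi (i + i) = v \<pi> powi (1 + (j + j))"
        unfolding powi_add i j by (simp add: power2_eq_square)
      hence "i + i = 1 + (j + j)"
        unfolding powi_eq_iff .
      thus False
        by presburger
    qed
    from add_eq_max[OF this] show ?thesis
      using \<omega>(2) by (simp add: mult mult.commute)
  qed simp
  thus ?thesis
    using \<omega>(1) by blast
qed

text \<open>The point is an integral w whose residue lies outside the residue field of F. If both
  basis elements were congruent to integers of F, some combination of them with a unit coordinate
  would lie in the maximal ideal of K. That ideal is generated by \<pi> when K is unramified, so all
  coordinates would be divisible by \<pi>.\<close>

lemma unramified_generator:
  assumes unram: "unramified v F K" and basis: "is_basis (int_ring v F) (int_ring v K) 2 e"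
  shows "\<exists>\<omega>\<in>K. \<forall>a\<in>F. \<forall>b\<in>F. v (a + b * \<omega>) = max (v a) (v b)"
proof -
  let ?O = "int_ring v F"
  have e_mem: "\<And>a b. a \<in> ?O \<Longrightarrow> b \<in> ?O \<Longrightarrow> a * e 0 + b * e 1 \<in> int_ring v K"
    and e_span: "\<And>x. x \<in> int_ring v K \<Longrightarrow> \<exists>a\<in>?O. \<exists>b\<in>?O. x = a * e 0 + b * e 1"
    and e_inj: "\<And>a b c d. a \<in> ?O \<Longrightarrow> b \<in> ?O \<Longrightarrow> c \<in> ?O \<Longrightarrow> d \<in> ?O \<Longrightarrow>
        a * e 0 + b * e 1 = c * e 0 + d * e 1 \<Longrightarrow> a = c \<and> b = d"
    using basis unfolding is_basis_2_iff by blast+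
  have O01: "0 \<in> ?O" "1 \<in> ?O"
    by (auto simp: int_ring_def)
  have eK: "e 0 \<in> int_ring v K" "e 1 \<in> int_ring v K"
    using e_mem[OF O01(2,1)] e_mem[OF O01] by simp_all
  have piO: "\<pi> * a \<in> ?O" if "a \<in> ?O" for a
    using that unif_less mult_le_one[of "v \<pi>" "v a"]
    by (auto simp: int_ring_def mult mult_mem unif_mem)
  \<comment> \<open>\<pi> remains a uniformizer in K, so a non-unit is \<pi> times an integral
    element and both of its coordinates are divisible by \<pi>.\<close>
  have small: "\<exists>c\<in>?O. \<exists>d\<in>?O. x = (\<pi> * c) * e 0 + (\<pi> * d) * e 1" if x: "x \<in> K" "v x < 1" for x
  proof -
    have "v x \<le> v \<pi>"
    proof (cases "x = 0")
      case False
      then obtain y where "y \<in> F" "v x = v y"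
        using unramified_value[OF unram x(1)] by blast
      thus ?thesis
        using less_iff_le[of y 0] x(2) by simp
    qed simp
    hence "x / \<pi> \<in> int_ring v K"
      using x(1) unif_mem F_subset by (auto simp: int_ring_def divide intro: ext.divide_mem)
    then obtain c d where "c \<in> ?O" "d \<in> ?O" "x / \<pi> = c * e 0 + d * e 1"
      using e_span by blast
    moreover from this have "x = \<pi> * (c * e 0 + d * e 1)"
      by (simp add: field_simps)
    ultimately show ?thesis
      by (intro bexI[of _ c] bexI[of _ d]) (simp_all add: algebra_simps)
  qed
  have not_unit: "v (\<pi> * c) < 1" if "c \<in> ?O" for c
    using that unif_less by (intro mult_less_1) (auto simp: int_ring_def)
  have "\<exists>w\<in>int_ring v K. \<forall>a\<in>?O. \<not> v (w - a) < 1"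
  proof (rule ccontr)
    assume "\<not> ?thesis"
    then obtain a b where ab: "a \<in> ?O" "v (e 0 - a) < 1" "b \<in> ?O" "v (e 1 - b) < 1"
      using eK by meson
    have aF: "a \<in> K" "b \<in> K" "v a \<le> 1" "v b \<le> 1" "e 0 \<in> K" "e 1 \<in> K"
      using ab eK F_subset by (auto simp: int_ring_def)
    show False
    proof (cases "v a < 1")
      case True
      hence "v (e 0) < 1"
        using add_less[OF ab(2) True] by simp
      then obtain c d where cd: "c \<in> ?O" "d \<in> ?O" "e 0 = (\<pi> * c) * e 0 + (\<pi> * d) * e 1"
        using small[OF aF(5)] by blast
      have "1 = \<pi> * c"
        using e_inj[OF O01(2,1) piO[OF cd(1)] piO[OF cd(2)]] cd(3) by simp
      thus False
        using not_unit[OF cd(1)] by (metis one less_irrefl)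
    next
      case False
      hence va: "v a = 1"
        using aF by simp
      \<comment> \<open>This combination is congruent to b a - a b = 0, although its second
        coordinate -a is a unit.\<close>
      have "b * e 0 - a * e 1 = b * (e 0 - a) - a * (e 1 - b)"
        by (simp add: algebra_simps)
      also have "v \<dots> < 1"
        using ab(2,4) aF(3,4) va mult_right_le_one_le[of "v (e 0 - a)" "v b"]
        by (intro diff_less) (auto simp: mult mult.commute[of "v b"])
      finally obtain c d where cd: "c \<in> ?O" "d \<in> ?O"
        "b * e 0 - a * e 1 = (\<pi> * c) * e 0 + (\<pi> * d) * e 1"
        using small[of "b * e 0 - a * e 1"] aF by (metis ext.diff_mem ext.mult_mem)
      have "- a \<in> ?O"
        using ab(1) by (auto simp: int_ring_def intro: uminus_mem)
      from e_inj[OF ab(3) this piO[OF cd(1)] piO[OF cd(2)]] cd(3) have "- a = \<pi> * d"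
        by simp
      thus False
        using not_unit[OF cd(2)] va by (metis uminus less_irrefl)
    qed
  qed
  then obtain w where w: "w \<in> K" "v w \<le> 1" "\<And>a. a \<in> ?O \<Longrightarrow> 1 \<le> v (w - a)"
    by (auto simp: int_ring_def not_less)
  have vw: "v w = 1"
    using w(2) w(3)[OF O01(1)] by simp
  have "v (a + b * w) = max (v a) (v b)" if ab: "a \<in> F" "b \<in> F" for a b
  proof (cases "v a = v b \<and> b \<noteq> 0")
    case False
    thus ?thesis
      using add_eq_max[of a "b * w"] vw by (cases "b = 0") (auto simp: mult)
  next
    case True
    \<comment> \<open>Cancellation is possible only between equal absolute values, and it would make
      w congruent to the integer \<open>- a / b\<close> of F.\<close>
    have "- a / b \<in> ?O"
      using ab True by (auto simp: int_ring_def divide intro: divide_mem uminus_mem)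
    from w(3)[OF this] have ge: "1 \<le> v (w + a / b)"
      by simp
    have "v (w + a / b) \<le> 1"
      using True vw by (intro add_le) (auto simp: divide)
    moreover have "a + b * w = b * (w + a / b)"
      using True by (simp add: field_simps)
    ultimately show ?thesis
      using ge True by (simp add: mult)
  qed
  thus ?thesis
    using w(1) by blast
qed

text \<open>In residue characteristic 2 squaring is injective on the finite residue field, hence surjective.\<close>

lemma residue_sqrt:
  assumes two: "v 2 < 1" and n: "n \<in> F" "v n \<le> 1"
  shows "\<exists>c\<in>F. v c \<le> 1 \<and> v (c ^ 2 - n) < 1"
proof -
  note Rd = is_transversalD[OF transversal]
  have cl: "add_closed (max_ideal v F)"
    using vball_add_closed[of 1] vball_1 by simp
  have R_mem: "r \<in> F" "v r \<le> 1" if "r \<in> R" for r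
    using Rd(1)[OF that] by (auto simp: int_ring_def)
  have sq_mem: "r ^ 2 \<in> int_ring v F" if "r \<in> R" for r
    using R_mem[OF that] by (simp add: int_ring_def power power_le_one power_mem)
  have "\<exists>s\<in>R. r ^ 2 - s \<in> max_ideal v F" if "r \<in> R" for r
    using Rd(2)[OF sq_mem[OF that]] .
  then obtain f where f: "\<And>r. r \<in> R \<Longrightarrow> f r \<in> R" "\<And>r. r \<in> R \<Longrightarrow> v (r ^ 2 - f r) < 1"
    unfolding max_ideal_def by (metis (mono_tags, lifting) mem_Collect_eq)
  have "inj_on f R"
  proof (rule inj_onI)
    fix r s assume rs: "r \<in> R" "s \<in> R" "f r = f s"
    have "v ((r ^ 2 - f r) - (s ^ 2 - f s)) < 1"
      by (rule diff_less[OF f(2)[OF rs(1)] f(2)[OF rs(2)]])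
    hence 1: "v (r ^ 2 - s ^ 2) < 1"
      using rs(3) by simp
    have "v (s * (r - s)) \<le> 1"
      unfolding mult using R_mem rs diff_le[of r 1 s] by (intro mult_le_one) auto
    hence 2: "v (2 * (s * (r - s))) < 1"
      by (rule mult_less_1[OF two])
    have "(r - s) ^ 2 = (r ^ 2 - s ^ 2) - 2 * (s * (r - s))"
      by (simp add: power2_eq_square algebra_simps)
    hence "v (r - s) ^ 2 < 1"
      using diff_less[OF 1 2] by (simp flip: power)
    hence "v (r - s) < 1"
      by (simp add: power_less_one_iff)
    hence "r - s \<in> max_ideal v F"
      using R_mem rs by (auto simp: max_ideal_def intro: diff_mem)
    thus "r = s"
      using Rd(3)[OF cl rs(1,2)] by blast
  qed
  hence "f ` R = R"
    using f(1) finite_R by (intro endo_inj_surj) auto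
  moreover obtain r0 where r0: "r0 \<in> R" "v (n - r0) < 1"
    using Rd(2)[of n] n by (auto simp: int_ring_def max_ideal_def)
  ultimately obtain c where c: "c \<in> R" "f c = r0"
    by (metis imageE)
  have "v (c ^ 2 - f c) < 1"
    using f(2)[OF c(1)] .
  hence "v ((c ^ 2 - f c) - (n - r0)) < 1"
    by (rule diff_less[OF _ r0(2)])
  thus ?thesis
    using R_mem[OF c(1)] c by (intro bexI[of _ c]) (auto simp: c(2))
qed

section \<open>Trace and discriminant in the quadratic case\<close>

lemma field_trace_eq:
  assumes \<omega>: "\<omega> \<in> K" and indep: "\<And>a b. a \<in> F \<Longrightarrow> b \<in> F \<Longrightarrow> a + b * \<omega> = 0 \<Longrightarrow> a = 0 \<and> b = 0"
    and sq: "\<omega> ^ 2 = n + s * \<omega>" "n \<in> F" "s \<in> F" and cd: "c \<in> F" "d \<in> F"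
  shows "field_trace F K (c + d * \<omega>) = 2 * c + d * s"
  unfolding field_trace_def ext_degree
proof (rule the_equality)
  have K: "K = {a + b * \<omega> |a b. a \<in> F \<and> b \<in> F}"
    by (rule spans[OF \<omega> indep])
  let ?x = "c + d * \<omega>"
  define e where "e i = (if i = 0 then 1 else \<omega>)" for i :: nat
  define m where "m i j = (if j = 0 then (if i = 0 then c else d) else (if i = 0 then d * n else c + d * s))"
    for i j :: nat
  have e: "e 0 = 1" "e 1 = \<omega>"
    by (auto simp: e_def)
  have inj: "a = a' \<and> b = b'" if "a \<in> F" "b \<in> F" "a' \<in> F" "b' \<in> F" "a + b * \<omega> = a' + b' * \<omega>" for a b a' b'
    using indep[of "a - a'" "b - b'"] that by (simp add: diff_mem algebra_simps)
  have "is_basis F K 2 e"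
    unfolding is_basis_2_iff e mult_1_right
  proof (intro conjI ballI impI)
    fix a b a' b' assume "a \<in> F" "b \<in> F" "a' \<in> F" "b' \<in> F" "a + b * \<omega> = a' + b' * \<omega>"
    from inj[OF this] show "a = a'" "b = b'"
      by auto
  qed (use K in blast)+
  moreover have "\<forall>i<2. \<forall>j<2. m i j \<in> F"
    using cd sq(2,3) by (auto simp: m_def mult_mem add_mem)
  moreover have "?x * e j = (\<Sum>i<2. m i j * e i)" for j
  proof (cases "j = 0")
    case False
    have "?x * \<omega> = c * \<omega> + d * \<omega> ^ 2"
      by (simp add: algebra_simps power2_eq_square)
    also have "\<dots> = d * n + (c + d * s) * \<omega>"
      unfolding sq(1) by (simp add: algebra_simps)
    finally show ?thesis
      using False by (simp add: m_def e_def numeral_2_eq_2)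
  qed (simp add: m_def e_def numeral_2_eq_2)
  moreover have "2 * c + d * s = (\<Sum>i<2. m i i)"
    by (simp add: m_def numeral_2_eq_2)
  ultimately show "\<exists>e m. is_basis F K 2 e \<and> (\<forall>i<2. \<forall>j<2. m i j \<in> F) \<and>
      (\<forall>j<2. ?x * e j = (\<Sum>i<2. m i j * e i)) \<and> 2 * c + d * s = (\<Sum>i<2. m i i)"
    by (intro exI[of _ e] exI[of _ m]) simp
  fix t assume "\<exists>e m. is_basis F K 2 e \<and> (\<forall>i<2. \<forall>j<2. m i j \<in> F) \<and>
      (\<forall>j<2. ?x * e j = (\<Sum>i<2. m i j * e i)) \<and> t = (\<Sum>i<2. m i i)"
  \<comment> \<open>The description defining \<open>field_trace\<close> ranges over all bases, so t
    must be shown independent of the basis. Eliminating \<open>e 1\<close> gives the Cayley-Hamilton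
    equation of \<open>?x\<close> with trace t, and its \<omega>-coordinate determines t. For d = 0
    the equation carries no such information, but the matrix is scalar.\<close>
  then obtain e m where basis: "is_basis F K 2 e" and m: "\<forall>i<2. \<forall>j<2. m i j \<in> F"
    and eq: "\<forall>j<2. ?x * e j = (\<Sum>i<2. m i j * e i)" and t: "t = (\<Sum>i<2. m i i)"
    by blast
  have mF: "m 0 0 \<in> F" "m 0 1 \<in> F" "m 1 0 \<in> F" "m 1 1 \<in> F"
    using m by auto
  have e0: "?x * e 0 = m 0 0 * e 0 + m 1 0 * e 1" and e1: "?x * e 1 = m 0 1 * e 0 + m 1 1 * e 1"
    using eq by (auto simp: numeral_2_eq_2)
  have t: "t = m 0 0 + m 1 1"
    using t by (simp add: numeral_2_eq_2)
  have e_inj: "a = a' \<and> b = b'"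
    if "a \<in> F" "b \<in> F" "a' \<in> F" "b' \<in> F" "a * e 0 + b * e 1 = a' * e 0 + b' * e 1" for a b a' b'
    using basis that unfolding is_basis_2_iff by blast
  have e0_nz: "e 0 \<noteq> 0"
    using e_inj[of 0 0 1 0] by auto
  show "t = 2 * c + d * s"
  proof (cases "d = 0")
    case True
    hence "c = m 0 0" "c = m 1 1"
      using e_inj[OF cd(1) zero_mem mF(1,3)] e_inj[OF zero_mem cd(1) mF(2,4)] e0 e1 by auto
    thus ?thesis
      using t True by simp
  next
    case False
    have a: "(?x - m 0 0) * e 0 = m 1 0 * e 1" and b: "(?x - m 1 1) * e 1 = m 0 1 * e 0"
      using e0 e1 by (auto simp: algebra_simps)
    have "(?x - m 1 1) * (?x - m 0 0) * e 0 = m 1 0 * ((?x - m 1 1) * e 1)"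
      using a by (metis mult.assoc mult.left_commute)
    also have "\<dots> = m 1 0 * m 0 1 * e 0"
      using b by simp
    finally have "(?x - m 1 1) * (?x - m 0 0) = m 1 0 * m 0 1"
      using e0_nz by simp
    hence "?x ^ 2 = t * ?x - (m 0 0 * m 1 1 - m 1 0 * m 0 1)"
      by (simp add: t algebra_simps power2_eq_square)
    moreover have "?x ^ 2 = c ^ 2 + 2 * c * d * \<omega> + d ^ 2 * \<omega> ^ 2"
      by (simp add: algebra_simps power2_eq_square)
    ultimately have "t * ?x - (m 0 0 * m 1 1 - m 1 0 * m 0 1) = c ^ 2 + 2 * c * d * \<omega> + d ^ 2 * (n + s * \<omega>)"
      unfolding sq(1) by metis
    hence "(t * c - (m 0 0 * m 1 1 - m 1 0 * m 0 1)) + (t * d) * \<omega> = (c ^ 2 + d ^ 2 * n) + (2 * c * d + d ^ 2 * s) * \<omega>"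
      by (simp add: algebra_simps)
    moreover have "t \<in> F" "2 \<in> F"
      using t mF add_mem of_nat_mem[of 2] by auto
    ultimately have "t * d = 2 * c * d + d ^ 2 * s"
      using inj[of "t * c - (m 0 0 * m 1 1 - m 1 0 * m 0 1)" "t * d" "c ^ 2 + d ^ 2 * n" "2 * c * d + d ^ 2 * s"]
        cd mF sq(2,3) by (auto simp: mult_mem add_mem diff_mem power_mem)
    hence "t * d = (2 * c + d * s) * d"
      by (simp add: algebra_simps power2_eq_square)
    thus ?thesis
      using False by simp
  qed
qed

text \<open>The equation of \<omega> over F has discriminant s^2 + 4n. Were this not a unit, the
  equation would have a double root modulo the maximal ideal, and \<open>2 * \<omega> - s\<close> or
  \<open>\<omega> - c\<close> would be smaller than the maximum formula allows. Passing to another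
  integral basis multiplies the discriminant by the square of a unit.\<close>

lemma unramified_discriminant:
  assumes \<omega>: "\<omega> \<in> K" and max: "\<And>a b. a \<in> F \<Longrightarrow> b \<in> F \<Longrightarrow> v (a + b * \<omega>) = max (v a) (v b)"
    and D: "is_discriminant v F K D"
  shows "v D = 1"
proof -
  have indep: "a = 0 \<and> b = 0" if "a \<in> F" "b \<in> F" "a + b * \<omega> = 0" for a b
  proof -
    have "max (v a) (v b) = 0"
      using max[OF that(1,2)] that(3) by simp
    hence "v a \<le> 0" "v b \<le> 0"
      by auto
    hence "v a = 0" "v b = 0"
      using nonneg[of a] nonneg[of b] by linarith+
    thus ?thesis by simp
  qed
  have K: "K = {a + b * \<omega> |a b. a \<in> F \<and> b \<in> F}"
    by (rule spans[OF \<omega> indep])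
  have OK: "\<exists>a b. a \<in> F \<and> b \<in> F \<and> v a \<le> 1 \<and> v b \<le> 1 \<and> x = a + b * \<omega>" if x: "x \<in> int_ring v K" for x
  proof -
    obtain a b where ab: "a \<in> F" "b \<in> F" "x = a + b * \<omega>"
      using x K by (auto simp: int_ring_def)
    hence "max (v a) (v b) \<le> 1"
      using x max[OF ab(1,2)] by (simp add: int_ring_def)
    thus ?thesis
      using ab by (intro exI[of _ a] exI[of _ b]) auto
  qed
  have v\<omega>: "v \<omega> = 1"
    using max[of 0 1] by simp
  obtain n s where ns: "n \<in> F" "s \<in> F" "v n \<le> 1" "v s \<le> 1" "\<omega> ^ 2 = n + s * \<omega>"
    using OK[of "\<omega> ^ 2"] \<omega> v\<omega> by (auto simp: int_ring_def power ext.power_mem)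
  have twoF: "2 \<in> F" "v 2 \<le> 1"
    using of_nat_mem[of 2] of_nat_le_1[of 2] by auto
  define \<Delta> where "\<Delta> = s ^ 2 + 4 * n"
  have \<Delta>F: "\<Delta> \<in> F"
    using ns of_nat_mem[of 4] by (auto simp: \<Delta>_def intro!: add_mem mult_mem power_mem)
  have "\<not> v \<Delta> < 1"
  proof
    assume less: "v \<Delta> < 1"
    show False
    \<comment> \<open>Completing the square requires 2 to be a unit. Otherwise s is forced into the
      maximal ideal, and a square root c of n modulo that ideal is the double root.\<close>
    proof (cases "v 2 = 1")
      case True
      have "(2 * \<omega> - s) ^ 2 = 4 * \<omega> ^ 2 - 4 * s * \<omega> + s ^ 2"
        by (simp add: power2_eq_square algebra_simps)
      also have "\<dots> = \<Delta>"
        unfolding ns(5) \<Delta>_def by (simp add: algebra_simps)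
      finally have "v (2 * \<omega> - s) ^ 2 < 1"
        using less by (simp flip: power)
      hence "v (2 * \<omega> - s) < 1"
        by (simp add: power_less_one_iff)
      moreover have "v (2 * \<omega> - s) = max (v s) (v 2)"
        using max[of "- s" 2] ns twoF by (simp add: uminus_mem)
      ultimately show False
        using True by simp
    next
      case False
      hence two: "v 2 < 1"
        using twoF(2) by simp
      have four: "v 4 < 1"
        using mult_less_1[OF two twoF(2)] by simp
      have "v (\<Delta> - 4 * n) < 1"
        by (rule diff_less[OF less mult_less_1[OF four ns(3)]])
      hence "v s ^ 2 < 1"
        by (simp add: \<Delta>_def power)
      hence vs: "v s < 1"
        by (simp add: power_less_one_iff)
      obtain c where c: "c \<in> F" "v c \<le> 1" "v (c ^ 2 - n) < 1"
        using residue_sqrt[OF two ns(1,3)] by blast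
      have small2: "v (2 * y) < 1" if "v y \<le> 1" for y
        by (rule mult_less_1[OF two that])
      have "(\<omega> - c) ^ 2 = \<omega> ^ 2 - 2 * (c * \<omega>) + c ^ 2"
        by (simp add: power2_eq_square algebra_simps)
      also have "\<dots> = ((c ^ 2 - n) + 2 * n) + (s * \<omega> - 2 * (c * \<omega>))"
        unfolding ns(5) by (simp add: algebra_simps)
      also have "v \<dots> < 1"
        using c(2) vs v\<omega>
        by (intro add_less[OF add_less[OF c(3) small2[OF ns(3)]] diff_less[OF _ small2]])
          (simp_all add: mult)
      finally have "v (\<omega> - c) ^ 2 < 1"
        by (simp add: power)
      hence "v (\<omega> - c) < 1"
        by (simp add: power_less_one_iff)
      moreover have "v (\<omega> - c) = max (v c) 1"
        using max[of "- c" 1] c by (simp add: uminus_mem)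
      ultimately show False
        by simp
    qed
  qed
  moreover have "v \<Delta> \<le> 1"
    unfolding \<Delta>_def using ns of_nat_le_1[of 4]
    by (intro add_le) (simp_all add: mult power power_le_one mult_le_one)
  ultimately have v\<Delta>: "v \<Delta> = 1"
    by simp
  obtain e where basis: "is_basis (int_ring v F) (int_ring v K) 2 e"
    and D_eq: "D = Determinant.det (Matrix.mat 2 2 (\<lambda>(i, j). field_trace F K (e i * e j)))"
    using D unfolding is_discriminant_def ext_degree by blast
  let ?O = "int_ring v F"
  have e_mem: "\<And>a b. a \<in> ?O \<Longrightarrow> b \<in> ?O \<Longrightarrow> a * e 0 + b * e 1 \<in> int_ring v K"
    and e_span: "\<And>x. x \<in> int_ring v K \<Longrightarrow> \<exists>a\<in>?O. \<exists>b\<in>?O. x = a * e 0 + b * e 1"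
    using basis unfolding is_basis_2_iff by blast+
  have O01: "0 \<in> ?O" "1 \<in> ?O"
    by (auto simp: int_ring_def)
  obtain a b where ab: "a \<in> F" "b \<in> F" "v a \<le> 1" "v b \<le> 1" "e 0 = a + b * \<omega>"
    using OK[of "e 0"] e_mem[OF O01(2,1)] by auto
  obtain c d where cd: "c \<in> F" "d \<in> F" "v c \<le> 1" "v d \<le> 1" "e 1 = c + d * \<omega>"
    using OK[of "e 1"] e_mem[OF O01] by auto
  obtain \<alpha> \<beta> where \<alpha>: "\<alpha> \<in> F" "v \<alpha> \<le> 1" "\<beta> \<in> F" "v \<beta> \<le> 1" "1 = \<alpha> * e 0 + \<beta> * e 1"
    using e_span[of 1] by (auto simp: int_ring_def)
  obtain \<gamma> \<delta> where \<gamma>: "\<gamma> \<in> F" "v \<gamma> \<le> 1" "\<delta> \<in> F" "v \<delta> \<le> 1" "\<omega> = \<gamma> * e 0 + \<delta> * e 1"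
    using e_span[of \<omega>] \<omega> v\<omega> by (auto simp: int_ring_def)
  have inj: "x = x' \<and> y = y'" if "x \<in> F" "y \<in> F" "x' \<in> F" "y' \<in> F" "x + y * \<omega> = x' + y' * \<omega>" for x y x' y'
    using indep[of "x - x'" "y - y'"] that by (simp add: diff_mem algebra_simps)
  have "1 + 0 * \<omega> = (\<alpha> * a + \<beta> * c) + (\<alpha> * b + \<beta> * d) * \<omega>"
    using \<alpha>(5) unfolding ab(5) cd(5) by (simp add: algebra_simps)
  from inj[OF one_mem zero_mem _ _ this] have 1: "\<alpha> * a + \<beta> * c = 1" "\<alpha> * b + \<beta> * d = 0"
    using \<alpha> ab cd by (auto simp: add_mem mult_mem)
  have "0 + 1 * \<omega> = (\<gamma> * a + \<delta> * c) + (\<gamma> * b + \<delta> * d) * \<omega>"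
    using \<gamma>(5) unfolding ab(5) cd(5) by (simp add: algebra_simps)
  from inj[OF zero_mem one_mem _ _ this] have 2: "\<gamma> * a + \<delta> * c = 0" "\<gamma> * b + \<delta> * d = 1"
    using \<gamma> ab cd by (auto simp: add_mem mult_mem)
  \<comment> \<open>The two changes of basis have integral entries and invert each other, so their
    determinants have product 1 and both are units.\<close>
  have "(\<alpha> * \<delta> - \<beta> * \<gamma>) * (a * d - b * c)
      = (\<alpha> * a + \<beta> * c) * (\<gamma> * b + \<delta> * d) - (\<alpha> * b + \<beta> * d) * (\<gamma> * a + \<delta> * c)"
    by (simp add: algebra_simps)
  hence "(\<alpha> * \<delta> - \<beta> * \<gamma>) * (a * d - b * c) = 1"
    using 1 2 by simp
  hence prod: "v (\<alpha> * \<delta> - \<beta> * \<gamma>) * v (a * d - b * c) = 1"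
    by (simp flip: mult)
  have le: "v (\<alpha> * \<delta> - \<beta> * \<gamma>) \<le> 1" "v (a * d - b * c) \<le> 1"
    by (rule diff_le; simp only: mult; rule mult_le_one; fact nonneg \<alpha>(2,4) \<gamma>(2,4) ab(3,4) cd(3,4))+
  have "v (a * d - b * c) = 1"
    using prod le mult_left_le_one_le[of "v (a * d - b * c)" "v (\<alpha> * \<delta> - \<beta> * \<gamma>)"] by simp
  note tr = field_trace_eq[OF \<omega> indep ns(5,1,2)]
  have prod_tr: "field_trace F K ((x + y * \<omega>) * (x' + y' * \<omega>))
      = 2 * (x * x' + y * y' * n) + (x * y' + y * x' + y * y' * s) * s"
    if "x \<in> F" "y \<in> F" "x' \<in> F" "y' \<in> F" for x y x' y'
  proof -
    have "(x + y * \<omega>) * (x' + y' * \<omega>) = x * x' + (x * y' + y * x') * \<omega> + y * y' * \<omega> ^ 2"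
      by (simp add: algebra_simps power2_eq_square)
    also have "\<dots> = (x * x' + y * y' * n) + (x * y' + y * x' + y * y' * s) * \<omega>"
      unfolding ns(5) by (simp add: algebra_simps)
    finally have eq: "(x + y * \<omega>) * (x' + y' * \<omega>)
      = (x * x' + y * y' * n) + (x * y' + y * x' + y * y' * s) * \<omega>" .
    show ?thesis
      unfolding eq by (rule tr) (use that ns(1,2) in \<open>simp_all add: add_mem mult_mem\<close>)
  qed
  have "D = (a * d - b * c) ^ 2 * \<Delta>"
    unfolding D_eq det_mat_2 prod.case ab(5) cd(5)
      prod_tr[OF ab(1,2) ab(1,2)] prod_tr[OF ab(1,2) cd(1,2)] prod_tr[OF cd(1,2) ab(1,2)]
      prod_tr[OF cd(1,2) cd(1,2)] \<Delta>_def
    by (simp add: power2_eq_square algebra_simps)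
  thus ?thesis
    using \<open>v (a * d - b * c) = 1\<close> v\<Delta> by (simp add: mult power)
qed

end

section \<open>Coordinates on the quadratic extension\<close>

text \<open>Horner evaluation stays inside A + A x, because the quadratic equation rewrites every
  square that appears.\<close>

lemma adjoin_quadratic:
  fixes x :: "'a::comm_ring_1"
  assumes "0 \<in> A" "\<And>a b. a \<in> A \<Longrightarrow> b \<in> A \<Longrightarrow> a + b \<in> A" "\<And>a b. a \<in> A \<Longrightarrow> b \<in> A \<Longrightarrow> a * b \<in> A"
    and x: "x * x = c + d * x" "c \<in> A" "d \<in> A"
  shows "adjoin A x = {u + w * x |u w. u \<in> A \<and> w \<in> A}"
proof
  have "\<exists>u w. u \<in> A \<and> w \<in> A \<and> Polynomial.poly P x = u + w * x" if "\<forall>i. Polynomial.coeff P i \<in> A" for P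
    using that
  proof (induction P)
    case 0
    show ?case
      using assms(1) by (intro exI[of _ 0]) simp
  next
    case (pCons a P)
    have "a \<in> A"
      using pCons.prems[rule_format, of 0] by simp
    have "\<forall>i. Polynomial.coeff P i \<in> A"
      using pCons.prems by (metis coeff_pCons_Suc)
    then obtain u w where uw: "u \<in> A" "w \<in> A" "Polynomial.poly P x = u + w * x"
      using pCons.IH by blast
    have "Polynomial.poly (pCons a P) x = a + u * x + w * (x * x)"
      by (simp add: uw(3) algebra_simps)
    also have "\<dots> = (a + w * c) + (u + w * d) * x"
      unfolding x(1) by (simp add: algebra_simps)
    finally have "Polynomial.poly (pCons a P) x = (a + w * c) + (u + w * d) * x" .
    moreover have "a + w * c \<in> A" "u + w * d \<in> A"
      using \<open>a \<in> A\<close> uw(1,2) x(2,3) by (simp_all add: assms(2,3))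
    ultimately show ?case
      by (intro exI[of _ "a + w * c"] exI[of _ "u + w * d"]) simp
  qed
  thus "adjoin A x \<subseteq> {u + w * x |u w. u \<in> A \<and> w \<in> A}"
    unfolding adjoin_def by blast
  show "{u + w * x |u w. u \<in> A \<and> w \<in> A} \<subseteq> adjoin A x"
  proof clarify
    fix u w assume "u \<in> A" "w \<in> A"
    hence "Polynomial.coeff [:u, w:] i \<in> A" for i
      using assms(1) by (auto simp: coeff_pCons split: nat.split)
    moreover have "u + w * x = Polynomial.poly [:u, w:] x"
      by (simp add: algebra_simps)
    ultimately show "u + w * x \<in> adjoin A x"
      unfolding adjoin_def by blast
  qed
qed

text \<open>One interface for both ramification types. \<open>v_coord\<close> says that 1 and
  \<omega> are orthogonal in the ultrametric sense, so K is F^2 with a weighted maximum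
  norm.\<close>

locale quad = quad_ext v F \<pi> R K
  for v :: "'a::field_char_0 \<Rightarrow> real" and F \<pi> R K +
  fixes \<omega> :: 'a and \<sigma> :: real
  assumes omega_mem: "\<omega> \<in> K" and sigma: "\<sigma> = 1 \<or> \<sigma> = sqrt (v \<pi>)"
    and v_coord: "a \<in> F \<Longrightarrow> b \<in> F \<Longrightarrow> v (a + b * \<omega>) = max (v a) (\<sigma> * v b)"
    and unif_val: "v \<pi> = 1 / real (card R)"
begin

text \<open>The exponent with \<open>max_ideal v K = box 1 \<delta>\<close>: in the unramified case
  b must be a non-unit as well, in the ramified case b \<omega> is small already for integral
  b.\<close>

definition \<delta> :: int
  where "\<delta> = (if \<sigma> = 1 then 1 else 0)"

lemma delta: "\<sigma> = 1 \<Longrightarrow> \<delta> = 1" "\<sigma> \<noteq> 1 \<Longrightarrow> \<delta> = 0"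
  unfolding \<delta>_def by simp_all

lemma sqrt_bounds: "v \<pi> < sqrt (v \<pi>)" "sqrt (v \<pi>) < 1"
  using unif_less unif_gt_0 by (auto intro!: real_less_rsqrt simp: power2_eq_square)

lemma sigma_pos: "0 < \<sigma>" and sigma_le_1: "\<sigma> \<le> 1"
  using sigma sqrt_bounds unif_gt_0 by auto

lemma powi_Suc: "v \<pi> powi (k + 1) = v \<pi> * v \<pi> powi k"
  by (simp add: powi_add)

text \<open>In the ramified case \<sigma> lies strictly between \<open>v \<pi>\<close> and 1, so a
  comparison of \<open>\<sigma> * v b\<close> with a power of \<open>v \<pi>\<close> rounds to a
  comparison of \<open>v b\<close> alone. Strict and weak bounds round to different exponents only
  in the unramified case, and \<delta> records this.\<close>

lemma sigma_less_iff: "b \<in> F \<Longrightarrow> \<sigma> * v b < v \<pi> powi j \<longleftrightarrow> v b \<le> v \<pi> powi (j + \<delta>)"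
proof (cases "\<sigma> = 1")
  case True
  assume "b \<in> F"
  thus ?thesis
    unfolding delta(1)[OF True] using less_iff_le True by simp
next
  case False
  assume b: "b \<in> F"
  have \<sigma>: "v \<pi> < \<sigma>" "\<sigma> < 1" "\<delta> = 0"
    using False sigma sqrt_bounds delta(2)[OF False] by auto
  have "\<sigma> * v b < v \<pi> powi j" if "v b \<le> v \<pi> powi j"
  proof (cases "b = 0")
    case nz: False
    have "\<sigma> * v b < 1 * v b"
      using \<sigma> nz by (intro mult_strict_right_mono) auto
    thus ?thesis
      using that by simp
  qed (simp add: powi_gt_0)
  moreover have "\<not> \<sigma> * v b < v \<pi> powi j" if "\<not> v b \<le> v \<pi> powi j"
  proof -
    have "b \<noteq> 0"
      using that powi_gt_0[of j] by auto
    then obtain k where k: "v b = v \<pi> powi k"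
      using value_group b by blast
    hence "k + 1 \<le> j"
      using that powi_le_iff[of k j] by simp
    hence "v \<pi> powi j \<le> v \<pi> powi (k + 1)"
      by (simp add: powi_le_iff)
    also have "\<dots> \<le> \<sigma> * v b"
      unfolding powi_Suc k using \<sigma>(1) powi_gt_0[of k] by simp
    finally show ?thesis
      by simp
  qed
  ultimately show ?thesis
    using \<sigma>(3) by auto
qed

lemma sigma_le_iff: "b \<in> F \<Longrightarrow> \<sigma> * v b \<le> v \<pi> powi j \<longleftrightarrow> v b \<le> v \<pi> powi j"
proof (cases "\<sigma> = 1")
  case False
  assume b: "b \<in> F"
  have \<sigma>: "v \<pi> < \<sigma>" "\<delta> = 0"
    using False sigma sqrt_bounds delta(2)[OF False] by auto
  have "v b \<le> v \<pi> powi j" if le: "\<sigma> * v b \<le> v \<pi> powi j"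
  proof (cases "b = 0")
    case False
    then obtain k where k: "v b = v \<pi> powi k"
      using value_group b by blast
    have "v \<pi> powi (k + 1) < \<sigma> * v b"
      unfolding powi_Suc k using \<sigma>(1) powi_gt_0[of k] by simp
    hence "j < k + 1"
      using le powi_less_iff[of "k + 1" j] by linarith
    thus ?thesis
      by (simp add: k powi_le_iff)
  qed (simp add: powi_gt_0 less_imp_le)
  thus ?thesis
    using sigma_less_iff[OF b, of j] \<sigma>(2) by auto
qed simp

lemma le_sigma_iff: "a \<in> F \<Longrightarrow> v a \<le> \<sigma> * v \<pi> powi k \<longleftrightarrow> v a \<le> v \<pi> powi (k + 1 - \<delta>)"
proof (cases "\<sigma> = 1")
  case False
  assume a: "a \<in> F"
  have \<sigma>: "v \<pi> < \<sigma>" "\<sigma> < 1" "\<delta> = 0"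
    using False sigma sqrt_bounds delta(2)[OF False] by auto
  have "v \<pi> powi (k + 1) \<le> \<sigma> * v \<pi> powi k" "\<sigma> * v \<pi> powi k < v \<pi> powi k"
    unfolding powi_Suc using \<sigma> powi_gt_0[of k] by simp_all
  moreover have "v a < v \<pi> powi k \<longleftrightarrow> v a \<le> v \<pi> powi (k + 1)"
    using less_iff_le[OF a] .
  ultimately show ?thesis
    unfolding \<sigma>(3) diff_0_right by (meson order_trans le_less_trans)
next
  case True
  show ?thesis
    unfolding delta(1)[OF True] using True by simp
qed

lemma indep: "a \<in> F \<Longrightarrow> b \<in> F \<Longrightarrow> a + b * \<omega> = 0 \<Longrightarrow> a = 0 \<and> b = 0"
proof -
  assume "a \<in> F" "b \<in> F" "a + b * \<omega> = 0"
  hence "max (v a) (\<sigma> * v b) = 0"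
    using v_coord[of a b] by simp
  hence "v a \<le> 0" "\<sigma> * v b \<le> 0"
    by auto
  hence "v a = 0" "v b = 0"
    using nonneg[of a] nonneg[of b] sigma_pos
    by (linarith, smt (verit) mult_pos_pos)
  thus ?thesis by simp
qed

lemma coord_inj:
  assumes "a \<in> F" "b \<in> F" "a' \<in> F" "b' \<in> F" "a + b * \<omega> = a' + b' * \<omega>"
  shows "a = a'" "b = b'"
  using indep[of "a - a'" "b - b'"] assms by (simp_all add: diff_mem algebra_simps)

lemma K_eq: "K = {a + b * \<omega> |a b. a \<in> F \<and> b \<in> F}"
  by (rule spans[OF omega_mem indep])

lemma K_cases:
  assumes "x \<in> K"
  obtains a b where "a \<in> F" "b \<in> F" "x = a + b * \<omega>"
  using assms unfolding K_eq by blast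

lemma coord_mem_K: "a \<in> F \<Longrightarrow> b \<in> F \<Longrightarrow> a + b * \<omega> \<in> K"
  unfolding K_eq by blast

text \<open>The lattice \<pi>^i O_F + \<pi>^j O_F \<omega>. Balls of K, its maximal ideal and the
  orders O_F[x] all have this shape, so one family of sets carries both the indices and the
  measures.\<close>

definition box :: "int \<Rightarrow> int \<Rightarrow> 'a set"
  where "box i j = {a + b * \<omega> |a b. a \<in> vball i \<and> b \<in> vball j}"

lemma vball_memF: "x \<in> vball i \<Longrightarrow> x \<in> F"
  by (simp add: vball_def)

lemma mem_box_iff: "a \<in> F \<Longrightarrow> b \<in> F \<Longrightarrow> a + b * \<omega> \<in> box i j \<longleftrightarrow> a \<in> vball i \<and> b \<in> vball j"
proof
  assume F: "a \<in> F" "b \<in> F" and "a + b * \<omega> \<in> box i j"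
  then obtain a' b' where *: "a' \<in> vball i" "b' \<in> vball j" "a + b * \<omega> = a' + b' * \<omega>"
    unfolding box_def by blast
  with coord_inj[OF F vball_memF[OF *(1)] vball_memF[OF *(2)] *(3)] show "a \<in> vball i \<and> b \<in> vball j"
    by simp
qed (auto simp: box_def)

lemma box_subset_K: "box i j \<subseteq> K"
  unfolding box_def using vball_memF coord_mem_K by blast

lemma box_add_closed: "add_closed (box i j)"
proof -
  have "0 + 0 * \<omega> \<in> box i j"
    unfolding mem_box_iff[OF zero_mem zero_mem] using add_closedD(1)[OF vball_add_closed] by simp
  moreover have "x - y \<in> box i j" if "x \<in> box i j" "y \<in> box i j" for x y
  proof -
    obtain a b a' b' where *: "x = a + b * \<omega>" "y = a' + b' * \<omega>" "a \<in> vball i" "b \<in> vball j"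
      "a' \<in> vball i" "b' \<in> vball j"
      using \<open>x \<in> box i j\<close> \<open>y \<in> box i j\<close> unfolding box_def by blast
    hence "x - y = (a - a') + (b - b') * \<omega>" "a - a' \<in> vball i" "b - b' \<in> vball j"
      using add_closedD(2)[OF vball_add_closed] by (simp_all add: algebra_simps)
    thus ?thesis
      unfolding box_def by blast
  qed
  ultimately show ?thesis
    by (simp add: add_closed_def)
qed

lemma box_mono: "i \<le> i' \<Longrightarrow> j \<le> j' \<Longrightarrow> box i' j' \<subseteq> box i j"
  unfolding box_def using vball_mono by blast

lemma subset_K_eqI:
  assumes "A \<subseteq> K" "B \<subseteq> K" "\<And>a b. a \<in> F \<Longrightarrow> b \<in> F \<Longrightarrow> a + b * \<omega> \<in> A \<longleftrightarrow> a + b * \<omega> \<in> B"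
  shows "A = B"
  using assms K_cases by (metis subset_antisym subset_iff)

lemma ball_eq_box: "{x \<in> K. v x \<le> v \<pi> powi i} = box i i"
  using box_subset_K
  by (intro subset_K_eqI) (auto simp: mem_box_iff v_coord sigma_le_iff coord_mem_K, auto simp: vball_def)

lemma int_ring_K: "int_ring v K = box 0 0"
  using ball_eq_box[of 0] by (simp add: int_ring_def)

lemma max_ideal_K: "max_ideal v K = box 1 \<delta>"
  unfolding max_ideal_def using box_subset_K
  using less_iff_le[of _ 0] sigma_less_iff[of _ 0]
  by (intro subset_K_eqI) (auto simp: mem_box_iff v_coord coord_mem_K, auto simp: vball_def)

text \<open>\<open>v \<pi> powi (i + j)\<close> will turn out to be the measure of the box. The
  second equation therefore says that a ball of K has the square of its radius as measure, as befits
  degree 2.\<close>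

lemma v_ball_eq_box:
  assumes "c \<in> K" "c \<noteq> 0"
  shows "\<exists>i j. {x \<in> K. v x \<le> v c} = box i j \<and> v c ^ 2 = v \<pi> powi (i + j)"
proof -
  obtain a b where ab: "a \<in> F" "b \<in> F" "c = a + b * \<omega>"
    using assms(1) by (rule K_cases)
  have vc: "v c = max (v a) (\<sigma> * v b)"
    using v_coord[OF ab(1,2)] ab(3) by simp
  show ?thesis
  proof (cases "\<sigma> * v b \<le> v a")
    case True
    have "a \<noteq> 0"
    proof
      assume "a = 0"
      hence "v b \<le> 0"
        using True sigma_pos by (simp add: mult_le_0_iff)
      hence "v b = 0"
        using nonneg[of b] by linarith
      thus False
        using \<open>a = 0\<close> ab assms(2) by simp
    qed
    then obtain k where "v a = v \<pi> powi k"
      using value_group ab(1) by blast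
    hence k: "v c = v \<pi> powi k"
      using vc True by simp
    have "v c ^ 2 = v \<pi> powi (k + k)"
      unfolding k powi_add power2_eq_square ..
    thus ?thesis
      using ball_eq_box[of k] k by metis
  next
    case False
    hence "b \<noteq> 0"
      using nonneg[of a] by auto
    then obtain k where k: "v b = v \<pi> powi k"
      using value_group ab(2) by blast
    have vc: "v c = \<sigma> * v \<pi> powi k"
      using vc False k by simp
    \<comment> \<open>When the \<omega>-part dominates in the ramified case, the radius is a
      half-integral power and the bound on the first coordinate rounds to the next exponent; in the
      unramified case \<delta> cancels this shift.\<close>
    have "{x \<in> K. v x \<le> v c} = box (k + 1 - \<delta>) k"
      unfolding vc using box_subset_K sigma_pos
      by (intro subset_K_eqI) (auto simp: mem_box_iff v_coord coord_mem_K le_sigma_iff, auto simp: vball_def)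
    moreover have "\<sigma> ^ 2 = v \<pi> powi (1 - \<delta>)"
    proof (cases "\<sigma> = 1")
      case False
      hence "\<sigma> = sqrt (v \<pi>)"
        using sigma by blast
      thus ?thesis
        unfolding delta(2)[OF False] by simp
    next
      case True
      show ?thesis
        unfolding delta(1)[OF True] using True by simp
    qed
    hence "v c ^ 2 = v \<pi> powi ((1 - \<delta>) + (k + k))"
      unfolding vc powi_add by (simp add: power_mult_distrib power2_eq_square)
    hence "v c ^ 2 = v \<pi> powi ((k + 1 - \<delta>) + k)"
      by (simp add: algebra_simps)
    ultimately show ?thesis
      by blast
  qed
qed

lemma box_transversal:
  "\<exists>T. is_transversal T (box i j) (box (i + int k) (j + int l)) \<and> finite T \<and> card T = card R ^ (k + l)"
proof -
  obtain T where T: "is_transversal T (vball i) (vball (i + int k))" "finite T" "card T = card R ^ k"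
    using vball_transversal by blast
  obtain S where S: "is_transversal S (vball j) (vball (j + int l))" "finite S" "card S = card R ^ l"
    using vball_transversal by blast
  note Td = is_transversalD[OF T(1)] and Sd = is_transversalD[OF S(1)]
  define f where "f = (\<lambda>(r, s). r + s * \<omega>)"
  have TF: "r \<in> F" if "r \<in> T" for r
    using Td(1)[OF that] vball_memF by blast
  have SF: "r \<in> F" if "r \<in> S" for r
    using Sd(1)[OF that] vball_memF by blast
  have "inj_on f (T \<times> S)"
  proof (rule inj_onI, clarify)
    fix r s r' s' assume rs: "r \<in> T" "s \<in> S" "r' \<in> T" "s' \<in> S" and "f (r, s) = f (r', s')"
    hence "r + s * \<omega> = r' + s' * \<omega>"
      by (simp add: f_def)
    from coord_inj[OF TF[OF rs(1)] SF[OF rs(2)] TF[OF rs(3)] SF[OF rs(4)] this] show "r = r' \<and> s = s'"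
      by simp
  qed
  hence card: "card (f ` (T \<times> S)) = card R ^ (k + l)"
    using T(3) S(3) by (simp add: card_image card_cartesian_product power_add)
  have "is_transversal (f ` (T \<times> S)) (box i j) (box (i + int k) (j + int l))"
  proof (rule is_transversalI)
    show "f ` (T \<times> S) \<subseteq> box i j"
      using Td(1) Sd(1) by (fastforce simp: box_def f_def)
    show "\<exists>r\<in>f ` (T \<times> S). x - r \<in> box (i + int k) (j + int l)" if x: "x \<in> box i j" for x
    proof -
      obtain a b where ab: "x = a + b * \<omega>" "a \<in> vball i" "b \<in> vball j"
        using x unfolding box_def by blast
      obtain r s where rs: "r \<in> T" "a - r \<in> vball (i + int k)" "s \<in> S" "b - s \<in> vball (j + int l)"
        using Td(2)[OF ab(2)] Sd(2)[OF ab(3)] by blast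
      have "x - f (r, s) = (a - r) + (b - s) * \<omega>"
        by (simp add: ab(1) f_def algebra_simps)
      hence "x - f (r, s) \<in> box (i + int k) (j + int l)"
        unfolding box_def using rs(2,4) by blast
      thus ?thesis
        using rs(1,3) by blast
    qed
    show "x = y" if xy: "x \<in> f ` (T \<times> S)" "y \<in> f ` (T \<times> S)" "x - y \<in> box (i + int k) (j + int l)" for x y
    proof -
      obtain r s r' s' where *: "x = r + s * \<omega>" "y = r' + s' * \<omega>" "r \<in> T" "s \<in> S" "r' \<in> T" "s' \<in> S"
        using xy(1,2) unfolding f_def by auto
      hence "(r - r') + (s - s') * \<omega> \<in> box (i + int k) (j + int l)"
        using xy(3) by (simp add: algebra_simps)
      hence "r - r' \<in> vball (i + int k)" "s - s' \<in> vball (j + int l)"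
        using mem_box_iff[of "r - r'" "s - s'"] * TF SF by (simp_all add: diff_mem)
      hence "r = r'" "s = s'"
        using Td(3)[OF vball_add_closed *(3,5)] Sd(3)[OF vball_add_closed *(4,6)] by blast+
      thus ?thesis
        using * by simp
    qed
  qed (rule box_add_closed)
  thus ?thesis
    using card T(2) S(2) by blast
qed

lemma omega_square: "\<exists>n\<in>int_ring v F. \<exists>s\<in>int_ring v F. \<omega> * \<omega> = n + s * \<omega>"
proof -
  have "v \<omega> = \<sigma>"
    using v_coord[of 0 1] sigma_pos by simp
  hence "\<omega> * \<omega> \<in> int_ring v K"
    using omega_mem sigma_le_1 sigma_pos by (simp add: int_ring_def mult ext.mult_mem mult_le_one)
  thus ?thesis
    unfolding int_ring_K box_def vball_0 by blast
qed

text \<open>The quadratic equation of x, with trace \<open>2 * a + b * s\<close> and with minus the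
  norm as constant term.\<close>

lemma square_coord:
  assumes "\<omega> * \<omega> = n + s * \<omega>" "x = a + b * \<omega>"
  shows "x * x = (b ^ 2 * n - a ^ 2 - a * b * s) + (2 * a + b * s) * x"
proof -
  have "x * x = a ^ 2 + 2 * a * b * \<omega> + b ^ 2 * (\<omega> * \<omega>)"
    by (simp add: assms(2) power2_eq_square algebra_simps)
  thus ?thesis
    unfolding assms by (simp add: power2_eq_square algebra_simps)
qed

lemma int_ring_closed:
  "0 \<in> int_ring v F" "1 \<in> int_ring v F" "2 \<in> int_ring v F"
  "a \<in> int_ring v F \<Longrightarrow> b \<in> int_ring v F \<Longrightarrow> a + b \<in> int_ring v F"
  "a \<in> int_ring v F \<Longrightarrow> b \<in> int_ring v F \<Longrightarrow> a - b \<in> int_ring v F"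
  "a \<in> int_ring v F \<Longrightarrow> b \<in> int_ring v F \<Longrightarrow> a * b \<in> int_ring v F"
  "a \<in> int_ring v F \<Longrightarrow> a ^ k \<in> int_ring v F"
  using of_nat_mem[of 2] of_nat_le_1[of 2]
  by (auto simp: int_ring_def add_mem mult_mem diff_mem power_mem add_le diff_le mult mult_le_one
      power power_le_one)

lemma square_int:
  assumes "a \<in> int_ring v F" "b \<in> int_ring v F" "x = a + b * \<omega>"
  shows "\<exists>c\<in>int_ring v F. \<exists>d\<in>int_ring v F. x * x = c + d * x"
proof -
  obtain n s where ns: "n \<in> int_ring v F" "s \<in> int_ring v F" "\<omega> * \<omega> = n + s * \<omega>"
    using omega_square by blast
  show ?thesis
    by (rule bexI[of _ "b ^ 2 * n - a ^ 2 - a * b * s"], rule bexI[of _ "2 * a + b * s"],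
        rule square_coord[OF ns(3) assms(3)])
      (use assms ns in \<open>auto intro!: int_ring_closed\<close>)
qed

lemma adjoin_field_iff:
  assumes "a \<in> F" "b \<in> F" "x = a + b * \<omega>"
  shows "adjoin F x = K \<longleftrightarrow> b \<noteq> 0"
proof -
  obtain n s where ns: "n \<in> F" "s \<in> F" "\<omega> * \<omega> = n + s * \<omega>"
    using omega_square by (auto simp: int_ring_def)
  have "b ^ 2 * n - a ^ 2 - a * b * s \<in> F" "2 * a + b * s \<in> F"
    using assms ns of_nat_mem[of 2] by (auto intro!: add_mem diff_mem mult_mem power_mem)
  hence adj: "adjoin F x = {u + w * x |u w. u \<in> F \<and> w \<in> F}"
    by (intro adjoin_quadratic[OF zero_mem add_mem mult_mem square_coord[OF ns(3) assms(3)]])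
  show ?thesis
  proof (cases "b = 0")
    case True
    hence "adjoin F x \<subseteq> F"
      unfolding adj using assms by (auto intro: add_mem mult_mem)
    moreover have "\<omega> \<notin> F"
      using coord_inj[of \<omega> 0 0 1] by auto
    ultimately show ?thesis
      using True omega_mem by auto
  next
    case False
    have "adjoin F x \<subseteq> K"
      unfolding adj using assms F_subset omega_mem by (auto intro!: ext.add_mem ext.mult_mem)
    moreover have "c + d * \<omega> \<in> adjoin F x" if "c \<in> F" "d \<in> F" for c d
    proof -
      have "c + d * \<omega> = (c - d / b * a) + (d / b) * x"
        using False by (simp add: assms(3) field_simps)
      thus ?thesis
        unfolding adj using that assms by (blast intro: diff_mem mult_mem divide_mem)
    qed
    hence "K \<subseteq> adjoin F x"
      unfolding K_eq by blast
    ultimately show ?thesis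
      using False by blast
  qed
qed

text \<open>The shift a is absorbed by O_F, so O_F[x] = O_F + b O_F \<omega>, and only the absolute
  value of b matters.\<close>

lemma adjoin_int:
  assumes "a \<in> int_ring v F" "b \<in> int_ring v F" "x = a + b * \<omega>" "v b = v \<pi> ^ k"
  shows "adjoin (int_ring v F) x = box 0 (int k)"
proof -
  obtain c d where cd: "c \<in> int_ring v F" "d \<in> int_ring v F" "x * x = c + d * x"
    using square_int[OF assms(1-3)] by blast
  have adj: "adjoin (int_ring v F) x = {u + w * x |u w. u \<in> int_ring v F \<and> w \<in> int_ring v F}"
    by (rule adjoin_quadratic[OF int_ring_closed(1,4,6) cd(3,1,2)])
  have F: "a \<in> F" "b \<in> F" "b \<noteq> 0"
    using assms by (auto simp: int_ring_def)
  have vb: "v b = v \<pi> powi int k"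
    using assms(4) by simp
  show ?thesis
  proof
    show "adjoin (int_ring v F) x \<subseteq> box 0 (int k)"
      unfolding adj
    proof clarify
      fix u w assume uw: "u \<in> int_ring v F" "w \<in> int_ring v F"
      have "u + w * x = (u + w * a) + (b * w) * \<omega>"
        by (simp add: assms(3) algebra_simps)
      moreover have "u + w * a \<in> vball 0"
        unfolding vball_0 by (intro int_ring_closed(4,6) uw assms(1))
      moreover have "b * w \<in> vball (int k + 0)"
        unfolding vball_scale[OF F(2) vb] vball_0 using uw F by (auto simp: int_ring_def mult_mem)
      hence "b * w \<in> vball (int k)"
        by simp
      ultimately show "u + w * x \<in> box 0 (int k)"
        unfolding box_def by blast
    qed
    show "box 0 (int k) \<subseteq> adjoin (int_ring v F) x"
    proof
      fix y assume "y \<in> box 0 (int k)"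
      then obtain c d where cd: "y = c + d * \<omega>" "c \<in> vball 0" "d \<in> vball (int k)"
        unfolding box_def by blast
      have "b * (d / b) \<in> vball (int k + 0)"
        using cd(3) F by simp
      hence db: "d / b \<in> int_ring v F"
        unfolding vball_scale[OF F(2) vb] vball_0 by simp
      have "y = (c - d / b * a) + (d / b) * x"
        using F by (simp add: cd(1) assms(3) field_simps)
      moreover have "c - d / b * a \<in> int_ring v F"
        using cd(2) unfolding vball_0 by (intro int_ring_closed(5,6) db assms(1))
      ultimately show "y \<in> adjoin (int_ring v F) x"
        unfolding adj using db by blast
    qed
  qed
qed

lemma add_index_adjoin:
  assumes "a \<in> int_ring v F" "b \<in> int_ring v F" "x = a + b * \<omega>" "v b = v \<pi> ^ k"
  shows "add_index (int_ring v K) (adjoin (int_ring v F) x) = card R ^ k"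
proof -
  obtain T where "is_transversal T (box 0 0) (box 0 (int k))" "card T = card R ^ k"
    using box_transversal[of 0 0 0 k] by auto
  thus ?thesis
    using add_index_eq_card[OF _ box_add_closed] by (simp add: int_ring_K adjoin_int[OF assms])
qed

end

section \<open>Haar measure\<close>

text \<open>Countable additivity for a nonnegative function cut into pieces. Measurability of f
  comes from the pieces too, f being their pointwise sum; this suits the densities, which are
  computed level by level.\<close>

lemma has_bochner_integral_pieces:
  fixes f :: "'b \<Rightarrow> real"
  assumes disj: "disjoint_family A"
    and int: "\<And>i::nat. has_bochner_integral M (\<lambda>x. indicator (A i) x * f x) (m i)"
    and nonneg: "\<And>x. x \<in> space M \<Longrightarrow> 0 \<le> f x"
    and zero: "\<And>x. x \<in> space M \<Longrightarrow> x \<notin> (\<Union>i. A i) \<Longrightarrow> f x = 0"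
    and sums: "m sums S"
  shows "has_bochner_integral M f S"
proof -
  let ?g = "\<lambda>i x. indicator (A i) x * f x"
  have g_sums: "(\<lambda>i. ?g i x) sums f x" if x: "x \<in> space M" for x
  proof (cases "x \<in> (\<Union>i. A i)")
    case True
    then obtain j where j: "x \<in> A j"
      by blast
    have "x \<notin> A i" if "i \<noteq> j" for i
      using disj j that unfolding disjoint_family_on_def by blast
    hence "(\<lambda>i. ?g i x) = (\<lambda>i. if i = j then f x else 0)"
      using j by (auto simp: indicator_def)
    thus ?thesis
      using sums_single[of j "\<lambda>_. f x"] by simp
  next
    case False
    thus ?thesis
      using zero[OF x] by simp
  qed
  have g_int: "integrable M (?g i)" "integral\<^sup>L M (?g i) = m i" for i
    using int[of i] by (simp_all add: has_bochner_integral_iff)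
  have g_meas: "?g i \<in> borel_measurable M" for i
    using g_int(1) by (rule borel_measurable_integrable)
  have "(\<lambda>x. \<Sum>i. ?g i x) \<in> borel_measurable M"
    by (intro borel_measurable_suminf g_meas)
  hence meas: "f \<in> borel_measurable M"
    using g_sums by (subst measurable_cong[of M f "\<lambda>x. \<Sum>i. ?g i x"]) (auto simp: sums_iff)
  have m_eq: "(\<integral>\<^sup>+x. ennreal (?g i x) \<partial>M) = ennreal (m i)" and m_nonneg: "0 \<le> m i" for i
  proof -
    have ae: "AE x in M. 0 \<le> ?g i x"
      using nonneg by (intro AE_I2) simp
    show "(\<integral>\<^sup>+x. ennreal (?g i x) \<partial>M) = ennreal (m i)"
      using nn_integral_eq_integral[OF g_int(1) ae] g_int(2) by simp
    show "0 \<le> m i"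
      using integral_nonneg_AE[OF ae] g_int(2) by simp
  qed
  have "(\<integral>\<^sup>+x. ennreal (f x) \<partial>M) = (\<integral>\<^sup>+x. (\<Sum>i. ennreal (?g i x)) \<partial>M)"
    using g_sums nonneg by (intro nn_integral_cong suminf_ennreal_eq[symmetric]) auto
  also have "\<dots> = (\<Sum>i. ennreal (m i))"
    using g_meas by (subst nn_integral_suminf) (auto simp: m_eq)
  also have "\<dots> = ennreal S"
    by (rule suminf_ennreal_eq[OF m_nonneg sums])
  finally have "(\<integral>\<^sup>+x. ennreal (f x) \<partial>M) = ennreal S" .
  moreover have "0 \<le> S"
    using sums m_nonneg by (metis suminf_nonneg sums_iff)
  ultimately show ?thesis
    using meas nonneg by (intro has_bochner_integral_nn_integral) auto
qed

lemma has_bochner_integral_diff_indicator: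
  assumes "A \<in> sets M" "B \<in> sets M" "B \<subseteq> A" "emeasure M A = ennreal a" "emeasure M B = ennreal b"
    "0 \<le> a" "0 \<le> b"
  shows "has_bochner_integral M (\<lambda>x. c * indicator (A - B) x) (c * (a - b) :: real)"
proof -
  have "measure M (A - B) = a - b"
    using assms by (subst measure_Diff) (auto simp: measure_def)
  moreover have "emeasure M (A - B) \<le> emeasure M A"
    using assms by (intro emeasure_mono) auto
  hence "emeasure M (A - B) < \<infinity>"
    using assms(4) by (simp add: less_top[symmetric] top_unique) (metis ennreal_neq_top neq_top_trans)
  hence "has_bochner_integral M (indicator (A - B)) (measure M (A - B))"
    using assms by (intro has_bochner_integral_real_indicator) auto
  ultimately show ?thesis
    by (intro has_bochner_integral_mult_right) auto
qed

locale haar = nonarch v + sub_field L for v :: "'a::field \<Rightarrow> real" and L +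
  fixes M :: "'a measure"
  assumes haar: "is_haar v L M"
begin

sublocale M: Metric_space L "\<lambda>x y. v (x - y)"
  by (rule Metric_space_nonarch_abs[OF nonarch])

lemma sets_M: "sets M = sigma_sets L {U. openin (abs_topology v L) U}"
proof -
  have "{U. openin (abs_topology v L) U} \<subseteq> Pow L"
    using openin_subset by fastforce
  thus ?thesis
    using haar by (simp add: is_haar_def)
qed

lemma space_M: "space M = L"
proof -
  have "{U. openin (abs_topology v L) U} \<subseteq> Pow L"
    using openin_subset by fastforce
  hence "space (sigma L {U. openin (abs_topology v L) U}) = L"
    by (rule space_measure_of)
  moreover have "sets M = sets (sigma L {U. openin (abs_topology v L) U})"
    using haar by (simp add: is_haar_def)
  ultimately show ?thesis
    using sets_eq_imp_space_eq by metis
qed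

lemma translate: "a \<in> L \<Longrightarrow> A \<in> sets M \<Longrightarrow> emeasure M ((+) a ` A) = emeasure M A"
  using haar by (simp add: is_haar_def)

text \<open>\<open>is_haar\<close> relates the values of \<open>emeasure\<close> only. That
  translates are measurable follows by induction over the generated sigma-algebra, since translation
  preserves balls and hence open sets.\<close>

lemma translate_sets:
  assumes a: "a \<in> L" and A: "A \<in> sets M"
  shows "(+) a ` A \<in> sets M"
proof -
  have "(+) a ` A \<in> sigma_sets L {U. openin (abs_topology v L) U}"
    using A unfolding sets_M
  proof (induction rule: sigma_sets.induct)
    case (Basic U)
    hence U: "U \<subseteq> L" "\<And>x. x \<in> U \<Longrightarrow> \<exists>r>0. M.mball x r \<subseteq> U"
      by (auto simp: M.openin_mtopology)
    have "openin (abs_topology v L) ((+) a ` U)"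
      unfolding M.openin_mtopology
    proof (intro conjI allI impI)
      show "(+) a ` U \<subseteq> L"
        using U(1) a add_mem by auto
      fix x assume "x \<in> (+) a ` U"
      then obtain u where u: "u \<in> U" "x = a + u"
        by blast
      obtain r where r: "r > 0" "M.mball u r \<subseteq> U"
        using U(2)[OF u(1)] by blast
      have "M.mball x r \<subseteq> (+) a ` U"
      proof
        fix y assume y: "y \<in> M.mball x r"
        hence "y - a \<in> M.mball u r"
          using u U(1) a by (auto simp: algebra_simps intro: diff_mem)
        hence "y - a \<in> U"
          using r(2) by blast
        thus "y \<in> (+) a ` U"
          by (intro image_eqI[of _ _ "y - a"]) auto
      qed
      thus "\<exists>r>0. M.mball x r \<subseteq> (+) a ` U"
        using r(1) by blast
    qed
    thus ?case
      by (intro sigma_sets.Basic) simp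
  next
    case Empty
    show ?case by (simp add: sigma_sets.Empty)
  next
    case (Compl A)
    have "(+) a ` (L - A) = L - (+) a ` A"
    proof
      show "(+) a ` (L - A) \<subseteq> L - (+) a ` A"
        using a add_mem by auto
      show "L - (+) a ` A \<subseteq> (+) a ` (L - A)"
      proof
        fix x assume x: "x \<in> L - (+) a ` A"
        hence "x - a \<in> L - A"
          using a diff_mem by (auto simp: image_iff algebra_simps)
        thus "x \<in> (+) a ` (L - A)"
          by (intro image_eqI[of _ _ "x - a"]) auto
      qed
    qed
    thus ?case
      using Compl.IH by (simp add: sigma_sets.Compl)
  next
    case (Union A)
    thus ?case
      by (simp add: image_UN sigma_sets.Union)
  qed
  thus ?thesis
    by (simp add: sets_M)
qed

text \<open>Stability under perturbations of one fixed size makes a set open, hence Borel. Balls of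
  F and boxes of K get their measurability this way.\<close>

lemma locally_constant_sets:
  assumes "U \<subseteq> L" "r > 0" "\<And>x y. x \<in> U \<Longrightarrow> y \<in> L \<Longrightarrow> v (x - y) < r \<Longrightarrow> y \<in> U"
  shows "U \<in> sets M"
proof -
  have "openin (abs_topology v L) U"
    unfolding M.openin_mtopology
  proof (intro conjI allI impI)
    fix x assume "x \<in> U"
    hence "M.mball x r \<subseteq> U"
      using assms(3) by auto
    thus "\<exists>r>0. M.mball x r \<subseteq> U"
      using assms(2) by blast
  qed (use assms in auto)
  thus ?thesis
    unfolding sets_M by (intro sigma_sets.Basic) simp
qed

text \<open>A is the disjoint union of the translates of B by the representatives, and all of them
  have the same measure.\<close>

lemma emeasure_transversal:
  assumes "is_transversal T A B" "finite T" "add_closed A" "add_closed B" "B \<subseteq> A" "A \<subseteq> L" "B \<in> sets M"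
  shows "emeasure M A = of_nat (card T) * emeasure M B"
proof -
  note Td = is_transversalD[OF assms(1)]
  have A_eq: "A = (\<Union>r\<in>T. (+) r ` B)"
  proof
    show "A \<subseteq> (\<Union>r\<in>T. (+) r ` B)"
    proof
      fix x assume "x \<in> A"
      then obtain r where r: "r \<in> T" "x - r \<in> B"
        using Td(2) by blast
      have "x \<in> (+) r ` B"
        by (rule image_eqI[of _ _ "x - r"]) (use r in auto)
      thus "x \<in> (\<Union>r\<in>T. (+) r ` B)"
        using r(1) by blast
    qed
    show "(\<Union>r\<in>T. (+) r ` B) \<subseteq> A"
      using Td(1) assms(5) add_closedD(4)[OF assms(3)] by blast
  qed
  have "disjoint_family_on (\<lambda>r. (+) r ` B) T"
    unfolding disjoint_family_on_def
  proof (intro ballI impI)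
    fix r s assume rs: "r \<in> T" "s \<in> T" "r \<noteq> s"
    show "(+) r ` B \<inter> (+) s ` B = {}"
    proof (rule ccontr)
      assume "(+) r ` B \<inter> (+) s ` B \<noteq> {}"
      then obtain b c where bc: "b \<in> B" "c \<in> B" "r + b = s + c"
        by blast
      hence "r - s = c - b"
        by (simp add: algebra_simps)
      hence "r - s \<in> B"
        using bc add_closedD(2)[OF assms(4)] by simp
      thus False
        using Td(3)[OF assms(4) rs(1,2)] rs(3) by blast
    qed
  qed
  moreover have TL: "r \<in> L" if "r \<in> T" for r
    using Td(1)[OF that] assms(6) by blast
  ultimately have "emeasure M A = (\<Sum>r\<in>T. emeasure M ((+) r ` B))"
    unfolding A_eq using assms(2,7) translate_sets by (intro sum_emeasure[symmetric]) auto
  also have "\<dots> = (\<Sum>r\<in>T. emeasure M B)"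
    by (intro sum.cong refl translate TL assms(7))
  finally show ?thesis
    by simp
qed

end

locale quad_haar = quad v F \<pi> R K \<omega> \<sigma> + HF: haar v F lamF + HK: haar v K lamK
  for v :: "'a::field_char_0 \<Rightarrow> real" and F \<pi> R K \<omega> \<sigma> lamF lamK
begin

lemma box_absorb:
  assumes "x \<in> box i j" "y \<in> K" "v (x - y) \<le> v \<pi> powi max i j"
  shows "y \<in> box i j"
proof -
  have "x \<in> K"
    using assms(1) box_subset_K by blast
  hence "x - y \<in> box (max i j) (max i j)"
    using assms ball_eq_box[of "max i j"] ext.diff_mem by blast
  hence "x - y \<in> box i j"
    using box_mono[of i "max i j" j "max i j"] by auto
  hence "x - (x - y) \<in> box i j"
    by (rule add_closedD(2)[OF box_add_closed assms(1)])
  thus ?thesis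
    by simp
qed

lemma box_sets: "box i j \<in> sets lamK"
  by (rule HK.locally_constant_sets[OF box_subset_K powi_gt_0[of "max i j"]])
    (use box_absorb in \<open>auto intro: less_imp_le\<close>)

lemma card_R_pos: "card R > 0"
  using unif_val unif_gt_0 by (metis div_by_0 gr0I of_nat_0 less_irrefl)

lemma emeasure_box: "emeasure lamK (box i j) = ennreal (v \<pi> powi (i + j))"
proof -
  \<comment> \<open>The cube with index N lies in both \<open>box i j\<close> and the unit box, even
    for negative i or j, so both measures are multiples of the measure of that cube.\<close>
  define N where "N = nat (max 0 (max i j))"
  let ?B = "box (int N) (int N)" and ?q = "card R"
  have q: "?q > 0"
    by (rule card_R_pos)
  have cells: "emeasure lamK (box i j) = of_nat (?q ^ (k + l)) * emeasure lamK (box (i + int k) (j + int l))"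
    for i j k l
  proof -
    obtain T where T: "is_transversal T (box i j) (box (i + int k) (j + int l))" "finite T"
      "card T = ?q ^ (k + l)"
      using box_transversal by blast
    show ?thesis
      using HK.emeasure_transversal[OF T(1,2) box_add_closed box_add_closed box_mono box_subset_K box_sets] T(3)
      by simp
  qed
  have "emeasure lamK (box 0 0) = 1"
    using HK.haar by (simp add: is_haar_def int_ring_K)
  hence "of_nat (?q ^ (N + N)) * emeasure lamK ?B = 1"
    using cells[of 0 0 N N] by simp
  hence B: "emeasure lamK ?B = ennreal (1 / real ?q ^ (N + N))"
    using q by (cases "emeasure lamK ?B")
      (auto simp: ennreal_of_nat_eq_real_of_nat ennreal_mult_top field_simps simp flip: ennreal_mult ennreal_1)
  define k l where "k = nat (int N - i)" and "l = nat (int N - j)"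
  have kl: "i + int k = int N" "j + int l = int N"
    by (auto simp: k_def l_def N_def)
  have "emeasure lamK (box i j) = ennreal (real ?q ^ (k + l) * (1 / real ?q ^ (N + N)))"
    using cells[of i j k l] B unfolding kl by (simp add: ennreal_of_nat_eq_real_of_nat flip: ennreal_mult)
  also have "real ?q ^ (k + l) * (1 / real ?q ^ (N + N)) = real ?q powi (int (k + l) - int (N + N))"
    using q by (simp add: power_int_diff del: of_nat_add)
  also have "int (k + l) - int (N + N) = - (i + j)"
    using kl by simp
  also have "real ?q powi - (i + j) = v \<pi> powi (i + j)"
    unfolding unif_val power_int_minus by (simp add: power_int_divide_distrib inverse_eq_divide)
  finally show ?thesis .
qed

lemma emeasure_ball:
  assumes "c \<in> K" "c \<noteq> 0" "a \<in> K"
  shows "{x \<in> K. v (x - a) \<le> v c} \<in> sets lamK"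
    and "emeasure lamK {x \<in> K. v (x - a) \<le> v c} = ennreal (v c ^ 2)"
proof -
  obtain i j where ij: "{x \<in> K. v x \<le> v c} = box i j" "v c ^ 2 = v \<pi> powi (i + j)"
    using v_ball_eq_box[OF assms(1,2)] by blast
  have eq: "{x \<in> K. v (x - a) \<le> v c} = (+) a ` box i j"
  proof
    show "(+) a ` box i j \<subseteq> {x \<in> K. v (x - a) \<le> v c}"
      unfolding ij(1)[symmetric] using assms(3) ext.add_mem by auto
    show "{x \<in> K. v (x - a) \<le> v c} \<subseteq> (+) a ` box i j"
    proof
      fix x assume x: "x \<in> {x \<in> K. v (x - a) \<le> v c}"
      show "x \<in> (+) a ` box i j"
        unfolding ij(1)[symmetric]
        by (rule image_eqI[of _ _ "x - a"]) (use x assms(3) ext.diff_mem in auto)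
    qed
  qed
  show "{x \<in> K. v (x - a) \<le> v c} \<in> sets lamK"
    unfolding eq by (rule HK.translate_sets[OF assms(3) box_sets])
  show "emeasure lamK {x \<in> K. v (x - a) \<le> v c} = ennreal (v c ^ 2)"
    unfolding eq HK.translate[OF assms(3) box_sets] emeasure_box ij(2) ..
qed

text \<open>On a ball that misses 0 the absolute value is constant, so inversion divides all
  distances to the centre by \<open>v r ^ 2\<close> and maps the ball onto a ball.\<close>

lemma inverse_ball:
  assumes r: "r \<in> K" and lt: "v c < v r"
  shows "inverse ` {x \<in> K. v (x - r) \<le> v c} = {x \<in> K. v (x - inverse r) \<le> v (c / r ^ 2)}"
proof -
  have r0: "r \<noteq> 0" "v r > 0"
    using lt nonneg[of c] by (auto simp del: nonneg)
  have vr: "v x = v r" if "v (x - r) \<le> v c" for x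
    using eq_of_diff_less[of x r] that lt by simp
  have one_way: "v (inverse x - inverse r) = v (x - r) / v r ^ 2" if "v (x - r) \<le> v c" for x
  proof -
    have "x \<noteq> 0"
      using vr[OF that] r0 by auto
    hence "inverse x - inverse r = (r - x) / (x * r)"
      using r0 by (simp add: field_simps)
    thus ?thesis
      using vr[OF that] by (simp add: divide mult power2_eq_square minus_commute[of r x])
  qed
  show ?thesis
  proof
    show "inverse ` {x \<in> K. v (x - r) \<le> v c} \<subseteq> {x \<in> K. v (x - inverse r) \<le> v (c / r ^ 2)}"
      using one_way r0 by (auto simp: ext.inverse_mem divide power intro!: divide_right_mono)
    show "{x \<in> K. v (x - inverse r) \<le> v (c / r ^ 2)} \<subseteq> inverse ` {x \<in> K. v (x - r) \<le> v c}"
    proof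
      fix x assume "x \<in> {x \<in> K. v (x - inverse r) \<le> v (c / r ^ 2)}"
      hence x: "x \<in> K" "v (x - inverse r) \<le> v c / v r ^ 2"
        by (auto simp: divide power)
      have "v c / v r ^ 2 < v r / v r ^ 2"
        using lt r0(2) by (intro divide_strict_right_mono) auto
      moreover have "v r / v r ^ 2 = v (inverse r)"
        unfolding inverse using r0 by (simp add: power2_eq_square inverse_eq_divide del: pos_iff)
      ultimately have lt': "v (x - inverse r) < v (inverse r)"
        using x(2) by linarith
      hence vx: "v x = v (inverse r)"
        by (rule eq_of_diff_less)
      hence x0: "x \<noteq> 0"
        using r0 by (auto simp: inverse)
      have "inverse x - r = (inverse r - x) * r * inverse x"
        using x0 r0 by (simp add: field_simps)
      hence "v (inverse x - r) = v (x - inverse r) * v r ^ 2"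
        using vx by (simp add: mult inverse minus_commute[of "inverse r" x] power2_eq_square)
      also have "\<dots> \<le> v c"
        using x(2) r0(2) by (simp add: field_simps)
      finally have "inverse x \<in> {x \<in> K. v (x - r) \<le> v c}"
        using x(1) ext.inverse_mem by simp
      thus "x \<in> inverse ` {x \<in> K. v (x - r) \<le> v c}"
        by (intro image_eqI[of _ _ "inverse x"]) auto
    qed
  qed
qed

text \<open>Change of variables for inversion, done ball by ball. S is a finite union of balls of
  radius t^N avoiding 0. Inversion divides the measure of the ball around r by
  \<open>v r ^ 4\<close>, and on the image the weight \<open>v x powi (-4)\<close> equals
  \<open>v r ^ 4\<close>, so each ball contributes its original measure.\<close>

lemma inversion_integral:
  assumes S: "S \<subseteq> int_ring v K" and inv: "\<And>x y. x \<in> S \<Longrightarrow> y \<in> K \<Longrightarrow> v (y - x) \<le> v \<pi> ^ N \<Longrightarrow> y \<in> S"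
    and big: "\<And>x. x \<in> S \<Longrightarrow> v \<pi> ^ N < v x"
  shows "has_bochner_integral lamK (\<lambda>x. indicator (inverse ` S) x * v x powi (-4)) (measure lamK S)"
proof -
  let ?B = "box (int N) (int N)"
  let ?U = "\<lambda>r. {x \<in> K. v (x - r) \<le> v (\<pi> ^ N)}"
  have pw: "v (\<pi> ^ N) = v \<pi> ^ N" "\<pi> ^ N \<in> K" "\<pi> ^ N \<noteq> 0"
    using unif_mem F_subset by (auto simp: power intro: ext.power_mem)
  obtain T where T: "is_transversal T (box 0 0) (box (0 + int N) (0 + int N))" "finite T"
    using box_transversal[of 0 0 N N] by blast
  note Td = is_transversalD[OF T(1)]
  have B_iff: "x \<in> ?B \<longleftrightarrow> x \<in> K \<and> v x \<le> v (\<pi> ^ N)" for x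
    using ball_eq_box[of "int N"] pw(1) by auto
  have SK: "x \<in> K" if "x \<in> S" for x
    using S that by (auto simp: int_ring_def)
  have TK: "r \<in> K" if "r \<in> T" for r
    using Td(1)[OF that] box_subset_K by blast
  \<comment> \<open>Stability of S under perturbations of size t^N puts the representative of every
    point of S into S, so these centres cover S.\<close>
  define T' where "T' = T \<inter> S"
  have finT': "finite T'"
    using T(2) by (simp add: T'_def)
  have S_eq: "S = (\<Union>r\<in>T'. ?U r)"
  proof
    show "(\<Union>r\<in>T'. ?U r) \<subseteq> S"
      using inv pw(1) unfolding T'_def by auto
    show "S \<subseteq> (\<Union>r\<in>T'. ?U r)"
    proof
      fix x assume x: "x \<in> S"
      hence "x \<in> box 0 0"
        using S int_ring_K by blast
      then obtain r where r: "r \<in> T" "x - r \<in> ?B"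
        using Td(2) by auto
      hence le: "v (x - r) \<le> v (\<pi> ^ N)"
        using B_iff by blast
      hence "r \<in> S"
        using inv[OF x TK[OF r(1)]] pw(1) by (simp add: minus_commute[of r x])
      thus "x \<in> (\<Union>r\<in>T'. ?U r)"
        using r(1) le SK[OF x] unfolding T'_def by blast
    qed
  qed
  have U_disj: "r = s" if "r \<in> T'" "s \<in> T'" "x \<in> ?U r" "x \<in> ?U s" for r s x
  proof -
    have "r \<in> T" "s \<in> T" "r \<in> K" "s \<in> K"
      using that TK by (auto simp: T'_def)
    moreover have "v ((x - s) - (x - r)) \<le> v (\<pi> ^ N)"
      by (rule diff_le) (use that(3,4) in auto)
    ultimately have "r - s \<in> ?B"
      unfolding B_iff using ext.diff_mem by simp
    thus ?thesis
      using Td(3)[OF box_add_closed, of r s] \<open>r \<in> T\<close> \<open>s \<in> T\<close> by simp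
  qed
  have disj: "disjoint_family_on ?U T'"
    unfolding disjoint_family_on_def using U_disj by blast
  have U_ball: "?U r \<in> sets lamK" "emeasure lamK (?U r) = ennreal (v (\<pi> ^ N) ^ 2)" if "r \<in> T'" for r
    using emeasure_ball[OF pw(2,3), of r] that SK by (auto simp: T'_def)
  have "measure lamK S = (\<Sum>r\<in>T'. measure lamK (?U r))"
    unfolding S_eq using U_ball finT' disj by (intro measure_finite_Union) auto
  also have "\<dots> = (\<Sum>r\<in>T'. v (\<pi> ^ N) ^ 2)"
    using U_ball by (intro sum.cong) (auto simp: measure_def)
  finally have mS: "measure lamK S = (\<Sum>r\<in>T'. v (\<pi> ^ N) ^ 2)" .
  have piece: "has_bochner_integral lamK (\<lambda>x. indicator (inverse ` ?U r) x * v x powi (-4)) (v (\<pi> ^ N) ^ 2)"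
    if r: "r \<in> T'" for r
  proof -
    have rS: "r \<in> S" "r \<in> K" "v (\<pi> ^ N) < v r"
      using r SK big pw(1) by (auto simp: T'_def)
    have r0: "r \<noteq> 0"
      using rS(3) nonneg[of "\<pi> ^ N"] by (auto simp del: nonneg)
    have c: "\<pi> ^ N / r ^ 2 \<in> K" "\<pi> ^ N / r ^ 2 \<noteq> 0" "inverse r \<in> K"
      using pw rS r0 by (auto intro: ext.divide_mem ext.power_mem ext.inverse_mem)
    note ball = emeasure_ball[OF c]
    let ?C = "{x \<in> K. v (x - inverse r) \<le> v (\<pi> ^ N / r ^ 2)}"
    have C: "inverse ` ?U r = ?C"
      by (rule inverse_ball[OF rS(2,3)])
    have "has_bochner_integral lamK (\<lambda>x. indicator ?C x * v r ^ 4) (measure lamK ?C * v r ^ 4)"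
      using ball by (intro has_bochner_integral_mult_left has_bochner_integral_real_indicator) auto
    moreover have "measure lamK ?C * v r ^ 4 = v (\<pi> ^ N) ^ 2"
      using ball(2) r0 by (simp add: measure_def divide power power_divide flip: power_mult)
    moreover have eq: "indicator ?C x * v x powi (-4) = indicator ?C x * v r ^ 4" for x
    proof (cases "x \<in> ?C")
      case True
      then obtain y where y: "y \<in> ?U r" "x = inverse y"
        using C by blast
      have "v y = v r"
        using eq_of_diff_less[of y r] y(1) rS(3) by auto
      thus ?thesis
        using True y(2) by (simp add: inverse power_int_minus power_inverse)
    qed simp
    ultimately show ?thesis
      unfolding C eq by metis
  qed
  have ind: "indicator (inverse ` S) x = (\<Sum>r\<in>T'. indicator (inverse ` ?U r) x :: real)" for x
  proof -
    have "disjoint_family_on (\<lambda>r. inverse ` ?U r) T'"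
      unfolding disjoint_family_on_def
    proof (intro ballI impI)
      fix r s assume rs: "r \<in> T'" "s \<in> T'" "r \<noteq> s"
      have "?U r \<inter> ?U s = {}"
        using U_disj[OF rs(1,2)] rs(3) by blast
      thus "inverse ` ?U r \<inter> inverse ` ?U s = {}"
        by (simp add: image_Int[symmetric] inj_on_def)
    qed
    moreover have "inverse ` S = (\<Union>r\<in>T'. inverse ` ?U r)"
      by (subst S_eq) blast
    ultimately show ?thesis
      using indicator_UN_disjoint[OF finT', of "\<lambda>r. inverse ` ?U r" x] by simp
  qed
  have "has_bochner_integral lamK (\<lambda>x. \<Sum>r\<in>T'. indicator (inverse ` ?U r) x * v x powi (-4))
      (\<Sum>r\<in>T'. v (\<pi> ^ N) ^ 2)"
    by (intro has_bochner_integral_sum piece)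
  thus ?thesis
    unfolding mS ind sum_distrib_right .
qed

end

section \<open>Random polynomials\<close>

context quad_haar
begin

abbreviation MO :: "'a measure"
  where "MO \<equiv> restrict_space lamF (int_ring v F)"

lemma vball_sets: "vball i \<in> sets lamF"
proof (rule HF.locally_constant_sets[OF _ powi_gt_0[of i]])
  fix x y assume x: "x \<in> vball i" and y: "y \<in> F" "v (x - y) < v \<pi> powi i"
  have "v (x - (x - y)) \<le> v \<pi> powi i"
    by (rule diff_le) (use x y in \<open>auto simp: vball_def\<close>)
  thus "y \<in> vball i"
    using y(1) by (simp add: vball_def)
qed (auto simp: vball_def)

lemma int_ring_sets: "int_ring v F \<in> sets lamF"
  using vball_sets[of 0] by (simp add: vball_0)

lemma space_MO: "space MO = int_ring v F"
  by (auto simp: space_restrict_space HF.space_M int_ring_def)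

lemma sets_MO: "A \<in> sets MO \<longleftrightarrow> A \<in> sets lamF \<and> A \<subseteq> int_ring v F"
  using int_ring_sets sets_restrict_space_iff[of "int_ring v F" lamF A] sets.sets_into_space[OF int_ring_sets]
  by (auto simp: Int_absorb2)

lemma emeasure_MO: "A \<in> sets MO \<Longrightarrow> emeasure MO A = emeasure lamF A"
  using int_ring_sets sets.sets_into_space[OF int_ring_sets]
  by (intro emeasure_restrict_space) (auto simp: sets_MO Int_absorb2)

lemma emeasure_space_MO: "emeasure MO (int_ring v F) = 1"
  using HF.haar emeasure_MO[of "int_ring v F"] int_ring_sets by (simp add: sets_MO is_haar_def)

lemma sigma_finite_MO: "sigma_finite_measure MO"
proof -
  have "finite_measure MO"
    by (rule finite_measureI) (simp add: space_MO emeasure_space_MO)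
  thus ?thesis
    by (simp add: finite_measure_def)
qed

lemma coset_sets: "{x \<in> int_ring v F. x - g \<in> vball i} \<in> sets MO" if g: "g \<in> int_ring v F"
proof -
  have "{x \<in> int_ring v F. x - g \<in> vball i} = (+) g ` vball i \<inter> int_ring v F"
  proof (intro equalityI subsetI)
    fix x assume "x \<in> {x \<in> int_ring v F. x - g \<in> vball i}"
    thus "x \<in> (+) g ` vball i \<inter> int_ring v F"
      by (auto intro!: image_eqI[of _ _ "x - g"])
  qed auto
  moreover have "(+) g ` vball i \<in> sets lamF"
    using g by (intro HF.translate_sets vball_sets) (simp add: int_ring_def)
  ultimately show ?thesis
    using int_ring_sets by (simp add: sets_MO)
qed

lemma translate_MO:
  assumes d: "d \<in> int_ring v F" and A: "A \<in> sets MO"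
  shows "{x \<in> int_ring v F. x + d \<in> A} \<in> sets MO"
    and "emeasure MO {x \<in> int_ring v F. x + d \<in> A} = emeasure MO A"
proof -
  have dF: "- d \<in> F" and AF: "A \<in> sets lamF" "A \<subseteq> int_ring v F"
    using d A[unfolded sets_MO] by (auto simp: int_ring_def uminus_mem)
  have eq: "{x \<in> int_ring v F. x + d \<in> A} = (+) (- d) ` A"
  proof (intro equalityI subsetI)
    fix x assume "x \<in> {x \<in> int_ring v F. x + d \<in> A}"
    thus "x \<in> (+) (- d) ` A"
      by (auto intro!: image_eqI[of _ _ "x + d"])
  next
    fix x assume "x \<in> (+) (- d) ` A"
    then obtain y where "y \<in> A" "x = y - d"
      by auto
    moreover from this have "x \<in> int_ring v F"
      using AF(2) d int_ring_closed(5) by blast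
    ultimately show "x \<in> {x \<in> int_ring v F. x + d \<in> A}"
      by simp
  qed
  show sets: "{x \<in> int_ring v F. x + d \<in> A} \<in> sets MO"
    unfolding sets_MO
  proof
    show "{x \<in> int_ring v F. x + d \<in> A} \<in> sets lamF"
      unfolding eq by (rule HF.translate_sets[OF dF AF(1)])
  qed blast
  show "emeasure MO {x \<in> int_ring v F. x + d \<in> A} = emeasure MO A"
    using emeasure_MO[OF sets] emeasure_MO[OF A] HF.translate[OF dF AF(1)] eq by simp
qed

end

sublocale quad_haar \<subseteq> PO: product_sigma_finite "\<lambda>_::nat. restrict_space lamF (int_ring v F)"
  by (simp add: product_sigma_finite_def sigma_finite_MO)

context quad_haar
begin

abbreviation polyM :: "nat \<Rightarrow> (nat \<Rightarrow> 'a) measure"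
  where "polyM m \<equiv> poly_measure v F lamF m"

lemma space_polyM: "space (polyM m) = {..m} \<rightarrow>\<^sub>E int_ring v F"
  by (simp add: poly_measure_def space_PiM space_MO)

lemma emeasure_space_polyM: "emeasure (polyM m) (space (polyM m)) = 1"
proof -
  have "emeasure (polyM m) ({..m} \<rightarrow>\<^sub>E int_ring v F) = (\<Prod>i\<in>{..m}. emeasure MO (int_ring v F))"
    unfolding poly_measure_def by (rule PO.emeasure_PiM) (simp_all add: sets_MO int_ring_sets)
  thus ?thesis
    by (simp add: space_polyM emeasure_space_MO)
qed

text \<open>A product measure is determined by its values on rectangles, and a rectangle is
  translated one coordinate at a time.\<close>

lemma polyM_translate:
  assumes d: "\<And>i. d i \<in> int_ring v F" and S: "S \<in> sets (polyM m)"
  shows "emeasure (polyM m) {c \<in> space (polyM m). (\<lambda>i\<in>{..m}. c i + d i) \<in> S} = emeasure (polyM m) S"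
proof -
  let ?\<tau> = "\<lambda>c. \<lambda>i\<in>{..m}. c i + d i"
  have comp: "(\<lambda>x. x + d i) \<in> measurable MO MO" for i
  proof (rule measurableI)
    show "x + d i \<in> space MO" if "x \<in> space MO" for x
      using that d int_ring_closed(4) by (simp add: space_MO)
    show "(\<lambda>x. x + d i) -` A \<inter> space MO \<in> sets MO" if "A \<in> sets MO" for A
    proof -
      have "(\<lambda>x. x + d i) -` A \<inter> space MO = {x \<in> int_ring v F. x + d i \<in> A}"
        by (auto simp: space_MO)
      thus ?thesis
        using translate_MO(1)[OF d that] by simp
    qed
  qed
  have meas: "?\<tau> \<in> measurable (polyM m) (polyM m)"
    unfolding poly_measure_def
  proof (rule measurable_restrict)
    fix i assume i: "i \<in> {..m}"
    show "(\<lambda>c. c i + d i) \<in> measurable (Pi\<^sub>M {..m} (\<lambda>_. MO)) MO"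
      by (rule measurable_compose[where f = "\<lambda>c. c i" and N = MO and g = "\<lambda>x. x + d i"])
        (use measurable_component_singleton[OF i, of "\<lambda>_. MO"] comp in auto)
  qed
  have "distr (polyM m) (polyM m) ?\<tau> = Pi\<^sub>M {..m} (\<lambda>_. MO)"
  proof (rule PO.PiM_eqI)
    show "sets (distr (polyM m) (polyM m) ?\<tau>) = sets (Pi\<^sub>M {..m} (\<lambda>_. MO))"
      by (simp add: poly_measure_def)
    fix A :: "nat \<Rightarrow> 'a set" assume A: "\<And>i. i \<in> {..m} \<Longrightarrow> A i \<in> sets MO"
    have "?\<tau> -` Pi\<^sub>E {..m} A \<inter> space (polyM m) = Pi\<^sub>E {..m} (\<lambda>i. {x \<in> int_ring v F. x + d i \<in> A i})"
      by (auto simp: space_polyM PiE_iff restrict_def extensional_def)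
    moreover have "Pi\<^sub>E {..m} A \<in> sets (polyM m)"
      unfolding poly_measure_def using A by (intro sets_PiM_I_finite) auto
    ultimately have "emeasure (distr (polyM m) (polyM m) ?\<tau>) (Pi\<^sub>E {..m} A)
        = emeasure (polyM m) (Pi\<^sub>E {..m} (\<lambda>i. {x \<in> int_ring v F. x + d i \<in> A i}))"
      using meas by (simp add: emeasure_distr)
    also have "\<dots> = (\<Prod>i\<in>{..m}. emeasure MO {x \<in> int_ring v F. x + d i \<in> A i})"
      unfolding poly_measure_def by (rule PO.emeasure_PiM) (use translate_MO(1)[OF d A] in auto)
    also have "\<dots> = (\<Prod>i\<in>{..m}. emeasure MO (A i))"
      by (intro prod.cong refl translate_MO(2)[OF d A])
    finally show "emeasure (distr (polyM m) (polyM m) ?\<tau>) (Pi\<^sub>E {..m} A) = (\<Prod>i\<in>{..m}. emeasure MO (A i))" .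
  qed simp
  hence distr: "distr (polyM m) (polyM m) ?\<tau> = polyM m"
    by (simp add: poly_measure_def)
  have "emeasure (polyM m) S = emeasure (distr (polyM m) (polyM m) ?\<tau>) S"
    by (simp add: distr)
  also have "\<dots> = emeasure (polyM m) (?\<tau> -` S \<inter> space (polyM m))"
    by (rule emeasure_distr[OF meas S])
  also have "?\<tau> -` S \<inter> space (polyM m) = {c \<in> space (polyM m). ?\<tau> c \<in> S}"
    by auto
  finally show ?thesis
    by simp
qed

text \<open>
  Coset decompositions replace measurability of addition, which would need a second countable topology.
\<close>

lemma polyM_locally_constant:
  assumes S: "S \<subseteq> space (polyM m)"
    and inv: "\<And>c c'. c \<in> S \<Longrightarrow> c' \<in> space (polyM m) \<Longrightarrow> (\<And>i. i \<le> m \<Longrightarrow> c i - c' i \<in> vball (int N)) \<Longrightarrow> c' \<in> S"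
  shows "S \<in> sets (polyM m)"
proof -
  obtain T where T: "is_transversal T (vball 0) (vball (0 + int N))" "finite T"
    using vball_transversal[of 0 N] by blast
  note Td = is_transversalD[OF T(1)]
  define cyl where "cyl g = Pi\<^sub>E {..m} (\<lambda>i. {x \<in> int_ring v F. x - g i \<in> vball (int N)})" for g
  define G where "G = {g \<in> {..m} \<rightarrow>\<^sub>E T. cyl g \<subseteq> S}"
  have "S = (\<Union>g\<in>G. cyl g)"
  proof
    show "(\<Union>g\<in>G. cyl g) \<subseteq> S"
      unfolding G_def by blast
    show "S \<subseteq> (\<Union>g\<in>G. cyl g)"
    proof
      fix c assume c: "c \<in> S"
      hence cO: "c \<in> {..m} \<rightarrow>\<^sub>E int_ring v F"
        using S space_polyM by blast
      have "\<exists>r\<in>T. c i - r \<in> vball (int N)" if "i \<le> m" for i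
        using Td(2)[of "c i"] PiE_mem[OF cO, of i] that by (simp add: vball_0)
      then obtain g0 where g0: "\<And>i. i \<le> m \<Longrightarrow> g0 i \<in> T \<and> c i - g0 i \<in> vball (int N)"
        by metis
      define g where "g = restrict g0 {..m}"
      have g: "g \<in> {..m} \<rightarrow>\<^sub>E T" "\<And>i. i \<le> m \<Longrightarrow> c i - g i \<in> vball (int N)"
        using g0 by (auto simp: g_def)
      have "c \<in> cyl g"
        using cO g(2) by (auto simp: cyl_def PiE_iff)
      moreover have "cyl g \<subseteq> S"
      proof
        fix c' assume c': "c' \<in> cyl g"
        have "c i - c' i \<in> vball (int N)" if "i \<le> m" for i
        proof -
          have "c' i - g i \<in> vball (int N)"
            using c' that by (auto simp: cyl_def)
          from add_closedD(2)[OF vball_add_closed g(2)[OF that] this] show ?thesis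
            by simp
        qed
        moreover have "c' \<in> space (polyM m)"
          using c' by (auto simp: cyl_def space_polyM PiE_iff)
        ultimately show "c' \<in> S"
          using inv[OF c] by blast
      qed
      ultimately show "c \<in> (\<Union>g\<in>G. cyl g)"
        using g(1) unfolding G_def by blast
    qed
  qed
  moreover have "finite G"
    unfolding G_def using finite_PiE[of "{..m}" "\<lambda>_. T"] T(2) by simp
  moreover have "cyl g \<in> sets (polyM m)" if "g \<in> G" for g
    unfolding cyl_def poly_measure_def
  proof (intro sets_PiM_I_finite coset_sets)
    fix i assume "i \<in> {..m}"
    hence "g i \<in> T"
      using that by (auto simp: G_def)
    thus "g i \<in> int_ring v F"
      using Td(1) vball_0 by blast
  qed simp
  ultimately show ?thesis
    by auto
qed

lemma lin_vball:
  assumes "\<And>i. i \<le> m \<Longrightarrow> c i \<in> vball k" "\<And>i. i \<le> m \<Longrightarrow> x i \<in> int_ring v F"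
  shows "(\<Sum>i\<le>m. c i * x i) \<in> vball k"
proof -
  have "v (c i * x i) \<le> v \<pi> powi k" if "i \<le> m" for i
    using assms[OF that] mult_left_le[of "v (x i)" "v (c i)"]
    by (simp add: mult vball_def int_ring_def)
  thus ?thesis
    using assms powi_gt_0[of k] unfolding vball_def
    by (auto intro!: sum_mem sum_le mult_mem simp: int_ring_def less_imp_le)
qed

text \<open>Uniform distribution of the two coordinates on O_F^2. By the triangular shape of
  \<open>x 0 = 1\<close>, \<open>y 0 = 0\<close>, \<open>y 1 = 1\<close>, the constant and linear
  coefficients reach every pair, so all residue cells are translates of each other and q^(i+j) of
  them share the total mass 1 equally. Hence the condition on m, and no further dependence on
  m.\<close>

lemma polyM_cells:
  assumes x: "\<And>i. i \<le> m \<Longrightarrow> x i \<in> int_ring v F" and y: "\<And>i. i \<le> m \<Longrightarrow> y i \<in> int_ring v F"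
    and m: "1 \<le> m" and xy: "x 0 = 1" "y 0 = 0" "y 1 = 1"
  defines "LE \<equiv> \<lambda>i j. {c \<in> space (polyM m). v (\<Sum>l\<le>m. c l * x l) \<le> v \<pi> ^ i \<and> v (\<Sum>l\<le>m. c l * y l) \<le> v \<pi> ^ j}"
  shows "LE i j \<in> sets (polyM m)" "emeasure (polyM m) (LE i j) = ennreal (v \<pi> ^ (i + j))"
proof -
  let ?P = "polyM m" and ?q = "card R"
  define lx where "lx c = (\<Sum>l\<le>m. c l * x l)" for c
  define ly where "ly c = (\<Sum>l\<le>m. c l * y l)" for c
  have memO: "c l \<in> int_ring v F" if "c \<in> space ?P" "l \<le> m" for c l
    using that by (auto simp: space_polyM)
  have lx_O: "lx c \<in> vball 0" and ly_O: "ly c \<in> vball 0" if "c \<in> space ?P" for c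
    unfolding lx_def ly_def
    by (rule lin_vball; use memO[OF that] x y in \<open>simp add: vball_0\<close>)+
  define cell where "cell r s = {c \<in> space ?P. lx c - r \<in> vball (int i) \<and> ly c - s \<in> vball (int j)}" for r s
  have LE_eq: "LE i j = cell 0 0"
    unfolding LE_def cell_def lx_def[symmetric] ly_def[symmetric]
    using lx_O ly_O by (auto simp: vball_def)
  have cell_sets: "cell r s \<in> sets ?P" for r s
  proof (rule polyM_locally_constant[where N = "max i j"])
    show "cell r s \<subseteq> space ?P"
      by (auto simp: cell_def)
    fix c c' assume c: "c \<in> cell r s" and c': "c' \<in> space ?P"
      and diff: "\<And>l. l \<le> m \<Longrightarrow> c l - c' l \<in> vball (int (max i j))"
    have "(\<Sum>l\<le>m. (c l - c' l) * x l) \<in> vball (int (max i j))"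
         "(\<Sum>l\<le>m. (c l - c' l) * y l) \<in> vball (int (max i j))"
      by (rule lin_vball[OF diff x], simp_all) (rule lin_vball[OF diff y], simp_all)
    hence "lx c - lx c' \<in> vball (int i)" "ly c - ly c' \<in> vball (int j)"
      using vball_mono[of "int i" "int (max i j)"] vball_mono[of "int j" "int (max i j)"]
      by (auto simp: lx_def ly_def left_diff_distrib sum_subtractf)
    moreover have "lx c - r \<in> vball (int i)" "ly c - s \<in> vball (int j)"
      using c by (auto simp: cell_def)
    ultimately have "(lx c - r) - (lx c - lx c') \<in> vball (int i)" "(ly c - s) - (ly c - ly c') \<in> vball (int j)"
      using add_closedD(2)[OF vball_add_closed] by blast+
    thus "c' \<in> cell r s"
      using c' by (simp add: cell_def)
  qed
  show "LE i j \<in> sets ?P"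
    unfolding LE_eq by (rule cell_sets)
  have cell_eq: "emeasure ?P (cell r s) = emeasure ?P (cell 0 0)"
    if rs: "r \<in> int_ring v F" "s \<in> int_ring v F" for r s
  proof -
    \<comment> \<open>Adding this polynomial shifts the coordinates by exactly (r, s): the linear
      coefficient s produces the second one, and the constant coefficient compensates the
      contribution \<open>s * x 1\<close> to the first.\<close>
    define d where "d l = (if l = 0 then r - s * x 1 else if l = 1 then s else 0)" for l :: nat
    have dO: "d l \<in> int_ring v F" for l
      using rs x[OF m] by (auto simp: d_def intro!: int_ring_closed)
    have sum_d: "(\<Sum>l\<le>m. d l * f l) = (r - s * x 1) * f 0 + s * f 1" for f :: "nat \<Rightarrow> 'a"
    proof -
      have "(\<Sum>l\<le>m. d l * f l) = (\<Sum>l\<in>{0, 1}. d l * f l)"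
        using m by (intro sum.mono_neutral_right) (auto simp: d_def)
      thus ?thesis
        by (simp add: d_def)
    qed
    have shift: "lx (\<lambda>l\<in>{..m}. c l + d l) = lx c + r" "ly (\<lambda>l\<in>{..m}. c l + d l) = ly c + s" for c
      using sum_d[of x] sum_d[of y] xy[simplified]
      by (simp_all add: lx_def ly_def distrib_right sum.distrib)
    have mem: "(\<lambda>l\<in>{..m}. c l + d l) \<in> space ?P" if "c \<in> space ?P" for c
      using memO[OF that] dO int_ring_closed(4) by (auto simp: space_polyM)
    have "{c \<in> space ?P. (\<lambda>l\<in>{..m}. c l + d l) \<in> cell r s} = cell 0 0"
      using mem by (auto simp: cell_def shift)
    thus ?thesis
      using polyM_translate[of d, OF dO cell_sets[of r s]] by simp
  qed
  obtain T where T: "is_transversal T (vball 0) (vball (0 + int i))" "finite T" "card T = ?q ^ i"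
    using vball_transversal by blast
  obtain S where S: "is_transversal S (vball 0) (vball (0 + int j))" "finite S" "card S = ?q ^ j"
    using vball_transversal by blast
  note Td = is_transversalD[OF T(1)] and Sd = is_transversalD[OF S(1)]
  have space_eq: "space ?P = (\<Union>p\<in>T \<times> S. cell (fst p) (snd p))"
  proof
    show "space ?P \<subseteq> (\<Union>p\<in>T \<times> S. cell (fst p) (snd p))"
    proof
      fix c assume c: "c \<in> space ?P"
      obtain r where "r \<in> T" "lx c - r \<in> vball (int i)"
        using Td(2)[OF lx_O[OF c]] by auto
      moreover obtain s where "s \<in> S" "ly c - s \<in> vball (int j)"
        using Sd(2)[OF ly_O[OF c]] by auto
      ultimately show "c \<in> (\<Union>p\<in>T \<times> S. cell (fst p) (snd p))"
        using c by (intro UN_I[of "(r, s)"]) (auto simp: cell_def)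
    qed
  qed (auto simp: cell_def)
  have disj: "disjoint_family_on (\<lambda>p. cell (fst p) (snd p)) (T \<times> S)"
    unfolding disjoint_family_on_def
  proof (intro ballI impI)
    fix p p' assume p: "p \<in> T \<times> S" "p' \<in> T \<times> S" "p \<noteq> p'"
    show "cell (fst p) (snd p) \<inter> cell (fst p') (snd p') = {}"
    proof (rule ccontr)
      assume "cell (fst p) (snd p) \<inter> cell (fst p') (snd p') \<noteq> {}"
      then obtain c where c: "c \<in> space ?P" "lx c - fst p \<in> vball (int i)" "ly c - snd p \<in> vball (int j)"
        "lx c - fst p' \<in> vball (int i)" "ly c - snd p' \<in> vball (int j)"
        by (auto simp: cell_def)
      have "fst p = fst p'"
        by (rule is_transversal_unique[OF T(1) lx_O[OF c(1)]]) (use p c in auto)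
      moreover have "snd p = snd p'"
        by (rule is_transversal_unique[OF S(1) ly_O[OF c(1)]]) (use p c in auto)
      ultimately show False
        using p(3) by (simp add: prod_eq_iff)
    qed
  qed
  have "emeasure ?P (space ?P) = (\<Sum>p\<in>T \<times> S. emeasure ?P (cell (fst p) (snd p)))"
    unfolding space_eq using disj cell_sets T(2) S(2) by (intro sum_emeasure[symmetric]) auto
  also have "\<dots> = (\<Sum>p\<in>T \<times> S. emeasure ?P (cell 0 0))"
  proof (intro sum.cong refl cell_eq)
    fix p assume "p \<in> T \<times> S"
    thus "fst p \<in> int_ring v F" "snd p \<in> int_ring v F"
      using Td(1) Sd(1) vball_0 by auto
  qed
  also have "\<dots> = of_nat (?q ^ (i + j)) * emeasure ?P (cell 0 0)"
    using T(3) S(3) by (simp add: card_cartesian_product power_add)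
  finally have "of_nat (?q ^ (i + j)) * emeasure ?P (cell 0 0) = 1"
    using emeasure_space_polyM by simp
  hence "emeasure ?P (cell 0 0) = ennreal (1 / real ?q ^ (i + j))"
    using card_R_pos by (cases "emeasure ?P (cell 0 0)")
      (auto simp: ennreal_of_nat_eq_real_of_nat ennreal_mult_top field_simps simp flip: ennreal_mult ennreal_1)
  thus "emeasure ?P (LE i j) = ennreal (v \<pi> ^ (i + j))"
    unfolding LE_eq by (simp add: unif_val power_one_over)
qed

section \<open>Mean squares of uniformly distributed coordinates\<close>

lemma int_value: "x \<in> int_ring v F \<Longrightarrow> x \<noteq> 0 \<Longrightarrow> \<exists>i. v x = v \<pi> ^ i"
proof -
  assume x: "x \<in> int_ring v F" "x \<noteq> 0"
  then obtain k where k: "v x = v \<pi> powi k"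
    using value_group by (auto simp: int_ring_def)
  hence "0 \<le> k"
    using x(1) powi_le_iff[of k 0] by (simp add: int_ring_def)
  hence "v x = v \<pi> ^ nat k"
    using k by (simp add: power_int_def)
  thus ?thesis ..
qed

lemma pow_le_iff: "v \<pi> ^ i \<le> v \<pi> ^ j \<longleftrightarrow> j \<le> i"
  using powi_le_iff[of "int i" "int j"] by simp

lemma pow_le_Suc: "y \<le> v \<pi> ^ Suc i \<Longrightarrow> y \<le> v \<pi> ^ i"
  using pow_le_iff[of "Suc i" i] by (meson le_SucI order_refl order_trans)

lemma pow_eq_iff: "v \<pi> ^ i = v \<pi> ^ j \<longleftrightarrow> i = j"
  using powi_eq_iff[of "int i" "int j"] by simp

lemma pow_pos: "0 < v \<pi> ^ i"
  by simp

lemma level_iff: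
  assumes "x \<in> int_ring v F"
  shows "v x \<le> v \<pi> ^ i \<and> \<not> v x \<le> v \<pi> ^ Suc i \<longleftrightarrow> v x = v \<pi> ^ i"
proof (cases "x = 0")
  case False
  then obtain k where "v x = v \<pi> ^ k"
    using int_value assms by blast
  thus ?thesis
    unfolding pow_le_iff pow_eq_iff by (simp only: pow_le_iff pow_eq_iff) auto
qed simp

text \<open>The mean of \<open>v U ^ 2\<close> for U uniform on O_F, that is, the sum over i of
  t^(2i) (t^i - t^(i+1)).\<close>

definition val1 :: real
  where "val1 = (1 - v \<pi>) / (1 - v \<pi> ^ 3)"

text \<open>The mean of the squared maximum of \<open>v U\<close> and
  \<open>\<sigma> * t^k * v W\<close> for (U, W) uniform on O_F^2. The first term collects the
  levels i < k of U, where W is unconstrained; the second collects the later levels of U and, with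
  factor \<sigma>^2 t, the levels dominated by W.\<close>

definition val2 :: "nat \<Rightarrow> real"
  where "val2 k = (1 - v \<pi>) * ((1 - v \<pi> ^ (3 * k)) / (1 - v \<pi> ^ 3)
    + v \<pi> ^ (3 * k) * (1 + \<sigma> ^ 2 * v \<pi>) / (1 - v \<pi> ^ 4))"

lemma geometric_pow_sums: "0 < d \<Longrightarrow> (\<lambda>i. (v \<pi> ^ d) ^ i) sums (1 / (1 - v \<pi> ^ d))"
  using unif_less by (intro geometric_sums) (simp add: power_less_one_iff)

text \<open>Exact levels of \<open>v U\<close> are differences of sublevel sets, and by discreteness
  they exhaust everything except U = 0, where the integrand vanishes.\<close>

lemma square_integral:
  assumes U: "\<And>c. c \<in> space P \<Longrightarrow> U c \<in> int_ring v F"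
    and LE: "\<And>i. {c \<in> space P. v (U c) \<le> v \<pi> ^ i} \<in> sets P"
      "\<And>i. emeasure P {c \<in> space P. v (U c) \<le> v \<pi> ^ i} = ennreal (v \<pi> ^ i)"
  shows "has_bochner_integral P (\<lambda>c. v (U c) ^ 2) val1"
proof (rule has_bochner_integral_pieces)
  define L where "L i = {c \<in> space P. v (U c) \<le> v \<pi> ^ i}" for i
  define A where "A i = L i - L (Suc i)" for i
  have A_iff: "c \<in> A i \<longleftrightarrow> c \<in> space P \<and> v (U c) = v \<pi> ^ i" for c i
    using level_iff[OF U] unfolding A_def L_def by blast
  show "disjoint_family A"
    unfolding disjoint_family_on_def
  proof (intro ballI impI)
    fix i j :: nat assume "i \<noteq> j"
    thus "A i \<inter> A j = {}"
      using pow_eq_iff[of i j] by (auto simp: A_iff)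
  qed
  show "has_bochner_integral P (\<lambda>c. indicator (A i) c * v (U c) ^ 2)
      ((v \<pi> ^ i) ^ 2 * (v \<pi> ^ i - v \<pi> ^ Suc i))" for i
  proof -
    have "has_bochner_integral P (\<lambda>c. (v \<pi> ^ i) ^ 2 * indicator (A i) c)
        ((v \<pi> ^ i) ^ 2 * (v \<pi> ^ i - v \<pi> ^ Suc i))"
      unfolding A_def L_def
      by (rule has_bochner_integral_diff_indicator[OF LE(1) LE(1) _ LE(2) LE(2)])
        (blast intro: pow_le_Suc, simp_all)
    moreover have "(\<lambda>c. indicator (A i) c * v (U c) ^ 2) = (\<lambda>c. (v \<pi> ^ i) ^ 2 * indicator (A i) c)"
      by (rule ext) (simp add: indicator_def A_iff)
    ultimately show ?thesis
      by (simp only:)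
  qed
  show "v (U c) ^ 2 = 0" if "c \<in> space P" "c \<notin> (\<Union>i. A i)" for c
    using int_value[OF U[OF that(1)]] that by (auto simp: A_iff)
  have "(\<lambda>i. (1 - v \<pi>) * (v \<pi> ^ 3) ^ i) sums ((1 - v \<pi>) * (1 / (1 - v \<pi> ^ 3)))"
    by (intro sums_mult geometric_pow_sums) simp
  moreover have "(1 - v \<pi>) * (v \<pi> ^ 3) ^ i = (v \<pi> ^ i) ^ 2 * (v \<pi> ^ i - v \<pi> ^ Suc i)" for i
    by (simp add: algebra_simps power2_eq_square power3_eq_cube power_mult_distrib)
  ultimately show "(\<lambda>i. (v \<pi> ^ i) ^ 2 * (v \<pi> ^ i - v \<pi> ^ Suc i)) sums val1"
    by (simp add: val1_def)
qed simp

text \<open>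
  The level sets of the maximum are \<open>v U = t^i, v W \<le> t^(i-k)\<close> and \<open>v W = t^l, v U \<le> t^(k+l+1)\<close>; the
  subtraction \<open>i - k\<close> is deliberately truncated, because \<open>v W \<le> 1\<close> always holds.
\<close>

lemma max_square_integral:
  assumes UW: "\<And>c. c \<in> space P \<Longrightarrow> U c \<in> int_ring v F" "\<And>c. c \<in> space P \<Longrightarrow> W c \<in> int_ring v F"
    and LE: "\<And>i j. {c \<in> space P. v (U c) \<le> v \<pi> ^ i \<and> v (W c) \<le> v \<pi> ^ j} \<in> sets P"
      "\<And>i j. emeasure P {c \<in> space P. v (U c) \<le> v \<pi> ^ i \<and> v (W c) \<le> v \<pi> ^ j} = ennreal (v \<pi> ^ (i + j))"
  shows "has_bochner_integral P (\<lambda>c. max (v (U c)) (\<sigma> * v \<pi> ^ k * v (W c)) ^ 2) (val2 k)"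
proof (rule has_bochner_integral_pieces)
  let ?t = "v \<pi>"
  let ?f = "\<lambda>c. max (v (U c)) (\<sigma> * ?t ^ k * v (W c)) ^ 2"
  define L where "L i j = {c \<in> space P. v (U c) \<le> ?t ^ i \<and> v (W c) \<le> ?t ^ j}" for i j
  define E where "E i = L i (i - k) - L (Suc i) (i - k)" for i
  define G where "G l = L (k + l + 1) l - L (k + l + 1) (Suc l)" for l
  have E_iff: "c \<in> E i \<longleftrightarrow> c \<in> space P \<and> v (U c) = ?t ^ i \<and> v (W c) \<le> ?t ^ (i - k)" for c i
    using level_iff[OF UW(1)] unfolding E_def L_def by blast
  have G_iff: "c \<in> G l \<longleftrightarrow> c \<in> space P \<and> v (W c) = ?t ^ l \<and> v (U c) \<le> ?t ^ (k + l + 1)" for c l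
    using level_iff[OF UW(2)] unfolding G_def L_def by blast
  have EG: "False" if "c \<in> E i" "c \<in> G l" for c i l
  proof -
    have "?t ^ i \<le> ?t ^ (k + l + 1)" "?t ^ l \<le> ?t ^ (i - k)"
      using that by (auto simp: E_iff G_iff)
    hence "k + l + 1 \<le> i" "i - k \<le> l"
      unfolding pow_le_iff .
    thus False by simp
  qed
  have EE: "i = j" if "c \<in> E i" "c \<in> E j" for c i j
    using that pow_eq_iff[of i j] by (simp add: E_iff)
  have GG: "i = j" if "c \<in> G i" "c \<in> G j" for c i j
    using that pow_eq_iff[of i j] by (simp add: G_iff)
  define A where "A i = E i \<union> G i" for i
  show "disjoint_family A"
    unfolding disjoint_family_on_def
  proof (intro ballI impI)
    fix i j :: nat assume "i \<noteq> j"
    thus "A i \<inter> A j = {}"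
      using EE[of _ i j] GG[of _ i j] EG[of _ i j] EG[of _ j i] unfolding A_def by blast
  qed
  have f_E: "?f c = (?t ^ i) ^ 2" if "c \<in> E i" for c i
  proof -
    have "\<sigma> * ?t ^ k * v (W c) \<le> 1 * ?t ^ k * ?t ^ (i - k)"
      using that sigma_le_1 sigma_pos by (intro mult_mono) (auto simp: E_iff)
    also have "\<dots> = ?t ^ (k + (i - k))"
      by (simp add: power_add)
    also have "\<dots> \<le> ?t ^ i"
      unfolding pow_le_iff by simp
    finally show ?thesis
      using that by (simp add: E_iff)
  qed
  have f_G: "?f c = (\<sigma> * ?t ^ k * ?t ^ l) ^ 2" if "c \<in> G l" for c l
  proof -
    have "v (U c) \<le> ?t ^ (k + l + 1)"
      using that by (simp add: G_iff)
    also have "\<dots> = ?t * (?t ^ k * ?t ^ l)"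
      by (simp add: power_add)
    \<comment> \<open>In both cases t is at most \<sigma>, so a U whose value is at most t^(k+l+1)
      cannot exceed the W-term.\<close>
    also have "\<dots> \<le> \<sigma> * (?t ^ k * ?t ^ l)"
      using sigma sqrt_bounds unif_less by (intro mult_right_mono) auto
    finally show ?thesis
      using that by (simp add: G_iff mult.assoc)
  qed
  let ?m = "\<lambda>i. (?t ^ i) ^ 2 * (?t ^ (i + (i - k)) - ?t ^ (Suc i + (i - k)))
      + (\<sigma> * ?t ^ k * ?t ^ i) ^ 2 * (?t ^ (k + i + 1 + i) - ?t ^ (k + i + 1 + Suc i))"
  show "has_bochner_integral P (\<lambda>c. indicator (A i) c * ?f c) (?m i)" for i
  proof -
    have "has_bochner_integral P (\<lambda>c. (?t ^ i) ^ 2 * indicator (E i) c + (\<sigma> * ?t ^ k * ?t ^ i) ^ 2 * indicator (G i) c)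
        (?m i)"
    proof (rule has_bochner_integral_add)
      show "has_bochner_integral P (\<lambda>c. (?t ^ i) ^ 2 * indicator (E i) c)
          ((?t ^ i) ^ 2 * (?t ^ (i + (i - k)) - ?t ^ (Suc i + (i - k))))"
        unfolding E_def L_def
        by (rule has_bochner_integral_diff_indicator[OF LE(1) LE(1) _ LE(2) LE(2)])
          (blast intro: pow_le_Suc, simp_all)
      show "has_bochner_integral P (\<lambda>c. (\<sigma> * ?t ^ k * ?t ^ i) ^ 2 * indicator (G i) c)
          ((\<sigma> * ?t ^ k * ?t ^ i) ^ 2 * (?t ^ (k + i + 1 + i) - ?t ^ (k + i + 1 + Suc i)))"
        unfolding G_def L_def
        by (rule has_bochner_integral_diff_indicator[OF LE(1) LE(1) _ LE(2) LE(2)])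
          (blast intro: pow_le_Suc, simp_all)
    qed
    moreover have "(\<lambda>c. indicator (A i) c * ?f c)
        = (\<lambda>c. (?t ^ i) ^ 2 * indicator (E i) c + (\<sigma> * ?t ^ k * ?t ^ i) ^ 2 * indicator (G i) c)"
    proof (rule ext)
      fix c
      consider "c \<in> E i" | "c \<in> G i" | "c \<notin> E i" "c \<notin> G i"
        by blast
      thus "indicator (A i) c * ?f c
          = (?t ^ i) ^ 2 * indicator (E i) c + (\<sigma> * ?t ^ k * ?t ^ i) ^ 2 * indicator (G i) c"
      proof cases
        case 1
        hence "c \<notin> G i"
          using EG by blast
        thus ?thesis
          using 1 unfolding f_E[OF 1] by (simp add: A_def)
      next
        case 2
        hence "c \<notin> E i"
          using EG by blast
        thus ?thesis
          using 2 unfolding f_G[OF 2] by (simp add: A_def)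
      qed (simp add: A_def)
    qed
    ultimately show ?thesis
      by (simp only:)
  qed
  show "?f c = 0" if c: "c \<in> space P" and not: "c \<notin> (\<Union>i. A i)" for c
  proof -
    have nE: "c \<notin> E i" and nG: "c \<notin> G i" for i
      using not unfolding A_def by auto
    have U0: "U c = 0"
    proof (rule ccontr)
      assume "U c \<noteq> 0"
      then obtain i where i: "v (U c) = ?t ^ i"
        using int_value UW(1)[OF c] by blast
      hence nle: "\<not> v (W c) \<le> ?t ^ (i - k)"
        using nE[of i] c by (simp add: E_iff)
      hence "W c \<noteq> 0"
        using pow_pos[of "i - k"] by auto
      then obtain l where l: "v (W c) = ?t ^ l"
        using int_value UW(2)[OF c] by blast
      hence "l < i - k"
        using nle pow_le_iff[of l "i - k"] by simp
      hence "?t ^ i \<le> ?t ^ (k + l + 1)"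
        unfolding pow_le_iff by simp
      thus False
        using nG[of l] c i l by (simp add: G_iff)
    qed
    have "W c = 0"
    proof (rule ccontr)
      assume "W c \<noteq> 0"
      then obtain l where l: "v (W c) = ?t ^ l"
        using int_value UW(2)[OF c] by blast
      thus False
        using nG[of l] c U0 by (simp add: G_iff)
    qed
    thus ?thesis
      using U0 by simp
  qed
  \<comment> \<open>The contribution of level i of U. The truncated subtraction gives ratio t^3 for
    i < k and ratio t^4 afterwards, so the series splits at k.\<close>
  define g where "g i = (1 - ?t) * ?t ^ (3 * i + (i - k))" for i
  have "(\<lambda>i. (1 - ?t) * ?t ^ (3 * k) * (?t ^ 4) ^ i) sums ((1 - ?t) * ?t ^ (3 * k) * (1 / (1 - ?t ^ 4)))"
    by (intro sums_mult geometric_pow_sums) simp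
  moreover have "(1 - ?t) * ?t ^ (3 * k) * (?t ^ 4) ^ i = g (i + k)" for i
    by (simp add: g_def algebra_simps flip: power_mult power_add)
  moreover have "(\<Sum>i<k. g i) = (1 - ?t) * ((1 - ?t ^ (3 * k)) / (1 - ?t ^ 3))"
  proof -
    have "(\<Sum>i<k. g i) = (1 - ?t) * (\<Sum>i<k. (?t ^ 3) ^ i)"
      unfolding sum_distrib_left by (intro sum.cong) (auto simp: g_def simp flip: power_mult)
    moreover have "?t ^ 3 \<noteq> 1"
      using unif_less power_less_one_iff[of ?t 3] by simp
    hence "(\<Sum>i<k. (?t ^ 3) ^ i) = (1 - (?t ^ 3) ^ k) / (1 - ?t ^ 3)"
      by (simp add: sum_gp_strict)
    ultimately show ?thesis
      by (simp add: power_mult)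
  qed
  ultimately have "g sums ((1 - ?t) * ?t ^ (3 * k) * (1 / (1 - ?t ^ 4)) + (1 - ?t) * ((1 - ?t ^ (3 * k)) / (1 - ?t ^ 3)))"
    using sums_iff_shift[of g k "(1 - ?t) * ?t ^ (3 * k) * (1 / (1 - ?t ^ 4))"] by simp
  moreover have "(\<lambda>i. \<sigma> ^ 2 * (1 - ?t) * ?t ^ (3 * k + 1) * (?t ^ 4) ^ i)
      sums (\<sigma> ^ 2 * (1 - ?t) * ?t ^ (3 * k + 1) * (1 / (1 - ?t ^ 4)))"
    by (intro sums_mult geometric_pow_sums) simp
  ultimately have "(\<lambda>i. g i + \<sigma> ^ 2 * (1 - ?t) * ?t ^ (3 * k + 1) * (?t ^ 4) ^ i)
      sums ((1 - ?t) * ?t ^ (3 * k) * (1 / (1 - ?t ^ 4)) + (1 - ?t) * ((1 - ?t ^ (3 * k)) / (1 - ?t ^ 3))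
        + \<sigma> ^ 2 * (1 - ?t) * ?t ^ (3 * k + 1) * (1 / (1 - ?t ^ 4)))"
    by (rule sums_add)
  moreover have "g i + \<sigma> ^ 2 * (1 - ?t) * ?t ^ (3 * k + 1) * (?t ^ 4) ^ i = ?m i" for i
  proof -
    have 1: "(?t ^ i) ^ 2 * (?t ^ (i + (i - k)) - ?t ^ (Suc i + (i - k))) = g i"
    proof -
      have "?t ^ (3 * i + (i - k)) = (?t ^ i) ^ 2 * ?t ^ (i + (i - k))"
        by (simp add: flip: power_mult power_add)
      thus ?thesis
        unfolding g_def by (simp add: algebra_simps)
    qed
    have "(?t ^ k * ?t ^ i) ^ 2 * ?t ^ (k + i + 1 + i) = ?t ^ (3 * k + 1) * (?t ^ 4) ^ i"
      by (simp add: algebra_simps flip: power_mult power_add)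
    moreover have "(\<sigma> * ?t ^ k * ?t ^ i) ^ 2 * (?t ^ (k + i + 1 + i) - ?t ^ (k + i + 1 + Suc i))
        = \<sigma> ^ 2 * (1 - ?t) * ((?t ^ k * ?t ^ i) ^ 2 * ?t ^ (k + i + 1 + i))"
      by (simp add: algebra_simps power_mult_distrib)
    ultimately show ?thesis
      using 1 by simp
  qed
  ultimately have "?m sums ((1 - ?t) * ?t ^ (3 * k) * (1 / (1 - ?t ^ 4)) + (1 - ?t) * ((1 - ?t ^ (3 * k)) / (1 - ?t ^ 3))
        + \<sigma> ^ 2 * (1 - ?t) * ?t ^ (3 * k + 1) * (1 / (1 - ?t ^ 4)))"
    by simp
  moreover have "(1 - ?t) * ?t ^ (3 * k) * (1 / (1 - ?t ^ 4)) + (1 - ?t) * ((1 - ?t ^ (3 * k)) / (1 - ?t ^ 3))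
        + \<sigma> ^ 2 * (1 - ?t) * ?t ^ (3 * k + 1) * (1 / (1 - ?t ^ 4)) = val2 k"
    by (simp add: val2_def add_divide_distrib distrib_left distrib_right mult_ac)
  ultimately show "?m sums val2 k"
    by simp
qed simp

end

section \<open>The densities\<close>

context quad_haar
begin

text \<open>Powers of z are reduced by its quadratic equation. The factor b stays outside y, so that
  \<open>y 1 = 1\<close> whatever b is; this is the triangular shape that \<open>polyM_cells\<close>
  asks for.\<close>

lemma power_coord:
  assumes "a \<in> int_ring v F" "b \<in> int_ring v F" "z = a + b * \<omega>"
  shows "\<exists>x y. (\<forall>i. x i \<in> int_ring v F \<and> y i \<in> int_ring v F \<and> z ^ i = x i + (y i * b) * \<omega>) \<and>
    x 0 = 1 \<and> y 0 = 0 \<and> y 1 = 1"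
proof -
  obtain c d where cd: "c \<in> int_ring v F" "d \<in> int_ring v F" "z * z = c + d * z"
    using square_int[OF assms] by blast
  define uw where "uw = rec_nat (1, 0) (\<lambda>_ (u, w). (w * c, u + w * d))"
  have uw0: "uw 0 = (1, 0)" and uwS: "uw (Suc i) = (snd (uw i) * c, fst (uw i) + snd (uw i) * d)" for i
    by (simp_all add: uw_def case_prod_beta)
  have uw: "fst (uw i) \<in> int_ring v F \<and> snd (uw i) \<in> int_ring v F \<and> z ^ i = fst (uw i) + snd (uw i) * z" for i
  proof (induction i)
    case 0
    show ?case
      by (simp add: uw0 int_ring_closed)
  next
    case (Suc i)
    have "z ^ Suc i = fst (uw i) * z + snd (uw i) * (z * z)"
      using Suc by (simp add: algebra_simps)
    also have "\<dots> = snd (uw i) * c + (fst (uw i) + snd (uw i) * d) * z"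
      unfolding cd(3) by (simp add: algebra_simps)
    finally show ?case
      using Suc cd(1,2) by (simp add: uwS int_ring_closed(4,6))
  qed
  define x where "x i = fst (uw i) + snd (uw i) * a" for i
  define y where "y i = snd (uw i)" for i
  have "x i \<in> int_ring v F \<and> y i \<in> int_ring v F \<and> z ^ i = x i + (y i * b) * \<omega>" for i
    using uw[of i] assms by (simp add: x_def y_def int_ring_closed(4,6) algebra_simps)
  moreover have "x 0 = 1" "y 0 = 0" "y 1 = 1"
    using uw0 uwS[of 0] by (simp_all add: x_def y_def)
  ultimately show ?thesis
    by blast
qed

text \<open>For m = 0 the polynomial is its constant coefficient, uniform on O_F; neither a second
  coordinate nor z enters.\<close>

lemma poly_integral_0: "(\<integral>c. v (\<Sum>i\<le>0. c i * z ^ i) ^ 2 \<partial>polyM 0) = val1"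
proof -
  let ?P = "polyM 0"
  have int: "v c \<le> v \<pi> ^ i \<longleftrightarrow> c \<in> vball (int i)" if "c \<in> int_ring v F" for c i
    using that by (simp add: vball_def int_ring_def)
  have vsub: "vball (int i) \<subseteq> int_ring v F" for i
    using vball_mono[of 0 "int i"] vball_0 by simp
  have vMO: "vball (int i) \<in> sets MO" for i
    using vball_sets vsub by (simp add: sets_MO)
  have emeas: "emeasure MO (vball (int i)) = ennreal (v \<pi> ^ i)" for i
  proof -
    obtain T where T: "is_transversal T (vball 0) (vball (0 + int i))" "finite T" "card T = card R ^ i"
      using vball_transversal by blast
    have "emeasure lamF (vball 0) = of_nat (card T) * emeasure lamF (vball (0 + int i))"
      by (rule HF.emeasure_transversal[OF T(1,2) vball_add_closed vball_add_closed vball_mono _ vball_sets])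
        (auto simp: vball_def)
    hence "of_nat (card R ^ i) * emeasure lamF (vball (int i)) = 1"
      using T(3) HF.haar by (simp add: vball_0 is_haar_def)
    hence "emeasure lamF (vball (int i)) = ennreal (1 / real (card R) ^ i)"
      using card_R_pos by (cases "emeasure lamF (vball (int i))")
        (auto simp: ennreal_of_nat_eq_real_of_nat ennreal_mult_top field_simps simp flip: ennreal_mult ennreal_1)
    thus ?thesis
      using emeasure_MO[OF vMO] by (simp add: unif_val power_one_over)
  qed
  have LE: "{c \<in> space ?P. v (c 0) \<le> v \<pi> ^ i} = {..0} \<rightarrow>\<^sub>E vball (int i)" for i
  proof (rule Set.set_eqI)
    fix c :: "nat \<Rightarrow> 'a"
    have single: "c \<in> {..0} \<rightarrow>\<^sub>E A \<longleftrightarrow> c 0 \<in> A \<and> c \<in> extensional {..0}" for A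
      by (simp add: PiE_iff)
    show "c \<in> {c \<in> space ?P. v (c 0) \<le> v \<pi> ^ i} \<longleftrightarrow> c \<in> {..0} \<rightarrow>\<^sub>E vball (int i)"
      unfolding mem_Collect_eq space_polyM single using int[of "c 0" i] vsub[of i] by blast
  qed
  have "has_bochner_integral ?P (\<lambda>c. v (c 0) ^ 2) val1"
  proof (rule square_integral)
    show "c 0 \<in> int_ring v F" if "c \<in> space ?P" for c
      using that by (auto simp: space_polyM)
    show "{c \<in> space ?P. v (c 0) \<le> v \<pi> ^ i} \<in> sets ?P" for i
      unfolding LE unfolding poly_measure_def by (intro sets_PiM_I_finite vMO) simp
    have "emeasure ?P ({..0} \<rightarrow>\<^sub>E vball (int i)) = (\<Prod>j\<in>{..0::nat}. emeasure MO (vball (int i)))" for i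
      unfolding poly_measure_def by (rule PO.emeasure_PiM) (simp_all add: vMO)
    thus "emeasure ?P {c \<in> space ?P. v (c 0) \<le> v \<pi> ^ i} = ennreal (v \<pi> ^ i)" for i
      unfolding LE by (simp add: emeas)
  qed
  thus ?thesis
    by (simp add: has_bochner_integral_iff)
qed

lemma poly_integral:
  assumes "a \<in> int_ring v F" "b \<in> int_ring v F" "z = a + b * \<omega>" "v b = v \<pi> ^ k" and m: "1 \<le> m"
  shows "(\<integral>c. v (\<Sum>i\<le>m. c i * z ^ i) ^ 2 \<partial>polyM m) = val2 k"
proof -
  obtain x y where xy: "\<And>i. x i \<in> int_ring v F" "\<And>i. y i \<in> int_ring v F"
    "\<And>i. z ^ i = x i + (y i * b) * \<omega>" "x 0 = 1" "y 0 = 0" "y 1 = 1"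
    using power_coord[OF assms(1-3)] by blast
  let ?U = "\<lambda>c. \<Sum>i\<le>m. c i * x i" and ?W = "\<lambda>c. \<Sum>i\<le>m. c i * y i"
  have O: "?U c \<in> int_ring v F" "?W c \<in> int_ring v F" if c: "c \<in> space (polyM m)" for c
  proof -
    have cO: "c i \<in> vball 0" if "i \<le> m" for i
      using c that by (auto simp: space_polyM vball_0)
    show "?U c \<in> int_ring v F" "?W c \<in> int_ring v F"
      using lin_vball[of m c 0 x] lin_vball[of m c 0 y] cO xy(1,2) by (simp_all add: vball_0)
  qed
  have eq: "v (\<Sum>i\<le>m. c i * z ^ i) ^ 2 = max (v (?U c)) (\<sigma> * v \<pi> ^ k * v (?W c)) ^ 2"
    if c: "c \<in> space (polyM m)" for c
  proof -
    have "(\<Sum>i\<le>m. c i * z ^ i) = ?U c + (?W c * b) * \<omega>"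
      by (simp add: xy(3) distrib_left sum.distrib sum_distrib_right mult.assoc)
    moreover have "?U c \<in> F" "?W c * b \<in> F"
      using O[OF c] assms(2) by (auto simp: int_ring_def mult_mem)
    ultimately have "v (\<Sum>i\<le>m. c i * z ^ i) = max (v (?U c)) (\<sigma> * v (?W c * b))"
      using v_coord by simp
    thus ?thesis
      by (simp add: mult assms(4) mult_ac)
  qed
  have "has_bochner_integral (polyM m) (\<lambda>c. max (v (?U c)) (\<sigma> * v \<pi> ^ k * v (?W c)) ^ 2) (val2 k)"
    by (rule max_square_integral[OF O polyM_cells[of m x y, OF xy(1,2) m xy(4-6)]])
  moreover have "(\<integral>c. v (\<Sum>i\<le>m. c i * z ^ i) ^ 2 \<partial>polyM m)
      = (\<integral>c. max (v (?U c)) (\<sigma> * v \<pi> ^ k * v (?W c)) ^ 2 \<partial>polyM m)"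
    by (rule Bochner_Integration.integral_cong[OF refl eq])
  ultimately show ?thesis
    by (simp add: has_bochner_integral_iff)
qed

definition val :: "nat \<Rightarrow> nat \<Rightarrow> real"
  where "val n k = (if n = 2 then val1 else val2 k)"

text \<open>The factor \<open>v \<pi> ^ k\<close> is the reciprocal of the index q^k of O_F[z], and
  for b = 0 the element z generates only F.\<close>

lemma rho_integral_eq:
  assumes "a \<in> int_ring v F" "b \<in> int_ring v F" "z = a + b * \<omega>" and n: "2 \<le> n"
  shows "b = 0 \<Longrightarrow> rho_integral v F lamF K D n z = 0"
    and "v b = v \<pi> ^ k \<Longrightarrow> rho_integral v F lamF K D n z = v D * v \<pi> ^ k * val n k"
proof -
  have F: "a \<in> F" "b \<in> F"
    using assms by (auto simp: int_ring_def)
  show "rho_integral v F lamF K D n z = 0" if "b = 0"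
    using adjoin_field_iff[OF F assms(3)] that by (simp add: rho_integral_def)
  assume vb: "v b = v \<pi> ^ k"
  hence "b \<noteq> 0"
    by auto
  hence "adjoin F z = K"
    using adjoin_field_iff[OF F assms(3)] by simp
  hence rho: "rho_integral v F lamF K D n z = v D / real (card R ^ k) *
      (\<integral>c. v (\<Sum>i\<le>n - 2. c i * z ^ i) ^ 2 \<partial>polyM (n - 2))"
    using n by (simp add: rho_integral_def ext_degree add_index_adjoin[OF assms(1-3) vb])
  have "(\<integral>c. v (\<Sum>i\<le>n - 2. c i * z ^ i) ^ 2 \<partial>polyM (n - 2)) = val n k"
  proof (cases "n = 2")
    case True
    show ?thesis
      unfolding True val_def using poly_integral_0[of z] by simp
  next
    case False
    thus ?thesis
      using poly_integral[OF assms(1-3) vb, of "n - 2"] n by (simp add: val_def)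
  qed
  thus "rho_integral v F lamF K D n z = v D * v \<pi> ^ k * val n k"
    unfolding rho by (simp add: unif_val power_one_over)
qed

lemma rho_integral_nonneg: "0 \<le> rho_integral v F lamF K D n z"
  unfolding rho_integral_def by (auto intro!: mult_nonneg_nonneg divide_nonneg_nonneg integral_nonneg_AE)

text \<open>The density is summed over levels of the second coordinate b. On \<open>A k\<close>, the
  integral x with \<open>v b = t^k\<close>, it is the constant \<open>r k\<close>; on
  \<open>C k\<close>, the inverses of such elements of the maximal ideal, it is \<open>r k\<close>
  times the weight from \<open>inversion_integral\<close>. For the remaining points, x or its
  inverse has b = 0 and the density vanishes.\<close>

lemma rho_sums:
  assumes n: "2 \<le> n"
    and sums: "(\<lambda>k. v D * v \<pi> ^ k * val n k * ((v \<pi> ^ k - v \<pi> ^ (k + 1)) + (v \<pi> ^ (1 + max (nat \<delta>) k) - v \<pi> ^ (k + 2))))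
      sums S"
  shows "rho v F lamF K lamK D n = S"
proof -
  let ?t = "v \<pi>" and ?f = "rho_density v F lamF K D n"
  define r where "r k = v D * ?t ^ k * val n k" for k
  define A where "A k = box 0 (int k) - box 0 (int k + 1)" for k
  \<comment> \<open>The index \<open>max \<delta> (int k)\<close> intersects level k with
    \<open>max_ideal v K\<close>. In the unramified case \<open>B 0\<close> is thus empty: a unit b
    makes x a unit.\<close>
  define B where "B k = box 1 (max \<delta> (int k)) - box 1 (int k + 1)" for k
  have \<delta>01: "\<delta> = 0 \<or> \<delta> = 1"
    by (simp add: \<delta>_def)
  have level: "v b \<le> ?t powi i \<and> \<not> v b \<le> ?t powi (i + 1) \<longleftrightarrow> v b = ?t powi i" if "b \<in> F" for b i
    using less_iff_le[OF that, of i] by linarith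
  have A_iff: "a + b * \<omega> \<in> A k \<longleftrightarrow> a + b * \<omega> \<in> int_ring v K \<and> v b = ?t ^ k"
    if ab: "a \<in> F" "b \<in> F" for a b k
  proof -
    have "a + b * \<omega> \<in> A k \<longleftrightarrow> v a \<le> 1 \<and> (v b \<le> ?t powi int k \<and> \<not> v b \<le> ?t powi (int k + 1))"
      unfolding A_def Diff_iff mem_box_iff[OF ab] using ab by (simp add: vball_def) blast
    also have "\<dots> \<longleftrightarrow> v a \<le> 1 \<and> v b = ?t ^ k"
      unfolding level[OF ab(2)] by simp
    also have "\<dots> \<longleftrightarrow> a + b * \<omega> \<in> int_ring v K \<and> v b = ?t ^ k"
      unfolding int_ring_K mem_box_iff[OF ab] using ab pow_le_iff[of k 0] by (auto simp: vball_def)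
    finally show ?thesis .
  qed
  have B_iff: "a + b * \<omega> \<in> B k \<longleftrightarrow> a + b * \<omega> \<in> max_ideal v K \<and> v b = ?t ^ k"
    if ab: "a \<in> F" "b \<in> F" for a b k
  proof -
    have mx: "v b \<le> ?t powi max \<delta> (int k) \<longleftrightarrow> v b \<le> ?t powi \<delta> \<and> v b \<le> ?t powi int k"
      using powi_le_iff[of \<delta> "int k"] powi_le_iff[of "int k" \<delta>] by (auto simp: max_def)
    have "a + b * \<omega> \<in> B k \<longleftrightarrow> v a \<le> ?t \<and> v b \<le> ?t powi \<delta> \<and>
        (v b \<le> ?t powi int k \<and> \<not> v b \<le> ?t powi (int k + 1))"
      unfolding B_def Diff_iff mem_box_iff[OF ab] using ab mx by (simp add: vball_def) blast
    also have "\<dots> \<longleftrightarrow> a + b * \<omega> \<in> max_ideal v K \<and> v b = ?t ^ k"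
      unfolding level[OF ab(2)] max_ideal_K mem_box_iff[OF ab] using ab by (auto simp: vball_def)
    finally show ?thesis .
  qed
  have AK: "A k \<subseteq> K" and BK: "B k \<subseteq> K" for k
    using box_subset_K by (auto simp: A_def B_def)
  have A_int: "x \<in> int_ring v K" and f_A: "?f x = r k" if x: "x \<in> A k" for x k
  proof -
    obtain a b where ab: "a \<in> F" "b \<in> F" "x = a + b * \<omega>"
      using x AK by (meson K_cases subsetD)
    have *: "x \<in> int_ring v K" "v b = ?t ^ k"
      using A_iff[OF ab(1,2)] x ab(3) by auto
    thus "x \<in> int_ring v K"
      by simp
    have "a \<in> int_ring v F" "b \<in> int_ring v F"
      using *(1) unfolding int_ring_K ab(3) mem_box_iff[OF ab(1,2)] vball_0 by auto
    thus "?f x = r k"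
      using rho_integral_eq(2)[OF _ _ ab(3) n *(2)] *(1) by (simp add: rho_density_def r_def)
  qed
  have B_max: "v x < 1" "x \<in> int_ring v K" "\<sigma> * ?t ^ k \<le> v x" and f_B: "rho_integral v F lamF K D n x = r k"
    if x: "x \<in> B k" for x k
  proof -
    obtain a b where ab: "a \<in> F" "b \<in> F" "x = a + b * \<omega>"
      using x BK by (meson K_cases subsetD)
    have *: "x \<in> max_ideal v K" "v b = ?t ^ k"
      using B_iff[OF ab(1,2)] x ab(3) by auto
    thus "v x < 1" and xO: "x \<in> int_ring v K"
      by (auto simp: max_ideal_def int_ring_def)
    show "\<sigma> * ?t ^ k \<le> v x"
      unfolding ab(3) v_coord[OF ab(1,2)] *(2) by simp
    have "a \<in> int_ring v F" "b \<in> int_ring v F"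
      using xO unfolding int_ring_K ab(3) mem_box_iff[OF ab(1,2)] vball_0 by auto
    thus "rho_integral v F lamF K D n x = r k"
      using rho_integral_eq(2)[OF _ _ ab(3) n *(2)] by (simp add: r_def)
  qed
  \<comment> \<open>On level k the value is at least \<sigma> t^k, hence at least t^(k+1); balls of
    radius t^(k+2) around such points avoid 0.\<close>
  have B_big: "?t ^ (k + 2) < v x" if "x \<in> B k" for x k
  proof -
    have "?t ^ (k + 2) < ?t ^ (k + 1)"
      using pow_le_iff[of "k + 1" "k + 2"] by linarith
    also have "?t ^ (k + 1) = ?t * ?t ^ k"
      by simp
    also have "\<dots> \<le> \<sigma> * ?t ^ k"
      using sigma sqrt_bounds unif_less by (intro mult_right_mono) auto
    also have "\<dots> \<le> v x"
      by (rule B_max(3)[OF that])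
    finally show ?thesis .
  qed
  define C where "C k = inverse ` B k" for k
  have C_out: "x \<notin> int_ring v K" and f_C: "?f x = v x powi (-4) * r k" if x: "x \<in> C k" for x k
  proof -
    obtain y where y: "y \<in> B k" "x = inverse y"
      using x unfolding C_def by blast
    have "0 < v y"
      using B_big[OF y(1)] pow_pos[of "k + 2"] by linarith
    hence "1 < v x"
      unfolding y(2) inverse using B_max(1)[OF y(1)] by (simp add: one_less_inverse del: pos_iff)
    thus out: "x \<notin> int_ring v K"
      by (simp add: int_ring_def)
    show "?f x = v x powi (-4) * r k"
      using out f_B[OF y(1)] y(2) by (simp add: rho_density_def ext_degree)
  qed
  have A_disj: "i = j" if x: "x \<in> A i" "x \<in> A j" for x i j
  proof -
    obtain a b where ab: "a \<in> F" "b \<in> F" "x = a + b * \<omega>"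
      using x(1) AK by (meson K_cases subsetD)
    hence "?t ^ i = ?t ^ j"
      using A_iff[OF ab(1,2)] x by auto
    thus ?thesis
      unfolding pow_eq_iff .
  qed
  have B_disj: "i = j" if x: "x \<in> B i" "x \<in> B j" for x i j
  proof -
    obtain a b where ab: "a \<in> F" "b \<in> F" "x = a + b * \<omega>"
      using x(1) BK by (meson K_cases subsetD)
    hence "?t ^ i = ?t ^ j"
      using B_iff[OF ab(1,2)] x by auto
    thus ?thesis
      unfolding pow_eq_iff .
  qed
  have C_disj: "i = j" if x: "x \<in> C i" "x \<in> C j" for x i j
  proof -
    have "inverse x \<in> B i" "inverse x \<in> B j"
      using x by (auto simp: C_def)
    thus ?thesis
      by (rule B_disj)
  qed
  have "has_bochner_integral lamK ?f S"
  proof (rule has_bochner_integral_pieces)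
    show "disjoint_family (\<lambda>k. A k \<union> C k)"
      unfolding disjoint_family_on_def
    proof (intro ballI impI)
      fix i j :: nat assume "i \<noteq> j"
      thus "(A i \<union> C i) \<inter> (A j \<union> C j) = {}"
        using A_disj[of _ i j] C_disj[of _ i j] A_int[of _ i] A_int[of _ j] C_out[of _ i] C_out[of _ j] by blast
    qed
    show "0 \<le> ?f x" for x
      by (simp add: rho_density_def rho_integral_nonneg)
    show "?f x = 0" if x: "x \<in> space lamK" and not: "x \<notin> (\<Union>k. A k \<union> C k)" for x
    proof (cases "x \<in> int_ring v K")
      case True
      have xK: "x \<in> K"
        using True by (simp add: int_ring_def)
      obtain a b where ab: "a \<in> F" "b \<in> F" "x = a + b * \<omega>"
        by (rule K_cases[OF xK])
      have O: "a \<in> int_ring v F" "b \<in> int_ring v F"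
        using True unfolding int_ring_K ab(3) mem_box_iff[OF ab(1,2)] vball_0 by auto
      have "b = 0"
      proof (rule ccontr)
        assume "b \<noteq> 0"
        then obtain k where "v b = ?t ^ k"
          using int_value[OF O(2)] by blast
        hence "x \<in> A k"
          using A_iff[OF ab(1,2)] True ab(3) by simp
        thus False
          using not by blast
      qed
      thus ?thesis
        using rho_integral_eq(1)[OF O ab(3) n] True by (simp add: rho_density_def)
    next
      case False
      define y where "y = inverse x"
      have xK: "x \<in> K"
        using x by (simp add: HK.space_M)
      hence yK: "y \<in> K"
        by (simp add: y_def ext.inverse_mem)
      have "1 < v x"
        using False xK by (simp add: int_ring_def)
      hence "v y < 1"
        unfolding y_def inverse by (simp add: inverse_less_1_iff)
      hence ymax: "y \<in> max_ideal v K" and yO: "y \<in> int_ring v K"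
        using yK by (auto simp: max_ideal_def int_ring_def)
      obtain a b where ab: "a \<in> F" "b \<in> F" "y = a + b * \<omega>"
        by (rule K_cases[OF yK])
      have O: "a \<in> int_ring v F" "b \<in> int_ring v F"
        using yO unfolding int_ring_K ab(3) mem_box_iff[OF ab(1,2)] vball_0 by auto
      have "b = 0"
      proof (rule ccontr)
        assume "b \<noteq> 0"
        then obtain k where "v b = ?t ^ k"
          using int_value[OF O(2)] by blast
        hence "y \<in> B k"
          using B_iff[OF ab(1,2)] ymax ab(3) by simp
        hence "x \<in> C k"
          unfolding C_def y_def by (metis image_eqI inverse_inverse_eq)
        thus False
          using not by blast
      qed
      thus ?thesis
        using rho_integral_eq(1)[OF O ab(3) n] False by (simp add: rho_density_def y_def)
    qed
    let ?m = "\<lambda>k. r k * (?t ^ k - ?t ^ (k + 1)) + r k * (?t ^ (1 + max (nat \<delta>) k) - ?t ^ (k + 2))"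
    show "?m sums S"
      using sums by (simp add: r_def distrib_left)
    show "has_bochner_integral lamK (\<lambda>x. indicator (A k \<union> C k) x * ?f x) (?m k)" for k
    proof -
      have pw: "?t powi (0 + int k) = ?t ^ k" "?t powi (0 + (int k + 1)) = ?t ^ (k + 1)"
        "?t powi (1 + max \<delta> (int k)) = ?t ^ (1 + max (nat \<delta>) k)" "?t powi (1 + (int k + 1)) = ?t ^ (k + 2)"
      proof -
        have "1 + max \<delta> (int k) = int (1 + max (nat \<delta>) k)" "0 + (int k + 1) = int (k + 1)"
          "1 + (int k + 1) = int (k + 2)"
          using \<delta>01 by auto
        thus "?t powi (0 + int k) = ?t ^ k" "?t powi (0 + (int k + 1)) = ?t ^ (k + 1)"
          "?t powi (1 + max \<delta> (int k)) = ?t ^ (1 + max (nat \<delta>) k)" "?t powi (1 + (int k + 1)) = ?t ^ (k + 2)"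
          by (simp_all only: power_int_of_nat add_0)
      qed
      have le: "max \<delta> (int k) \<le> int k + 1"
        using \<delta>01 by auto
      have intA: "has_bochner_integral lamK (\<lambda>x. r k * indicator (A k) x) (r k * (?t ^ k - ?t ^ (k + 1)))"
        unfolding A_def
        by (rule has_bochner_integral_diff_indicator[OF box_sets box_sets box_mono _ _])
          (simp_all only: emeasure_box pw, simp_all)
      have "has_bochner_integral lamK (\<lambda>x. 1 * indicator (B k) x) (1 * (?t ^ (1 + max (nat \<delta>) k) - ?t ^ (k + 2)))"
        unfolding B_def
        by (rule has_bochner_integral_diff_indicator[OF box_sets box_sets box_mono[OF order_refl le] _ _])
          (simp_all only: emeasure_box pw, simp_all)
      hence "integral\<^sup>L lamK (indicator (B k)) = ?t ^ (1 + max (nat \<delta>) k) - ?t ^ (k + 2)"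
        by (simp add: has_bochner_integral_iff)
      moreover have "B k \<inter> space lamK = B k"
        using BK by (auto simp: HK.space_M)
      ultimately have measB: "measure lamK (B k) = ?t ^ (1 + max (nat \<delta>) k) - ?t ^ (k + 2)"
        by simp
      have "has_bochner_integral lamK (\<lambda>x. indicator (inverse ` B k) x * v x powi (-4)) (measure lamK (B k))"
      \<comment> \<open>Perturbations of size t^(k+2) preserve both boxes that cut out
        \<open>B k\<close>, whose indices are at most k + 1, and stay below every value taken on
        \<open>B k\<close>.\<close>
      proof (rule inversion_integral[where N = "k + 2"])
        show "B k \<subseteq> int_ring v K"
          using B_max(2) by blast
        show "?t ^ (k + 2) < v x" if "x \<in> B k" for x
          by (rule B_big[OF that])
        fix x y assume x: "x \<in> B k" and y: "y \<in> K" and xy: "v (y - x) \<le> ?t ^ (k + 2)"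
        have bd: "v (y - x) \<le> ?t powi i" "v (x - y) \<le> ?t powi i" if "i \<le> int k + 2" for i
        proof -
          have "?t ^ (k + 2) \<le> ?t powi i"
            using powi_le_iff[of "int (k + 2)" i] that unfolding power_int_of_nat by simp
          thus "v (y - x) \<le> ?t powi i" "v (x - y) \<le> ?t powi i"
            using xy by (simp_all add: minus_commute[of x y])
        qed
        have xK: "x \<in> K"
          using x BK by blast
        have "y \<in> box 1 (max \<delta> (int k))"
          using x le by (intro box_absorb[OF _ y bd(2)]) (auto simp: B_def)
        moreover have "y \<notin> box 1 (int k + 1)"
        proof
          assume "y \<in> box 1 (int k + 1)"
          hence "x \<in> box 1 (int k + 1)"
            by (rule box_absorb[OF _ xK bd(1)]) simp
          thus False
            using x by (simp add: B_def)
        qed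
        ultimately show "y \<in> B k"
          by (simp add: B_def)
      qed
      hence "has_bochner_integral lamK (\<lambda>x. r k * (indicator (C k) x * v x powi (-4)))
          (r k * (?t ^ (1 + max (nat \<delta>) k) - ?t ^ (k + 2)))"
        unfolding C_def measB by (intro has_bochner_integral_mult_right) auto
      from has_bochner_integral_add[OF intA this]
      have "has_bochner_integral lamK (\<lambda>x. r k * indicator (A k) x + r k * (indicator (C k) x * v x powi (-4))) (?m k)" .
      moreover have "(\<lambda>x. indicator (A k \<union> C k) x * ?f x)
          = (\<lambda>x. r k * indicator (A k) x + r k * (indicator (C k) x * v x powi (-4)))"
      proof (rule ext)
        fix x
        consider "x \<in> A k" | "x \<in> C k" | "x \<notin> A k" "x \<notin> C k"
          by blast
        thus "indicator (A k \<union> C k) x * ?f x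
            = r k * indicator (A k) x + r k * (indicator (C k) x * v x powi (-4))"
        proof cases
          case 1
          hence "x \<notin> C k"
            using A_int C_out by blast
          thus ?thesis
            using 1 f_A[OF 1] by simp
        next
          case 2
          hence "x \<notin> A k"
            using A_int C_out by blast
          thus ?thesis
            using 2 f_C[OF 2] by simp
        qed simp
      qed
      ultimately show ?thesis
        by (simp only:)
    qed
  qed
  thus ?thesis
    by (simp add: rho_def has_bochner_integral_iff)
qed

text \<open>The masses of \<open>A k\<close> and \<open>B k\<close> add up to t^k (1 - t^2), except
  that \<open>B 0\<close> is empty in the unramified case; the subtracted term is the mass t (1 - t)
  missing there. The ratio t^2 combines this mass with the reciprocal of the index.\<close>

lemma rho_eq_of_sums:
  assumes n: "2 \<le> n" and sums: "(\<lambda>k. (v \<pi> ^ 2) ^ k * val n k) sums S"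
  shows "rho v F lamF K lamK D n
    = v D * ((1 - v \<pi> ^ 2) * S - of_int \<delta> * (1 - v \<pi>) * v \<pi> * val n 0)"
proof (rule rho_sums[OF n])
  let ?t = "v \<pi>"
  let ?c = "v D * (of_int \<delta> * (1 - ?t) * ?t * val n 0)"
  have "(\<lambda>k. v D * (1 - ?t ^ 2) * ((?t ^ 2) ^ k * val n k) - (if k = 0 then ?c else 0))
      sums (v D * (1 - ?t ^ 2) * S - ?c)"
    using sums_single[of 0 "\<lambda>_. ?c"] by (intro sums_diff sums_mult sums) simp
  moreover have "v D * (1 - ?t ^ 2) * ((?t ^ 2) ^ k * val n k) - (if k = 0 then ?c else 0)
      = v D * ?t ^ k * val n k * ((?t ^ k - ?t ^ (k + 1)) + (?t ^ (1 + max (nat \<delta>) k) - ?t ^ (k + 2)))" for k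
  proof -
    have sq: "(?t ^ 2) ^ k = ?t ^ k * ?t ^ k"
      by (simp add: power2_eq_square power_mult_distrib)
    have \<delta>01: "\<delta> = 0 \<or> \<delta> = 1"
      by (simp add: \<delta>_def)
    show ?thesis
    proof (cases "k = 0 \<and> \<delta> = 1")
      case True
      thus ?thesis
        by (simp add: power2_eq_square algebra_simps)
    next
      case False
      hence "max (nat \<delta>) k = k" "(if k = 0 then ?c else 0) = 0"
        using \<delta>01 by auto
      thus ?thesis
        unfolding sq by (simp add: power2_eq_square algebra_simps)
    qed
  qed
  ultimately show "(\<lambda>k. v D * ?t ^ k * val n k *
      ((?t ^ k - ?t ^ (k + 1)) + (?t ^ (1 + max (nat \<delta>) k) - ?t ^ (k + 2))))
      sums (v D * ((1 - ?t ^ 2) * S - of_int \<delta> * (1 - ?t) * ?t * val n 0))"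
    by (simp add: right_diff_distrib mult_ac)
qed

section \<open>Summation over the levels and closed forms\<close>

lemma val_2_sums: "(\<lambda>k. (v \<pi> ^ 2) ^ k * val 2 k) sums (1 / (1 - v \<pi> ^ 2) * val1)"
  using sums_mult2[OF geometric_pow_sums[of 2], of val1] by (simp add: val_def)

text \<open>The parts of \<open>val2 k\<close> in t^(3k) combine with the t^(2k) of the level to
  ratio t^5, the source of the denominator 1 + t + t^2 + t^3 + t^4.\<close>

lemma val_ge_3_sums:
  assumes "3 \<le> n"
  shows "(\<lambda>k. (v \<pi> ^ 2) ^ k * val n k) sums
    ((1 - v \<pi>) * ((1 / (1 - v \<pi> ^ 2) - 1 / (1 - v \<pi> ^ 5)) / (1 - v \<pi> ^ 3)
      + (1 + \<sigma> ^ 2 * v \<pi>) / (1 - v \<pi> ^ 4) * (1 / (1 - v \<pi> ^ 5))))"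
proof -
  let ?t = "v \<pi>"
  have "(\<lambda>k. (1 - ?t) * (((?t ^ 2) ^ k - (?t ^ 5) ^ k) / (1 - ?t ^ 3)
        + (1 + \<sigma> ^ 2 * ?t) / (1 - ?t ^ 4) * (?t ^ 5) ^ k)) sums
    ((1 - ?t) * ((1 / (1 - ?t ^ 2) - 1 / (1 - ?t ^ 5)) / (1 - ?t ^ 3)
      + (1 + \<sigma> ^ 2 * ?t) / (1 - ?t ^ 4) * (1 / (1 - ?t ^ 5))))"
    by (intro sums_mult sums_add sums_divide sums_diff geometric_pow_sums) simp_all
  moreover have "(1 - ?t) * (((?t ^ 2) ^ k - (?t ^ 5) ^ k) / (1 - ?t ^ 3)
        + (1 + \<sigma> ^ 2 * ?t) / (1 - ?t ^ 4) * (?t ^ 5) ^ k) = (?t ^ 2) ^ k * val n k" for k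
  proof -
    have 5: "(?t ^ 5) ^ k = (?t ^ 2) ^ k * ?t ^ (3 * k)"
      by (simp flip: power_mult power_add)
    show ?thesis
      using assms unfolding 5 val_def val2_def
      by (simp add: diff_divide_distrib add_divide_distrib distrib_left distrib_right right_diff_distrib
          left_diff_distrib mult_ac)
  qed
  ultimately show ?thesis
    by simp
qed

lemma one_minus_pow:
  "1 - v \<pi> ^ 2 = (1 - v \<pi>) * (1 + v \<pi>)" "1 - v \<pi> ^ 3 = (1 - v \<pi>) * (1 + v \<pi> + v \<pi> ^ 2)"
  "1 - v \<pi> ^ 4 = (1 - v \<pi>) * ((1 + v \<pi>) * (1 + v \<pi> ^ 2))"
  "1 - v \<pi> ^ 5 = (1 - v \<pi>) * (1 + v \<pi> + v \<pi> ^ 2 + v \<pi> ^ 3 + v \<pi> ^ 4)"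
  by (simp_all add: algebra_simps power2_eq_square power3_eq_cube eval_nat_numeral)

lemma denominators_pos:
  "0 < 1 - v \<pi>" "0 < 1 + v \<pi>" "0 < 1 + v \<pi> ^ 2" "0 < 1 + v \<pi> + v \<pi> ^ 2"
  "0 < 1 + v \<pi> + v \<pi> ^ 2 + v \<pi> ^ 3 + v \<pi> ^ 4"
  using unif_less unif_gt_0 by (auto intro!: add_pos_nonneg)

text \<open>\<open>val 2 k\<close> is constant in k, so the factor 1 - t^2 cancels against the
  geometric series and \<open>val1\<close> remains.\<close>

lemma rho_2:
  "rho v F lamF K lamK D 2 = v D * ((1 - of_int \<delta> * v \<pi> * (1 - v \<pi>)) / (1 + v \<pi> + v \<pi> ^ 2))"
proof -
  let ?t = "v \<pi>"
  have a: "1 - ?t \<noteq> 0" "1 + ?t \<noteq> 0" "1 + ?t + ?t ^ 2 \<noteq> 0"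
    using denominators_pos by auto
  have "val1 = 1 / (1 + ?t + ?t ^ 2)"
    unfolding val1_def one_minus_pow using a by simp
  moreover have "(1 - ?t ^ 2) * (1 / (1 - ?t ^ 2) * val1) = val1"
    unfolding one_minus_pow using a by simp
  ultimately show ?thesis
    using rho_eq_of_sums[OF order_refl val_2_sums]
    by (simp add: val_def diff_divide_distrib mult_ac)
qed

lemma rho_ge_3:
  assumes "3 \<le> n"
  shows "rho v F lamF K lamK D n = v D *
    ((v \<pi> ^ 2 + (1 + \<sigma> ^ 2 * v \<pi>) / (1 + v \<pi> ^ 2)) / (1 + v \<pi> + v \<pi> ^ 2 + v \<pi> ^ 3 + v \<pi> ^ 4)
      - of_int \<delta> * (1 - v \<pi>) * v \<pi> * ((1 + \<sigma> ^ 2 * v \<pi>) / ((1 + v \<pi>) * (1 + v \<pi> ^ 2))))"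
proof -
  let ?t = "v \<pi>"
  define a2 a3 a4 a5 s where "a2 = 1 + ?t" and "a3 = 1 + ?t + ?t ^ 2" and "a4 = 1 + ?t ^ 2"
    and "a5 = 1 + ?t + ?t ^ 2 + ?t ^ 3 + ?t ^ 4" and "s = 1 + \<sigma> ^ 2 * ?t"
  have nz: "1 - ?t \<noteq> 0" "a2 \<noteq> 0" "a3 \<noteq> 0" "a4 \<noteq> 0" "a5 \<noteq> 0"
    using denominators_pos by (auto simp: a2_def a3_def a4_def a5_def)
  have n: "2 \<le> n"
    using assms by simp
  have v0: "val n 0 = s / (a2 * a4)"
    using assms nz unfolding val_def val2_def one_minus_pow by (simp add: a2_def a4_def s_def)
  \<comment> \<open>This identity removes the denominator 1 + t + t^2, which enters through 1 -
    t^3.\<close>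
  have num: "a5 - a2 = ?t ^ 2 * a3"
    by (simp add: a2_def a3_def a5_def power2_eq_square power3_eq_cube eval_nat_numeral algebra_simps)
  have frac: "1 / (w * x) - 1 / (w * y) = (y - x) / (w * (x * y))"
    if "w \<noteq> 0" "x \<noteq> 0" "y \<noteq> 0" for w x y :: real
    using that by (simp add: field_simps)
  have "1 / ((1 - ?t) * a2) - 1 / ((1 - ?t) * a5) = (a5 - a2) / ((1 - ?t) * (a2 * a5))"
    by (rule frac[OF nz(1,2,5)])
  also have "\<dots> / ((1 - ?t) * a3) = ?t ^ 2 / ((1 - ?t) ^ 2 * (a2 * a5))"
    unfolding num using nz by (simp add: power2_eq_square)
  finally have e1: "(1 / ((1 - ?t) * a2) - 1 / ((1 - ?t) * a5)) / ((1 - ?t) * a3) = ?t ^ 2 / ((1 - ?t) ^ 2 * (a2 * a5))" .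
  have key: "(w * a2) * (w * (x / (w ^ 2 * (a2 * a5)) + s / (w * (a2 * a4)) * (1 / (w * a5))))
      = (x + s / a4) / a5" if "w \<noteq> 0" for w x
  proof -
    have key: "(w * a2) * (w * (x / (w ^ 2 * (a2 * a5)))) = x / a5"
      using that nz(2) by (simp add: power2_eq_square)
    moreover have "(w * a2) * (w * (s / (w * (a2 * a4)) * (1 / (w * a5)))) = s / a4 / a5"
      using that nz(2) by simp
    ultimately show ?thesis
      unfolding distrib_left[of w] distrib_left[of "w * a2"] add_divide_distrib by (simp only:)
  qed
  show ?thesis
    unfolding rho_eq_of_sums[OF n val_ge_3_sums[OF assms], of D] one_minus_pow v0
    unfolding a5_def[symmetric] s_def[symmetric]
    unfolding a3_def[symmetric] a4_def[symmetric]
    unfolding a2_def[symmetric]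
    unfolding e1 key[OF nz(1)] ..
qed

end

theorem theoremC:
  fixes p :: nat and Qp F K :: "'a::field_char_0 set" and v :: "'a \<Rightarrow> real"
    and lamF lamK :: "'a measure" and D :: 'a and q :: nat
  assumes "padic_setting p Qp F v"
    and "q = residue_card v F"
    and "subfield K ambient" and "F \<subseteq> K" and "ring.dimension ambient 2 F K"
    and "is_haar v F lamF" and "is_haar v K lamK"
    and "is_discriminant v F K D"
  shows "(unramified v F K \<longrightarrow>
            rho v F lamF K lamK D 2 = (real q ^ 2 - real q + 1) / (real q ^ 2 + real q + 1) \<and>
            (\<forall>n\<ge>3. rho v F lamF K lamK D n
               = (real q ^ 4 + 1) / (real q ^ 4 + real q ^ 3 + real q ^ 2 + real q + 1))) \<and>
         (totally_ramified v F K \<longrightarrow>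
            rho v F lamF K lamK D 2 = v D * (real q ^ 2 / (real q ^ 2 + real q + 1)) \<and>
            (\<forall>n\<ge>3. rho v F lamF K lamK D n
               = v D * (real q ^ 2 * (real q ^ 2 + 1)
                   / (real q ^ 4 + real q ^ 3 + real q ^ 2 + real q + 1))))"
proof -
  interpret padic p Qp F v
    by (rule padic.intro[OF assms(1)])
  obtain \<pi> R where R: "disc_val v F \<pi> R" "card R = q" "v \<pi> = 1 / real q"
    using disc_val_exists assms(2) by metis
  interpret dv: disc_val v F \<pi> R
    by (rule R(1))
  interpret qe: quad_ext v F \<pi> R K
    using R(1) assms(3-5) by (simp add: quad_ext_def quad_ext_axioms_def sub_field_def)
  have q: "real q > 0"
    using dv.unif_gt_0(1) R(3) by (metis div_by_0 less_irrefl of_nat_0_less_iff of_nat_0 gr0I)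
  have den: "1 + v \<pi> + v \<pi> ^ 2 = (real q ^ 2 + real q + 1) / real q ^ 2"
    "1 + v \<pi> + v \<pi> ^ 2 + v \<pi> ^ 3 + v \<pi> ^ 4
      = (real q ^ 4 + real q ^ 3 + real q ^ 2 + real q + 1) / real q ^ 4"
  proof -
    have "real q ^ 3 / real q ^ 4 = 1 / real q" "real q ^ 2 / real q ^ 4 = 1 / real q ^ 2"
      "real q / real q ^ 4 = 1 / real q ^ 3" "real q / real q ^ 2 = 1 / real q"
      using q by (simp_all add: eval_nat_numeral)
    thus "1 + v \<pi> + v \<pi> ^ 2 = (real q ^ 2 + real q + 1) / real q ^ 2"
      "1 + v \<pi> + v \<pi> ^ 2 + v \<pi> ^ 3 + v \<pi> ^ 4
      = (real q ^ 4 + real q ^ 3 + real q ^ 2 + real q + 1) / real q ^ 4"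
      using q unfolding R(3) power_one_over add_divide_distrib by simp_all
  qed
  have haar: "haar v F lamF" "haar v K lamK"
    using assms(3,6,7) nonarch subfield
    by (simp_all add: haar_def haar_axioms_def nonarch_def sub_field_def)
  show ?thesis
  proof (intro conjI impI)
    assume unram: "unramified v F K"
    \<comment> \<open>The hypothesis on D supplies the integral basis from which \<omega> is
      built.\<close>
    obtain e where "is_basis (int_ring v F) (int_ring v K) 2 e"
      using assms(8) unfolding is_discriminant_def qe.ext_degree by blast
    then obtain \<omega> where \<omega>: "\<omega> \<in> K" "\<And>a b. a \<in> F \<Longrightarrow> b \<in> F \<Longrightarrow> v (a + b * \<omega>) = max (v a) (v b)"
      using qe.unramified_generator[OF unram] by blast
    have vD: "v D = 1"
      by (rule qe.unramified_discriminant[OF \<omega> assms(8)])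
    have "quad v F \<pi> R K \<omega> 1"
      using qe.quad_ext_axioms \<omega> R(2,3) by (simp add: quad_def quad_axioms_def)
    then interpret quad_haar v F \<pi> R K \<omega> 1 lamF lamK
      using haar by (simp add: quad_haar_def)
    have \<delta>: "\<delta> = 1"
      by (rule delta(1)) simp
    have "rho v F lamF K lamK D 2 = (1 - v \<pi> * (1 - v \<pi>)) / (1 + v \<pi> + v \<pi> ^ 2)"
      unfolding rho_2 \<delta> vD by simp
    also have "1 - v \<pi> * (1 - v \<pi>) = (real q ^ 2 - real q + 1) / real q ^ 2"
      unfolding R(3) using q by (simp add: field_simps power2_eq_square)
    finally show "rho v F lamF K lamK D 2 = (real q ^ 2 - real q + 1) / (real q ^ 2 + real q + 1)"
      unfolding den(1) using q by simp
    show "\<forall>n\<ge>3. rho v F lamF K lamK D n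
        = (real q ^ 4 + 1) / (real q ^ 4 + real q ^ 3 + real q ^ 2 + real q + 1)"
    proof (intro allI impI)
      fix n :: nat assume n: "3 \<le> n"
      let ?t = "v \<pi>" and ?a5 = "1 + v \<pi> + v \<pi> ^ 2 + v \<pi> ^ 3 + v \<pi> ^ 4"
      have frac: "x / a / b - y * (1 / a) = (x - y * b) / (a * b)" if "a \<noteq> 0" "b \<noteq> 0" for a b x y :: real
        using that by (simp add: field_simps)
      have nz: "1 + ?t \<noteq> 0" "1 + ?t ^ 2 \<noteq> 0" "?a5 \<noteq> 0"
        using denominators_pos by auto
      have "rho v F lamF K lamK D n
          = (?t ^ 2 + (1 + ?t) / (1 + ?t ^ 2)) / ?a5 - (1 - ?t) * ?t * ((1 + ?t) / ((1 + ?t) * (1 + ?t ^ 2)))"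
        unfolding rho_ge_3[OF n] \<delta> vD by simp
      also have "(1 + ?t) / ((1 + ?t) * (1 + ?t ^ 2)) = 1 / (1 + ?t ^ 2)"
        using nz by simp
      also have "?t ^ 2 + (1 + ?t) / (1 + ?t ^ 2) = (?t ^ 2 * (1 + ?t ^ 2) + (1 + ?t)) / (1 + ?t ^ 2)"
        using nz by (simp add: field_simps)
      also have "\<dots> / ?a5 - (1 - ?t) * ?t * (1 / (1 + ?t ^ 2))
          = (?t ^ 2 * (1 + ?t ^ 2) + (1 + ?t) - (1 - ?t) * ?t * ?a5) / ((1 + ?t ^ 2) * ?a5)"
        by (rule frac[OF nz(2,3)])
      \<comment> \<open>The numerator telescopes to 1 + t^2 + t^4 + t^6, and its factor 1 + t^2
        cancels the extra denominator.\<close>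
      also have "?t ^ 2 * (1 + ?t ^ 2) + (1 + ?t) - (1 - ?t) * ?t * ?a5 = (1 + ?t ^ 2) * (1 + ?t ^ 4)"
        by (simp add: algebra_simps eval_nat_numeral)
      also have "\<dots> / ((1 + ?t ^ 2) * ?a5) = (1 + ?t ^ 4) / ?a5"
        using nz by simp
      also have "1 + ?t ^ 4 = (real q ^ 4 + 1) / real q ^ 4"
        unfolding R(3) using q by (simp add: field_simps)
      finally show "rho v F lamF K lamK D n
          = (real q ^ 4 + 1) / (real q ^ 4 + real q ^ 3 + real q ^ 2 + real q + 1)"
        unfolding den(2) using q by simp
    qed
  next
    assume ram: "totally_ramified v F K"
    obtain \<omega> where \<omega>: "\<omega> \<in> K"
      "\<And>a b. a \<in> F \<Longrightarrow> b \<in> F \<Longrightarrow> v (a + b * \<omega>) = max (v a) (sqrt (v \<pi>) * v b)"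
      using qe.ramified_generator[OF ram] by blast
    have "quad v F \<pi> R K \<omega> (sqrt (v \<pi>))"
      using qe.quad_ext_axioms \<omega> R(2,3) by (simp add: quad_def quad_axioms_def)
    then interpret quad_haar v F \<pi> R K \<omega> "sqrt (v \<pi>)" lamF lamK
      using haar by (simp add: quad_haar_def)
    have \<delta>: "\<delta> = 0"
      by (rule delta(2)) (use sqrt_bounds in simp)
    have "rho v F lamF K lamK D 2 = v D * (1 / (1 + v \<pi> + v \<pi> ^ 2))"
      unfolding rho_2 \<delta> by simp
    thus "rho v F lamF K lamK D 2 = v D * (real q ^ 2 / (real q ^ 2 + real q + 1))"
      unfolding den(1) by simp
    show "\<forall>n\<ge>3. rho v F lamF K lamK D n = v D * (real q ^ 2 * (real q ^ 2 + 1)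
        / (real q ^ 4 + real q ^ 3 + real q ^ 2 + real q + 1))"
    proof (intro allI impI)
      fix n :: nat assume n: "3 \<le> n"
      let ?t = "v \<pi>" and ?a5 = "1 + v \<pi> + v \<pi> ^ 2 + v \<pi> ^ 3 + v \<pi> ^ 4"
      \<comment> \<open>With \<sigma>^2 = t the quotient of 1 + \<sigma>^2 t by 1 + t^2 is 1, so the
        general formula collapses to (t^2 + 1) over the quartic in t.\<close>
      have s: "sqrt ?t ^ 2 * ?t = ?t ^ 2"
        by (simp add: power2_eq_square)
      have "1 + ?t ^ 2 \<noteq> 0"
        using denominators_pos by auto
      hence "rho v F lamF K lamK D n = v D * ((?t ^ 2 + 1) / ?a5)"
        unfolding rho_ge_3[OF n] \<delta> s by simp
      also have "?t ^ 2 + 1 = (real q ^ 2 * (real q ^ 2 + 1)) / real q ^ 4"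
        unfolding R(3) power_one_over using q
        by (simp add: add_divide_distrib distrib_left flip: power_add) (simp add: eval_nat_numeral)
      finally show "rho v F lamF K lamK D n = v D * (real q ^ 2 * (real q ^ 2 + 1)
          / (real q ^ 4 + real q ^ 3 + real q ^ 2 + real q + 1))"
        unfolding den(2) using q by simp
    qed
  qed
qed

end
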